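(* Let $\mathcal{Q}\subset\mathbb{N}$ be an infinite set of positive integers, let $n\ge 1$ be an integer and let $\tau>2+1/n$ be a real number. Then the Hausdorff dimension of $W^*_{\tau,n}(\mathcal{Q})$ is $$\dim W^*_{\tau,n}(\mathcal{Q})=\frac{n+\nu(\mathcal{Q})}{\tau}.$$
   Context: For $\bm{x}\in\mathbb{R}^n$, $|\bm{x}|$ denotes the supremum norm, and for $\bm{p}=(p_1,\dots,p_n)\in\mathbb{Z}^n$, $q\in\mathbb{N}$, $\bm{p}/q=(p_1/q,\dots,p_n/q)$. For an infinite $\mathcal{S}\subset\mathbb{N}$ and $\tau>1$, let $W_{\tau,n}(\mathcal{S})=\{\bm{x}\in\mathbb{R}^n : |\bm{x}-\bm{p}/q|<q^{-\tau}\text{ for infinitely many }(\bm{p},q)\in\mathbb{Z}^n\times\mathcal{S}\}$ (for a finite set $\mathcal{S}$ this set is empty). Define the liminf set $W^*_{\tau,n}(\mathcal{Q})=W_{\tau,n}(\mathbb{N})\setminus W_{\tau,n}(\mathbb{N}\setminus\mathcal{Q})$, i.e. the set of $\bm{x}\in\mathbb{R}^n$ with infinitely many such approximations $(\bm{p},q)$ with $q\in\mathcal{Q}$ but only finitely many with $q\notin\mathcal{Q}$. The exponent of convergence of $\mathcal{Q}$ is $\nu(\mathcal{Q})=\inf\{\nu>0:\sum_{q\in\mathcal{Q}}q^{-\nu}<\infty\}\in[0,1]$. *)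

theory Defs
  imports "HOL-Analysis.Analysis"
begin

text \<open>
  The library function \<open>diameter\<close> is real-valued and meaningless on unbounded sets, so covers
  are required to consist of bounded sets. The gauge uses the convention that a nonempty set of
  diameter 0 has \<open>diam\<^sup>0 = 1\<close> (whereas \<open>0 powr 0 = 0\<close> in the library), so that the
  0-dimensional Hausdorff measure is the counting measure.
\<close>

definition hausdorff_gauge :: "real \<Rightarrow> 'a::metric_space set \<Rightarrow> ennreal" where
  "hausdorff_gauge s U =
     (if U = {} then 0 else if s = 0 then 1 else ennreal (diameter U powr s))"

definition hausdorff_premeasure :: "real \<Rightarrow> real \<Rightarrow> 'a::metric_space set \<Rightarrow> ennreal" where
  "hausdorff_premeasure s \<delta> A =
     Inf {(\<Sum>i. hausdorff_gauge s (U i)) | U :: nat \<Rightarrow> 'a set.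
            A \<subseteq> (\<Union>i. U i) \<and> (\<forall>i. bounded (U i) \<and> diameter (U i) \<le> \<delta>)}"

definition hausdorff_measure :: "real \<Rightarrow> 'a::metric_space set \<Rightarrow> ennreal" where
  "hausdorff_measure s A = (SUP \<delta>\<in>{0<..}. hausdorff_premeasure s \<delta> A)"

text \<open>
  On \<open>real ^ 'n\<close> the metric is the Euclidean one; the supremum metric is bi-Lipschitz
  equivalent to it and yields the same dimension.
\<close>

definition hausdorff_dim :: "'a::metric_space set \<Rightarrow> ereal" where
  "hausdorff_dim A = Inf {ereal s | s. 0 \<le> s \<and> hausdorff_measure s A = 0}"

definition rat_vec :: "int ^ 'n \<Rightarrow> nat \<Rightarrow> real ^ 'n" where
  "rat_vec p q = (\<chi> i. real_of_int (p $ i) / real q)"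

text \<open>
  The library's \<open>infnorm\<close> is the supremum norm. For finite \<open>S\<close> the set below is empty.
\<close>

definition W :: "real \<Rightarrow> nat set \<Rightarrow> (real ^ 'n) set" where
  "W \<tau> S = {x. infinite {(p :: int ^ 'n, q :: nat).
                  q \<in> S \<and> infnorm (x - rat_vec p q) < real q powr (-\<tau>)}}"

definition W_star :: "real \<Rightarrow> nat set \<Rightarrow> (real ^ 'n) set" where
  "W_star \<tau> Q = W \<tau> {1..} - W \<tau> ({1..} - Q)"

definition conv_exponent :: "nat set \<Rightarrow> real" where
  "conv_exponent Q = Inf {\<nu>. 0 < \<nu> \<and> (\<lambda>q. real q powr (-\<nu>)) summable_on Q}"

end

(*
Upper bound: W* lies in W(Q), which is covered by about q^n sup-balls of radius q^(-tau) for each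
large q in Q.

Lower bound: instead of building a measure on a Cantor set, play against a given cover U_i with
sizes d_i and small sum of d_i^s, where s < (n + nu)/tau. A nested sequence of boxes, each in the
annulus q^(-tau)/4 <= |x - p/q| < q^(-tau) of a reduced p/q with q in Q, is chosen so that the sum of
d_i^s over the U_i meeting the box stays below a multiple of (size of the box)^s. The sets meeting
all boxes would then have size 0, so the limit point is not covered. Given a box, the candidates for
the next one come from the reduced p/q in it with q in Q and N <= q < 2N, for a dyadic block holding
at least N^t elements of Q with t close to nu. Such rationals are well spread: sieving
gives equidistribution at scales above N^(-1/2), and counting solutions of |p q' - p' q| <= Y shows
that after deleting few of them the others are separated by nearly the optimal distance. Averaging over
the candidates a cost that counts covering sets and unwanted rationals v with
q_k^(tau-1)/2 <= v <= (4N)^(1/(tau-1)) produces a cheap one; all other denominators are excluded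
by the gap between distinct rationals.
*)

theory Submission
  imports Defs
begin

subsection \<open>Integer points in boxes and sieving\<close>

text \<open>Two counts lie behind the hypotheses. Sets of the cover too small to meet two children
  cost in total at most about \<open>N powr (\<tau> * s)\<close>, against roughly
  \<open>N powr (n + t)\<close> children: this gives the condition
  \<open>\<tau> * s < n + t\<close>, hence the dimension. An unwanted rational may spoil one child
  however tiny its ball is; those with denominator up to about
  \<open>N powr (1 / (\<tau> - 1))\<close> number at most about
  \<open>N powr ((n + 1) / (\<tau> - 1))\<close>, and this exponent is below \<open>n\<close>
  exactly when \<open>\<tau> > 2 + 1/n\<close>. The range of unwanted denominators reflects that
  distinct rationals \<open>u / v\<close> and \<open>p / q\<close> approximating one point satisfy
  \<open>v powr (\<tau> - 1) < 2 * q\<close> or \<open>q powr (\<tau> - 1) < 2 * v\<close>;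
  \<open>4 * N\<close> is twice the bound for the next denominator. The obstacle is that
  \<open>Q\<close> may be empty over long ranges and that constants depend on the parent box. So
  \<open>N\<close> is chosen after the box, large enough to absorb constants and factors
  \<open>N powr \<epsilon>\<close>. Against a fixed cover a single cheap child per box suffices, and
  averaging finds it without mass estimates at all scales between parent and child.\<close>

lemma infnorm_less_vec: "infnorm (x :: real ^ 'n) < D \<longleftrightarrow> (\<forall>i. \<bar>x $ i\<bar> < D)"
proof -
  have "finite {\<bar>x $ i\<bar> |i. i \<in> (UNIV :: 'n set)}" by (simp add: full_SetCompr_eq)
  then show ?thesis unfolding infnorm_cart
    by (subst cSup_eq_Max) (auto simp: full_SetCompr_eq)
qed

lemma infnorm_le_vec: "infnorm (x :: real ^ 'n) \<le> D \<longleftrightarrow> (\<forall>i. \<bar>x $ i\<bar> \<le> D)"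
proof -
  have "finite {\<bar>x $ i\<bar> |i. i \<in> (UNIV :: 'n set)}" by (simp add: full_SetCompr_eq)
  then show ?thesis unfolding infnorm_cart
    by (subst cSup_eq_Max) (auto simp: full_SetCompr_eq)
qed

lemma card_vec_box:
  fixes A :: "'n::finite \<Rightarrow> 'a set"
  shows "card {v :: 'a ^ 'n. \<forall>i. v $ i \<in> A i} = (\<Prod>i\<in>UNIV. card (A i))"
proof -
  have "bij_betw vec_nth {v :: 'a ^ 'n. \<forall>i. v $ i \<in> A i} (PiE UNIV A)"
    by (rule bij_betwI[where g = vec_lambda]) (auto simp: PiE_iff)
  then show ?thesis by (simp add: bij_betw_same_card card_PiE)
qed

lemma finite_vec_box:
  fixes A :: "'n::finite \<Rightarrow> 'a set"
  assumes "\<And>i. finite (A i)"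
  shows "finite {v :: 'a ^ 'n. \<forall>i. v $ i \<in> A i}"
proof -
  have "bij_betw vec_nth {v :: 'a ^ 'n. \<forall>i. v $ i \<in> A i} (PiE UNIV A)"
    by (rule bij_betwI[where g = vec_lambda]) (auto simp: PiE_iff)
  moreover have "finite (PiE UNIV A)" using assms by (intro finite_PiE) auto
  ultimately show ?thesis by (simp add: bij_betw_finite)
qed

lemma int_interval_eq: "{m::int. a < real_of_int m \<and> real_of_int m \<le> b} = {\<lfloor>a\<rfloor><..\<lfloor>b\<rfloor>}"
  by (auto simp: floor_less_iff le_floor_iff)

text \<open>Inclusion-exclusion by induction on \<open>S\<close>: the multiples of a new prime
  \<open>l\<close> correspond to an interval of length \<open>y / l\<close>, sieved by the same
  \<open>S\<close> because \<open>l\<close> is coprime to its members. Each prime doubles the error,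
  which therefore does not depend on \<open>y\<close>.\<close>

lemma sieve_interval:
  fixes S :: "int set"
  assumes "finite S" "\<And>l. l \<in> S \<Longrightarrow> prime l" "y \<ge> 0"
  shows "\<bar>real (card {m::int. a < real_of_int m \<and> real_of_int m \<le> a + y \<and> (\<forall>l\<in>S. \<not> l dvd m)})
     - y * (\<Prod>l\<in>S. 1 - 1 / real_of_int l)\<bar> \<le> 2 ^ card S"
  using assms
proof (induction S arbitrary: a y rule: finite_induct)
  case empty
  have "real (card {m::int. a < real_of_int m \<and> real_of_int m \<le> a + y}) = real_of_int (\<lfloor>a + y\<rfloor> - \<lfloor>a\<rfloor>)"
    unfolding int_interval_eq using empty by (simp add: floor_mono)
  then show ?case using empty by simp linarith
next
  case (insert l S)
  have l: "prime l" "l > 0" using insert by (auto simp: prime_gt_0_int)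
  define A where "A = (\<lambda>a y. {m::int. a < real_of_int m \<and> real_of_int m \<le> a + y \<and> (\<forall>l\<in>S. \<not> l dvd m)})"
  have finA: "finite (A a y)" for a y
  proof (rule finite_subset)
    show "A a y \<subseteq> {\<lfloor>a\<rfloor><..\<lfloor>a+y\<rfloor>}" unfolding A_def int_interval_eq[symmetric] by auto
  qed auto
  have ndvd: "\<not> k dvd l" if "k \<in> S" for k
    using that insert l by (metis insertI2 primes_dvd_imp_eq)
  have im: "{m \<in> A a y. l dvd m} = (\<lambda>m. l * m) ` A (a / real_of_int l) (y / real_of_int l)"
  proof (intro set_eqI iffI)
    fix m assume m: "m \<in> {m \<in> A a y. l dvd m}"
    then obtain k where k: "m = l * k" by auto
    have "k \<in> A (a / real_of_int l) (y / real_of_int l)"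
      using m l unfolding A_def k by (auto simp: field_simps)
    then show "m \<in> (\<lambda>m. l * m) ` A (a / real_of_int l) (y / real_of_int l)" using k by auto
  next
    fix m assume "m \<in> (\<lambda>m. l * m) ` A (a / real_of_int l) (y / real_of_int l)"
    then obtain k where k: "m = l * k" "k \<in> A (a / real_of_int l) (y / real_of_int l)" by auto
    have "\<not> j dvd l * k" if "j \<in> S" for j
    proof
      assume "j dvd l * k"
      moreover have "prime j" using insert that by auto
      ultimately have "j dvd k" using ndvd[OF that] by (simp add: prime_dvd_mult_iff)
      then show False using k that unfolding A_def by auto
    qed
    then show "m \<in> {m \<in> A a y. l dvd m}" using k l unfolding A_def by (auto simp: field_simps)
  qed
  have c1: "card {m \<in> A a y. l dvd m} = card (A (a / real_of_int l) (y / real_of_int l))"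
    unfolding im using l by (intro card_image) (auto simp: inj_on_def)
  have "{m::int. a < real_of_int m \<and> real_of_int m \<le> a + y \<and> (\<forall>k\<in>insert l S. \<not> k dvd m)}
     = A a y - {m \<in> A a y. l dvd m}" unfolding A_def by auto
  then have c2: "real (card {m::int. a < real_of_int m \<and> real_of_int m \<le> a + y \<and> (\<forall>k\<in>insert l S. \<not> k dvd m)})
    = real (card (A a y)) - real (card (A (a / real_of_int l) (y / real_of_int l)))"
    using finA c1 by (metis (no_types, lifting) card_Diff_subset card_mono finite_subset mem_Collect_eq of_nat_diff subsetI)
  have i1: "\<bar>real (card (A a y)) - y * (\<Prod>l\<in>S. 1 - 1 / real_of_int l)\<bar> \<le> 2 ^ card S"
    unfolding A_def by (rule insert.IH) (use insert in auto)
  have i2: "\<bar>real (card (A (a / real_of_int l) (y / real_of_int l))) - y / real_of_int l * (\<Prod>l\<in>S. 1 - 1 / real_of_int l)\<bar> \<le> 2 ^ card S"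
    unfolding A_def by (rule insert.IH) (use insert l in auto)
  have e: "y * (\<Prod>l\<in>insert l S. 1 - 1 / real_of_int l) = y * (\<Prod>l\<in>S. 1 - 1 / real_of_int l) - y / real_of_int l * (\<Prod>l\<in>S. 1 - 1 / real_of_int l)"
    using insert by (simp add: algebra_simps)
  have "\<bar>(u - v) - (w - x)\<bar> \<le> 2 * (z::real)" if "\<bar>u - w\<bar> \<le> z" "\<bar>v - x\<bar> \<le> z" for u v w x z
    using that by linarith
  from this[OF i1 i2] show ?case unfolding c2 e using insert by simp
qed

text \<open>For positive \<open>q\<close> this is Euler's phi(q) / q.\<close>

definition sieve_density :: "nat \<Rightarrow> real" where
  "sieve_density q = (\<Prod>l\<in>prime_factors (int q). 1 - 1 / real_of_int l)"

lemma coprime_count: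
  assumes "q > 0" "y \<ge> 0"
  shows "\<bar>real (card {m::int. a < real_of_int m \<and> real_of_int m \<le> a + y \<and> coprime m (int q)})
     - y * sieve_density q\<bar> \<le> 2 ^ card (prime_factors (int q))"
proof -
  have "coprime m (int q) \<longleftrightarrow> (\<forall>l\<in>prime_factors (int q). \<not> l dvd m)" for m
  proof -
    have "\<exists>p. prime p \<and> p dvd m \<and> p dvd int q" if "\<not> coprime m (int q)"
    proof -
      have "gcd m (int q) \<noteq> 0" "\<not> is_unit (gcd m (int q))" using assms that by (auto simp: is_unit_gcd)
      then obtain p where "p dvd gcd m (int q)" "prime p" using prime_divisor_exists by blast
      then show ?thesis by auto
    qed
    moreover have False if "coprime m (int q)" "prime p" "p dvd m" "p dvd int q" for p
      using that coprime_common_divisor not_prime_unit by blast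
    ultimately have "coprime m (int q) \<longleftrightarrow> \<not> (\<exists>p. prime p \<and> p dvd m \<and> p dvd int q)" by blast
    then show ?thesis using assms by (auto simp: prime_factors_dvd)
  qed
  then show ?thesis unfolding sieve_density_def
    using sieve_interval[of "prime_factors (int q)" y a] assms by auto
qed

lemma sieve_density_ge:
  "sieve_density q \<ge> 1 / 2 ^ card (prime_factors (int q))"
proof -
  have "(\<Prod>l\<in>prime_factors (int q). 1/2) \<le> sieve_density q"
    unfolding sieve_density_def
  proof (rule prod_mono)
    fix l assume "l \<in> prime_factors (int q)"
    then have "l \<ge> 2" using prime_ge_2_int by blast
    then show "0 \<le> (1/2::real) \<and> 1/2 \<le> 1 - 1 / real_of_int l" by (simp add: field_simps)
  qed
  then show ?thesis by (simp add: power_one_over)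
qed

lemma prod_prime_factors_le:
  assumes "q > 0" shows "(\<Prod>l\<in>prime_factors (int q). real_of_int l) \<le> real q"
proof -
  have "(\<Prod>l\<in>prime_factors (int q). l) dvd (\<Prod>l\<in>prime_factors (int q). l ^ multiplicity l (int q))"
  proof (rule prod_dvd_prod)
    fix l assume "l \<in> prime_factors (int q)"
    then have "multiplicity l (int q) > 0" by (simp add: prime_factors_multiplicity)
    then show "l dvd l ^ multiplicity l (int q)" by (simp add: dvd_power)
  qed
  also have "\<dots> = int q" using prod_prime_factors[of "int q"] assms by simp
  finally have "(\<Prod>l\<in>prime_factors (int q). l) \<le> int q" using assms by (simp add: zdvd_imp_le)
  then have "real_of_int (\<Prod>l\<in>prime_factors (int q). l) \<le> real_of_int (int q)" by (simp only: of_int_le_iff)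
  then show ?thesis by simp
qed

text \<open>Only primes below \<open>2 powr (1 / \<epsilon>)\<close> contribute a factor 2 that
  \<open>l powr \<epsilon>\<close> does not pay for, and their number is bounded. Sieve errors thus
  become losses of an arbitrarily small power.\<close>

lemma two_pow_omega_le:
  assumes "\<epsilon> > 0"
  shows "\<exists>C\<ge>1. \<forall>q>0. 2 ^ card (prime_factors (int q)) \<le> C * real q powr \<epsilon>"
proof -
  define P where "P = \<lceil>2 powr (1/\<epsilon>)\<rceil>"
  have big: "2 \<le> real_of_int l powr \<epsilon>" if "l \<ge> P" for l
  proof -
    have "2 powr (1/\<epsilon>) \<le> real_of_int l" using that unfolding P_def by linarith
    then have "(2 powr (1/\<epsilon>)) powr \<epsilon> \<le> real_of_int l powr \<epsilon>" using assms by (intro powr_mono2) auto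
    then show ?thesis using assms by (simp add: powr_powr)
  qed
  have "2 ^ card (prime_factors (int q)) \<le> 2 ^ nat P * real q powr \<epsilon>" if "q > 0" for q
  proof -
    let ?F = "prime_factors (int q)"
    have sp: "l \<ge> 2" if "l \<in> ?F" for l using that prime_ge_2_int by blast
    have "(2::real) ^ card ?F = (\<Prod>l\<in>?F. 2)" by simp
    also have "\<dots> \<le> (\<Prod>l\<in>?F. (if l < P then 2 else 1) * real_of_int l powr \<epsilon>)"
    proof (rule prod_mono, intro conjI)
      fix l assume "l \<in> ?F"
      then have "l \<ge> 2" by (rule sp)
      then have "1 \<le> real_of_int l powr \<epsilon>" using assms by (intro ge_one_powr_ge_zero) auto
      then show "2 \<le> (if l < P then 2 else 1) * real_of_int l powr \<epsilon>" using big[of l] by auto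
    qed auto
    also have "\<dots> = (\<Prod>l\<in>?F. if l < P then 2 else 1) * (\<Prod>l\<in>?F. real_of_int l) powr \<epsilon>"
      by (simp add: prod.distrib prod_powr_distrib)
    also have "(\<Prod>l\<in>?F. if l < P then 2 else (1::real)) = (\<Prod>l\<in>{l\<in>?F. l < P}. 2)"
      by (rule prod.inter_filter[symmetric]) simp
    also have "\<dots> = 2 ^ card {l\<in>?F. l < P}" by simp
    also have "\<dots> * (\<Prod>l\<in>?F. real_of_int l) powr \<epsilon> \<le> 2 ^ nat P * real q powr \<epsilon>"
    proof (intro mult_mono)
      have "{l\<in>?F. l < P} \<subseteq> {0..<P}" using sp by force
      then have "card {l\<in>?F. l < P} \<le> card {0..<P}" by (intro card_mono) auto
      then show "(2::real) ^ card {l\<in>?F. l < P} \<le> 2 ^ nat P" by simp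
      show "(\<Prod>l\<in>?F. real_of_int l) powr \<epsilon> \<le> real q powr \<epsilon>"
      proof (rule powr_mono2)
        show "0 \<le> (\<Prod>l\<in>?F. real_of_int l)"
        proof (rule prod_nonneg)
          fix l assume "l \<in> ?F"
          from sp[OF this] show "0 \<le> real_of_int l" by simp
        qed
      qed (use assms prod_prime_factors_le[OF \<open>q>0\<close>] in auto)
    qed auto
    finally show ?thesis .
  qed
  moreover have "(1::real) \<le> 2 ^ nat P" by simp
  ultimately show ?thesis by blast
qed

subsection \<open>Close pairs of rationals\<close>

text \<open>
  The value \<open>a * q' - b * q\<close> is a multiple of \<open>g = gcd q q'\<close>, and for a fixed value the solutions
  \<open>a\<close> form a single class modulo \<open>q / g\<close>: the two factors \<open>g\<close> cancel in the count.
\<close>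

lemma close_pair_count:
  fixes q q' :: nat and A Y :: real
  assumes "q > 0" "q' > 0" "real (gcd q q') \<le> Y"
  defines "E \<equiv> {(a :: int, b :: int). A < real_of_int a \<and> real_of_int a \<le> A + real q \<and>
      \<bar>real_of_int (a * int q' - b * int q)\<bar> \<le> Y}"
  shows "finite E" and "real (card E) \<le> 6 * Y"
proof -
  define g where "g = int (gcd q q')"
  define h where "h = int q div g"
  have g: "g > 0" "g dvd int q" "g dvd int q'" using assms by (auto simp: g_def)
  have qh: "int q = g * h" using g by (simp add: h_def)
  have h: "h > 0" using qh g(1) assms(1) zero_less_mult_pos[of g h] by simp
  define f where "f = (\<lambda>(a::int, b::int). ((a * int q' - b * int q) div g, a div h))"
  have inj: "inj_on f E"
  proof (rule inj_onI)
    fix x y assume "x \<in> E" "y \<in> E" and fxy: "f x = f y"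
    obtain a b a' b' where xy: "x = (a, b)" "y = (a', b')" by (cases x, cases y) auto
    from fxy have "f (a, b) = f (a', b')" unfolding xy .
    then have 1: "(a * int q' - b * int q) div g = (a' * int q' - b' * int q) div g" and 2: "a div h = a' div h"
      by (auto simp: f_def)
    have "g dvd (a * int q' - b * int q)" "g dvd (a' * int q' - b' * int q)" using g by auto
    with 1 have "a * int q' - b * int q = a' * int q' - b' * int q" by (metis dvd_div_mult_self)
    then have eq: "(a - a') * int q' = (b - b') * int q" by (simp add: algebra_simps)
    obtain h' where h': "int q' = g * h'" using g by blast
    have h'': "h' = int q' div g" using h' g by simp
    have "coprime (int q div gcd (int q) (int q')) (int q' div gcd (int q) (int q'))"
      by (rule div_gcd_coprime) (use assms(1) in auto)
    then have cop: "coprime h h'" unfolding h'' h_def g_def by simp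
    have "g * ((a - a') * h') = g * ((b - b') * h)" using eq unfolding qh h' by (simp add: algebra_simps)
    then have "(a - a') * h' = (b - b') * h" using g by simp
    then have "h dvd (a - a') * h'" by simp
    then have "h dvd a - a'" using cop coprime_dvd_mult_left_iff by blast
    then have "a mod h = a' mod h" by (simp add: mod_eq_dvd_iff)
    with 2 have "a = a'" by (metis div_mult_mod_eq)
    with eq show "x = y" using assms unfolding xy by auto
  qed
  \<comment> \<open>At most \<open>2 * v + 1\<close> multiples of \<open>g\<close> are admissible
    values, and an interval of length \<open>q = g * h\<close> meets at most \<open>g + 1\<close>
    blocks of length \<open>h\<close>. The hypothesis \<open>gcd q q' \<le> Y\<close> gives
    \<open>v \<ge> 1\<close>, so the product is at most \<open>(3 * v) * (2 * g)\<close>.\<close>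
  define v where "v = \<lfloor>Y / real_of_int g\<rfloor>"
  define T where "T = {- v..v} \<times> {\<lfloor>A\<rfloor> div h..\<lfloor>A\<rfloor> div h + g}"
  have im: "f ` E \<subseteq> T"
  proof (rule image_subsetI)
    fix x assume "x \<in> E"
    obtain a b where x: "x = (a, b)" by (cases x)
    with \<open>x \<in> E\<close> have "(a, b) \<in> E" by simp
    then have ab: "A < real_of_int a" "real_of_int a \<le> A + real q" "\<bar>real_of_int (a * int q' - b * int q)\<bar> \<le> Y"
      by (auto simp: E_def)
    define w where "w = (a * int q' - b * int q) div g"
    have "g dvd (a * int q' - b * int q)" using g by auto
    then have wg: "a * int q' - b * int q = g * w" by (simp add: w_def)
    have "real_of_int g * \<bar>real_of_int w\<bar> \<le> Y" using ab(3) unfolding wg using g by (simp add: abs_mult)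
    then have "\<bar>real_of_int w\<bar> \<le> Y / real_of_int g" using g by (simp add: field_simps)
    then have w: "w \<in> {-v..v}" unfolding v_def by simp linarith
    have "\<lfloor>A\<rfloor> \<le> a" "a \<le> \<lfloor>A\<rfloor> + g * h" using ab(1,2) unfolding qh[symmetric] by linarith+
    then have "\<lfloor>A\<rfloor> div h \<le> a div h" "a div h \<le> (\<lfloor>A\<rfloor> + g * h) div h" using h zdiv_mono1 by blast+
    moreover have "(\<lfloor>A\<rfloor> + g * h) div h = \<lfloor>A\<rfloor> div h + g" using h by simp
    ultimately show "f x \<in> T" using w unfolding x T_def f_def w_def by auto
  qed
  have finT: "finite T" unfolding T_def by auto
  show "finite E" by (rule finite_imageD[OF finite_subset[OF im finT] inj])
  have gY: "real_of_int g \<le> Y" using assms(3) g_def by simp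
  have v: "v \<ge> 1" unfolding v_def using gY g by simp
  have v2: "real_of_int v \<le> Y / real_of_int g" unfolding v_def by simp
  have "card E \<le> card T" by (rule card_inj_on_le[OF inj im finT])
  then have "real (card E) \<le> real (card T)" by simp
  also have "real (card T) = real_of_int (2 * v + 1) * real_of_int (g + 1)"
    unfolding T_def card_cartesian_product using v g by simp
  also have "\<dots> \<le> (3 * real_of_int v) * (2 * real_of_int g)" using v g by (intro mult_mono) auto
  also have "\<dots> \<le> 6 * Y" using v2 g by (simp add: field_simps)
  finally show "real (card E) \<le> 6 * Y" .
qed

lemma close_vec_pair_count:
  fixes q q' :: nat and A :: "'n::finite \<Rightarrow> real" and Y :: real
  assumes "q > 0" "q' > 0" "real (gcd q q') \<le> Y"
  defines "E \<equiv> {(p :: int ^ 'n, p' :: int ^ 'n). \<forall>i. A i < real_of_int (p $ i) \<and> real_of_int (p $ i) \<le> A i + real q \<and>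
      \<bar>real_of_int (p $ i * int q' - p' $ i * int q)\<bar> \<le> Y}"
  shows "finite E" and "real (card E) \<le> (6 * Y) ^ CARD('n)"
proof -
  define B where "B = (\<lambda>i. {(a :: int, b :: int). A i < real_of_int a \<and> real_of_int a \<le> A i + real q \<and>
      \<bar>real_of_int (a * int q' - b * int q)\<bar> \<le> Y})"
  have B: "finite (B i)" "real (card (B i)) \<le> 6 * Y" for i
    using close_pair_count[OF assms(1-3), of "A i"] unfolding B_def by auto
  define f where "f = (\<lambda>(p :: int ^ 'n, p' :: int ^ 'n). (\<chi> i. (p $ i, p' $ i)))"
  have "inj f" by (auto simp: inj_def f_def vec_eq_iff)
  then have inj: "inj_on f E" by (rule inj_on_subset) auto
  have im: "f ` E \<subseteq> {v. \<forall>i. v $ i \<in> B i}" unfolding f_def E_def B_def by auto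
  have fin: "finite {v. \<forall>i. v $ i \<in> B i}" using B by (intro finite_vec_box)
  show "finite E" by (rule finite_imageD[OF finite_subset[OF im fin] inj])
  have "card E \<le> card {v. \<forall>i. v $ i \<in> B i}" by (rule card_inj_on_le[OF inj im fin])
  also have "\<dots> = (\<Prod>i\<in>UNIV. card (B i))" by (rule card_vec_box)
  finally have "real (card E) \<le> (\<Prod>i\<in>UNIV. real (card (B i)))" by (simp flip: of_nat_prod)
  also have "\<dots> \<le> (\<Prod>i\<in>(UNIV::'n set). 6 * Y)" using B by (intro prod_mono) auto
  finally show "real (card E) \<le> (6 * Y) ^ CARD('n)" by simp
qed

text \<open>Coprimality in the single coordinate \<open>k\<close> already makes
  \<open>(p, q)\<close> reduced and leaves only one coordinate to sieve. The half-open box turns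
  coordinate counts into differences of floors.\<close>

definition box_rationals :: "'n::finite \<Rightarrow> real ^ 'n \<Rightarrow> real \<Rightarrow> nat set \<Rightarrow> ((int ^ 'n) \<times> nat) set" where
  "box_rationals k c r R = {(p, q). q \<in> R \<and> coprime (p $ k) (int q) \<and>
     (\<forall>i. c $ i - r < rat_vec p q $ i \<and> rat_vec p q $ i \<le> c $ i + r)}"

text \<open>The expected number of points of \<open>box_rationals\<close> per unit volume.\<close>

definition rationals_weight :: "nat \<Rightarrow> nat set \<Rightarrow> real" where
  "rationals_weight n R = (\<Sum>q\<in>R. real q ^ n * sieve_density q)"

lemma finite_int_interval: "finite {m::int. a < real_of_int m \<and> real_of_int m \<le> b \<and> P m}"
  by (rule finite_subset[of _ "{\<lfloor>a\<rfloor><..\<lfloor>b\<rfloor>}"]) (auto simp: floor_less_iff le_floor_iff)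

lemma sieve_density_nonneg: "sieve_density q \<ge> 0"
  by (rule order_trans[OF _ sieve_density_ge]) simp

text \<open>The count factors over the coordinates: coordinate \<open>k\<close> is sieved, the
  others count all integers. The premises of the second claim make the errors at most half of the
  main terms \<open>2 * r * q * sieve_density q\<close> and \<open>2 * r * q\<close>.\<close>

lemma box_rationals_fibre:
  fixes c :: "real ^ 'n" and r :: real and q :: nat and k :: 'n
  assumes "q > 0" "r > 0"
  defines "F \<equiv> {p :: int ^ 'n. coprime (p $ k) (int q) \<and>
     (\<forall>i. c $ i - r < rat_vec p q $ i \<and> rat_vec p q $ i \<le> c $ i + r)}"
  shows "finite F"
    and "\<lbrakk>2 ^ card (prime_factors (int q)) \<le> r * real q * sieve_density q; 1 \<le> r * real q\<rbrakk> \<Longrightarrow>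
       r ^ CARD('n) * (real q ^ CARD('n) * sieve_density q) \<le> real (card F)
     \<and> real (card F) \<le> (4 * r) ^ CARD('n) * (real q ^ CARD('n) * sieve_density q)"
proof -
  let ?I = "\<lambda>i. {m::int. real q * (c $ i - r) < real_of_int m \<and> real_of_int m \<le> real q * (c $ i - r) + 2 * r * real q}"
  let ?J = "\<lambda>i. {m::int. real q * (c $ i - r) < real_of_int m \<and> real_of_int m \<le> real q * (c $ i - r) + 2 * r * real q \<and> coprime m (int q)}"
  define B where "B = (\<lambda>i. if i = k then ?J i else ?I i)"
  have FB: "F = {p. \<forall>i. p $ i \<in> B i}"
  proof -
    have "(c $ i - r < rat_vec p q $ i \<and> rat_vec p q $ i \<le> c $ i + r) \<longleftrightarrow> p $ i \<in> ?I i" for p :: "int ^ 'n" and i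
      using assms(1) unfolding rat_vec_def by (auto simp: field_simps)
    then show ?thesis unfolding F_def B_def by (auto split: if_splits)
  qed
  have finB: "finite (B i)" for i 
  proof (cases "i = k")
    case True
    then show ?thesis unfolding B_def by (simp add: finite_int_interval)
  next
    case False
    then show ?thesis unfolding B_def int_interval_eq by simp
  qed
  then show "finite F" unfolding FB by (rule finite_vec_box)
  have "card F = (\<Prod>i\<in>UNIV. card (B i))" unfolding FB by (rule card_vec_box)
  also have "\<dots> = card (?J k) * (\<Prod>i\<in>UNIV - {k}. card (B i))" by (subst prod.remove[of _ k]) (auto simp: B_def)
  also have "(\<Prod>i\<in>UNIV - {k}. card (B i)) = (\<Prod>i\<in>UNIV - {k}. card (?I i))" by (rule prod.cong) (auto simp: B_def)
  finally have cF: "real (card F) = real (card (?J k)) * (\<Prod>i\<in>UNIV - {k}. real (card (?I i)))" by simp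
  assume a: "2 ^ card (prime_factors (int q)) \<le> r * real q * sieve_density q" "1 \<le> r * real q"
  let ?y = "r * real q"
  have "\<bar>real (card (?J k)) - 2 * ?y * sieve_density q\<bar> \<le> 2 ^ card (prime_factors (int q))"
    using coprime_count[of q "2 * ?y" "real q * (c $ k - r)"] assms by (simp add: algebra_simps)
  then have J: "?y * sieve_density q \<le> real (card (?J k))" "real (card (?J k)) \<le> 4 * ?y * sieve_density q"
    using a by linarith+
  have I: "?y \<le> real (card (?I i))" "real (card (?I i)) \<le> 4 * ?y" for i
  proof -
    have "real (card (?I i)) = real_of_int (\<lfloor>real q * (c $ i - r) + 2 * r * real q\<rfloor> - \<lfloor>real q * (c $ i - r)\<rfloor>)"
      unfolding int_interval_eq using assms by (simp add: floor_mono)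
    moreover have "2 * r * real q = 2 * ?y" by simp
    ultimately show "?y \<le> real (card (?I i))" "real (card (?I i)) \<le> 4 * ?y"
      using a(2) by linarith+
  qed
  have card': "card (UNIV - {k} :: 'n set) = CARD('n) - 1" by simp
  have pw: "x * x ^ (CARD('n) - 1) = x ^ CARD('n)" for x :: real
    using power_Suc[of x "CARD('n) - 1"] by (simp del: power_Suc)
  define P where "P = (\<Prod>i\<in>UNIV - {k}. real (card (?I i)))"
  define J where "J = real (card (?J k))"
  have "(\<Prod>i\<in>UNIV - {k}. ?y) \<le> P" unfolding P_def using I(1) a(2) by (intro prod_mono) simp
  then have P1: "?y ^ (CARD('n) - 1) \<le> P" using card' by simp
  have "P \<le> (\<Prod>i\<in>UNIV - {k}. 4 * ?y)" unfolding P_def using I(2) by (intro prod_mono) simp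
  then have P2: "P \<le> (4 * ?y) ^ (CARD('n) - 1)" using card' by simp
  have cF': "real (card F) = J * P" using cF unfolding P_def J_def .
  have J1: "?y * sieve_density q \<le> J" "J \<le> 4 * ?y * sieve_density q" "J \<ge> 0" using J unfolding J_def by auto
  have P0: "0 \<le> ?y ^ (CARD('n) - 1)" using a(2) by simp
  have "?y ^ CARD('n) * sieve_density q = (?y * sieve_density q) * ?y ^ (CARD('n) - 1)"
    using pw[of ?y] by (simp add: ac_simps)
  also have "\<dots> \<le> real (card F)" unfolding cF' using J1 P1 P0
    by (intro mult_mono) auto
  finally have l: "?y ^ CARD('n) * sieve_density q \<le> real (card F)" .
  have "real (card F) \<le> (4 * ?y * sieve_density q) * (4 * ?y) ^ (CARD('n) - 1)"
    unfolding cF' using J1 P2 P0 P1 by (intro mult_mono) linarith+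
  also have "\<dots> = (4 * ?y) ^ CARD('n) * sieve_density q" using pw[of "4 * ?y"] by (simp add: ac_simps)
  finally have u: "real (card F) \<le> (4 * ?y) ^ CARD('n) * sieve_density q" .
  show "r ^ CARD('n) * (real q ^ CARD('n) * sieve_density q) \<le> real (card F)
     \<and> real (card F) \<le> (4 * r) ^ CARD('n) * (real q ^ CARD('n) * sieve_density q)"
    using l u by (simp add: power_mult_distrib ac_simps)
qed

lemma box_rationals_count:
  fixes c :: "real ^ 'n" and r :: real and k :: 'n
  assumes "finite R" "\<And>q. q \<in> R \<Longrightarrow> q > 0" "r > 0"
  shows "finite (box_rationals k c r R)"
    and "(\<And>q. q \<in> R \<Longrightarrow> 2 ^ card (prime_factors (int q)) \<le> r * real q * sieve_density q \<and> 1 \<le> r * real q) \<Longrightarrow>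
       r ^ CARD('n) * rationals_weight CARD('n) R \<le> real (card (box_rationals k c r R))
     \<and> real (card (box_rationals k c r R)) \<le> (4 * r) ^ CARD('n) * rationals_weight CARD('n) R"
proof -
  define F where "F = (\<lambda>q. {p :: int ^ 'n. coprime (p $ k) (int q) \<and>
     (\<forall>i. c $ i - r < rat_vec p q $ i \<and> rat_vec p q $ i \<le> c $ i + r)})"
  have P: "box_rationals k c r R = prod.swap ` (SIGMA q:R. F q)" 
  proof (intro set_eqI iffI)
    fix x assume "x \<in> box_rationals k c r R"
    then have "(snd x, fst x) \<in> (SIGMA q:R. F q)" unfolding box_rationals_def F_def by auto
    then show "x \<in> prod.swap ` (SIGMA q:R. F q)" by (metis image_eqI swap_simp prod.collapse)
  qed (auto simp: box_rationals_def F_def)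
  have fF: "finite (F q)" if "q \<in> R" for q unfolding F_def using box_rationals_fibre(1) assms that by blast
  show "finite (box_rationals k c r R)" unfolding P using fF assms by auto
  have "card (box_rationals k c r R) = card (SIGMA q:R. F q)" unfolding P by (rule card_image) auto
  also have "\<dots> = (\<Sum>q\<in>R. card (F q))" using fF assms by simp
  finally have c: "real (card (box_rationals k c r R)) = (\<Sum>q\<in>R. real (card (F q)))" by simp
  assume a: "\<And>q. q \<in> R \<Longrightarrow> 2 ^ card (prime_factors (int q)) \<le> r * real q * sieve_density q \<and> 1 \<le> r * real q"
  have b: "r ^ CARD('n) * (real q ^ CARD('n) * sieve_density q) \<le> real (card (F q))
     \<and> real (card (F q)) \<le> (4 * r) ^ CARD('n) * (real q ^ CARD('n) * sieve_density q)" if "q \<in> R" for q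
    unfolding F_def using box_rationals_fibre(2)[of q r k c] assms a that by blast
  show "r ^ CARD('n) * rationals_weight CARD('n) R \<le> real (card (box_rationals k c r R))
     \<and> real (card (box_rationals k c r R)) \<le> (4 * r) ^ CARD('n) * rationals_weight CARD('n) R"
    unfolding c rationals_weight_def sum_distrib_left by (intro conjI sum_mono) (use b in blast)+
qed

subsection \<open>Well-spread families of rationals\<close>

text \<open>Largeness conditions on \<open>N\<close> and \<open>q\<close> are put in this form, so
  that only exponents have to be compared.\<close>

lemma eventually_powr_dominated:
  fixes a b K :: real
  assumes "a < b"
  shows "eventually (\<lambda>N::nat. K * real N powr a \<le> real N powr b) sequentially"
proof -
  have "((\<lambda>x::real. x powr (a - b)) \<longlongrightarrow> 0) at_top"
    using tendsto_neg_powr[of "a - b" "\<lambda>x. x" at_top] assms by (simp add: filterlim_ident)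
  then have "((\<lambda>N::nat. real N powr (a - b)) \<longlongrightarrow> 0) sequentially"
    by (rule filterlim_compose) (rule filterlim_real_sequentially)
  then have "eventually (\<lambda>N::nat. real N powr (a - b) < 1 / (\<bar>K\<bar> + 1)) sequentially"
    by (rule order_tendstoD) simp
  then show ?thesis
    using eventually_gt_at_top[of 0]
  proof eventually_elim
    case (elim N)
    have "K * real N powr a \<le> (\<bar>K\<bar> + 1) * real N powr a" by (intro mult_right_mono) auto
    also have "\<dots> = (\<bar>K\<bar> + 1) * real N powr (a - b) * real N powr b"
      using elim by (simp add: powr_diff)
    also have "\<dots> \<le> 1 * real N powr b" using elim by (intro mult_right_mono) (simp_all add: field_simps)
    finally show ?case by simp
  qed
qed

lemma sieve_density_le_1: "sieve_density q \<le> 1"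
  unfolding sieve_density_def
proof (rule prod_le_1)
  fix l assume "l \<in> prime_factors (int q)"
  then have "l \<ge> 2" using prime_ge_2_int by blast
  then show "0 \<le> 1 - 1 / real_of_int l \<and> 1 - 1 / real_of_int l \<le> 1" by (simp add: field_simps)
qed

lemma rat_vec_diff_nth:
  assumes "q > 0" "q' > 0"
  shows "real q * real q' * (rat_vec p q - rat_vec p' q') $ i = real_of_int (p $ i * int q' - p' $ i * int q)"
  using assms by (simp add: rat_vec_def field_simps)

lemma reduced_eqI:
  fixes p p' :: "int ^ 'n"
  assumes "q > 0" "q' > 0" "coprime (p $ k) (int q)" "coprime (p' $ l) (int q')"
    and eq: "\<And>i. p $ i * int q' = p' $ i * int q"
  shows "(p, q) = (p', q')"
proof -
  have "int q dvd p $ k * int q'" using eq[of k] by simp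
  then have 1: "int q dvd int q'" using assms(3) by (metis coprime_commute coprime_dvd_mult_right_iff)
  have "int q' dvd p' $ l * int q" using eq[of l] by (metis dvd_triv_right)
  then have 2: "int q' dvd int q" using assms(4) by (metis coprime_commute coprime_dvd_mult_right_iff)
  have "q = q'" using 1 2 by (simp add: dvd_antisym)
  then show ?thesis using eq assms(1) by (auto simp: vec_eq_iff)
qed

text \<open>Each pair of denominators obeys \<open>close_vec_pair_count\<close> with
  \<open>Y = 4 * \<delta> * N ^ 2\<close>, as both are below \<open>2 * N\<close>. If their gcd
  exceeds \<open>Y\<close>, the differences \<open>p $ i * q' - p' $ i * q\<close>, being multiples
  of it, all vanish; reducedness makes the two points equal, so there is no pair. The bound
  \<open>r \<le> 1/2\<close> keeps the numerators over \<open>q\<close> in an interval of length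
  \<open>q\<close>.\<close>

lemma close_box_rationals_count:
  fixes c :: "real ^ 'n" and r \<delta> :: real and k :: 'n
  assumes R: "R \<subseteq> {N..<2*N}" and N: "N > 0" and r: "0 < r" "r \<le> 1/2" and \<delta>: "\<delta> \<ge> 0"
  defines "E \<equiv> {(P, P'). P \<in> box_rationals k c r R \<and> P' \<in> box_rationals k c r R \<and> P \<noteq> P' \<and>
      infnorm (rat_vec (fst P) (snd P) - rat_vec (fst P') (snd P')) \<le> \<delta>}"
  shows "finite E" "real (card E) \<le> real (card R) ^ 2 * (24 * \<delta> * real N ^ 2) ^ CARD('n)"
proof -
  have finR: "finite R" and Rpos: "\<And>q. q \<in> R \<Longrightarrow> q > 0" using R N finite_subset by fastforce+
  have finP: "finite (box_rationals k c r R)" using box_rationals_count(1) finR Rpos r by blast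
  have "E \<subseteq> box_rationals k c r R \<times> box_rationals k c r R" unfolding E_def by auto
  then show finE: "finite E" using finP by (meson finite_SigmaI finite_subset)
  define Y where "Y = 4 * \<delta> * real N ^ 2"
  define F where "F = (\<lambda>(q, q'). {(P, P') \<in> E. snd P = q \<and> snd P' = q'})"
  have cF: "real (card (F z)) \<le> (6 * Y) ^ CARD('n)" if z: "z \<in> R \<times> R" for z
  proof -
    obtain q q' where qq: "z = (q, q')" by (cases z)
    have q: "q \<in> R" "q' \<in> R" "q > 0" "q' > 0" "q \<le> 2 * N" "q' \<le> 2 * N" using z R Rpos unfolding qq by auto
    have inb: "\<bar>real_of_int (p $ i * int q' - p' $ i * int q)\<bar> \<le> Y" if "((p, q), (p', q')) \<in> E" for p p' i
    proof -
      have "\<bar>(rat_vec p q - rat_vec p' q') $ i\<bar> \<le> \<delta>" using that unfolding E_def infnorm_le_vec by auto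
      then have "real q * real q' * \<bar>(rat_vec p q - rat_vec p' q') $ i\<bar> \<le> (2 * real N) * (2 * real N) * \<delta>"
        using q by (intro mult_mono) auto
      then show ?thesis using rat_vec_diff_nth[OF q(3,4), of p p' i, symmetric] unfolding Y_def
        by (simp add: abs_mult power2_eq_square mult_ac del: vector_minus_component)
    qed
    have A: "real q * (c $ i - r) < real_of_int (p $ i) \<and> real_of_int (p $ i) \<le> real q * (c $ i - r) + real q"
      if "(p, q) \<in> box_rationals k c r R" for p i
    proof -
      have "c $ i - r < real_of_int (p $ i) / real q" "real_of_int (p $ i) / real q \<le> c $ i + r"
        using that unfolding box_rationals_def rat_vec_def by auto
      then have "real q * (c $ i - r) < real_of_int (p $ i)" "real_of_int (p $ i) \<le> real q * (c $ i + r)"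
        using q by (simp_all add: field_simps)
      moreover have "real q * (c $ i + r) \<le> real q * (c $ i - r + 1)" using r by (intro mult_left_mono) auto
      ultimately show ?thesis by (simp add: algebra_simps)
    qed
    show ?thesis
    proof (cases "real (gcd q q') \<le> Y")
      case True
      define G where "G = {(p :: int ^ 'n, p' :: int ^ 'n). \<forall>i. real q * (c $ i - r) < real_of_int (p $ i) \<and> real_of_int (p $ i) \<le> real q * (c $ i - r) + real q \<and>
        \<bar>real_of_int (p $ i * int q' - p' $ i * int q)\<bar> \<le> Y}"
      have G: "finite G" "real (card G) \<le> (6 * Y) ^ CARD('n)"
        using close_vec_pair_count[OF q(3,4) True, of "\<lambda>i. real q * (c $ i - r)"] unfolding G_def by auto
      have "F z \<subseteq> (\<lambda>(p, p'). ((p, q), (p', q'))) ` G"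
      proof
        fix x assume x: "x \<in> F z"
        then obtain p p' where x': "x = ((p, q), (p', q'))" "((p, q), (p', q')) \<in> E" unfolding F_def qq by (cases x) auto
        have "(p, q) \<in> box_rationals k c r R" using x' unfolding E_def by auto
        then have "(p, p') \<in> G" unfolding G_def using A inb[OF x'(2)] by auto
        then show "x \<in> (\<lambda>(p, p'). ((p, q), (p', q'))) ` G" using x' by force
      qed
      then have "card (F z) \<le> card G" using G(1) by (rule surj_card_le[rotated])
      then show ?thesis using G(2) by linarith
    next
      case False
      have "F z = {}"
      proof (rule ccontr)
        assume "F z \<noteq> {}"
        then obtain p p' where x: "((p, q), (p', q')) \<in> E" unfolding F_def qq by auto
        have "p $ i * int q' = p' $ i * int q" for i
        proof (rule ccontr)
          assume ne: "p $ i * int q' \<noteq> p' $ i * int q"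
          have "int (gcd q q') dvd p $ i * int q' - p' $ i * int q" by simp
          then have "int (gcd q q') \<le> \<bar>p $ i * int q' - p' $ i * int q\<bar>" using ne by (intro zdvd_imp_le) auto
          then have "real (gcd q q') \<le> \<bar>real_of_int (p $ i * int q' - p' $ i * int q)\<bar>" by linarith
          then show False using inb[OF x, of i] False by linarith
        qed
        moreover have "coprime (p $ k) (int q)" "coprime (p' $ k) (int q')" using x unfolding E_def box_rationals_def by auto
        ultimately have "(p, q) = (p', q')" using reduced_eqI q by blast
        then show False using x unfolding E_def by auto
      qed
      then show ?thesis using \<delta> unfolding Y_def by simp
    qed
  qed
  have "E = (\<Union>z\<in>R\<times>R. F z)" unfolding F_def E_def box_rationals_def by auto
  then have "card E \<le> (\<Sum>z\<in>R\<times>R. card (F z))" using card_UN_le[of "R \<times> R" F] finR by simp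
  then have "real (card E) \<le> (\<Sum>z\<in>R\<times>R. real (card (F z)))" by (simp flip: of_nat_sum)
  also have "\<dots> \<le> (\<Sum>z\<in>R\<times>R. (6 * Y) ^ CARD('n))" by (intro sum_mono cF)
  also have "\<dots> = real (card R) ^ 2 * (6 * Y) ^ CARD('n)" by (simp add: card_cartesian_product power2_eq_square)
  finally show "real (card E) \<le> real (card R) ^ 2 * (24 * \<delta> * real N ^ 2) ^ CARD('n)"
    unfolding Y_def by (simp add: mult.assoc mult.left_commute)
qed


text \<open>
  The last clause says that down to scale \<open>N powr -(1/2)\<close> the points are spread as evenly as
  Lebesgue measure; below that scale only the separation \<open>\<delta>\<close> is used, which is optimal up
  to the factor \<open>N powr -\<epsilon>\<close>. Such losses are harmless there because \<open>N\<close> is huge.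
\<close>

definition good_children ::
  "'n::finite \<Rightarrow> real ^ 'n \<Rightarrow> real \<Rightarrow> real \<Rightarrow> nat \<Rightarrow> nat set \<Rightarrow> ((int ^ 'n) \<times> nat) set \<Rightarrow> real \<Rightarrow> bool" where
  "good_children k c r \<epsilon> N R S \<delta> \<longleftrightarrow> finite S \<and> S \<subseteq> box_rationals k c r R \<and> \<delta> > 0 \<and>
      (\<forall>P\<in>S. \<forall>P'\<in>S. P \<noteq> P' \<longrightarrow> \<delta> < infnorm (rat_vec (fst P) (snd P) - rat_vec (fst P') (snd P'))) \<and>
      real (card R) * real N powr (real CARD('n) - \<epsilon>) \<le> real (card S) \<and>
      real N powr - \<epsilon> \<le> \<delta> ^ CARD('n) * real (card S) \<and>
      real (card S) \<le> 4 ^ CARD('n) * real N ^ (CARD('n) + 1) \<and>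
      (\<forall>z D. real N powr - (1/2) \<le> D \<longrightarrow>
         real (card (S \<inter> box_rationals k z D R)) \<le> 2 * 4 ^ CARD('n) * (D / r) ^ CARD('n) * real (card S))"

text \<open>From all \<open>M\<close> reduced points of the box, the first member of every pair at
  distance at most \<open>\<delta>\<close> is deleted. With \<open>\<delta>\<close> set so that
  there are at most \<open>M / 2\<close> such pairs, half of the points survive, and
  \<open>\<delta> ^ n * M\<close> is about \<open>(M / (m * N ^ n)) ^ 2\<close> with
  \<open>m = card R\<close>, a constant up to sieve losses.\<close>

lemma eventually_good_children:
  fixes k :: "'n::finite" and c :: "real ^ 'n" and r \<epsilon> :: real
  assumes r: "0 < r" "r \<le> 1/2" and \<epsilon>: "\<epsilon> > 0"
  shows "eventually (\<lambda>N. \<forall>R. R \<subseteq> {N..<2*N} \<and> R \<noteq> {} \<longrightarrow>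
    (\<exists>S \<delta>. good_children k c r \<epsilon> N R S \<delta>)) sequentially"
proof -
  \<comment> \<open>The sieve loss \<open>W\<close> is of order \<open>N powr \<epsilon>'\<close>
    and enters squared, through \<open>cond\<close> and through the size of \<open>\<delta>\<close>.
    So \<open>2 * \<epsilon>'\<close> must stay below \<open>\<epsilon>\<close>, and below
    \<open>1/2\<close> to admit boxes of radius \<open>N powr -(1/2)\<close>.\<close>
  define \<epsilon>' where "\<epsilon>' = min (\<epsilon> / 4) (1 / 8)"
  have \<epsilon>': "\<epsilon>' > 0" "2 * \<epsilon>' < 1 / 2" "2 * \<epsilon>' < \<epsilon>" "\<epsilon>' < \<epsilon>" using \<epsilon> by (auto simp: \<epsilon>'_def)
  obtain C where C: "C \<ge> 1" "\<And>q. q > 0 \<Longrightarrow> 2 ^ card (prime_factors (int q)) \<le> C * real q powr \<epsilon>'"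
    using two_pow_omega_le[OF \<epsilon>'(1)] by blast
  define L where "L = C * 2 powr \<epsilon>'"
  have L: "L > 0" using C by (simp add: L_def)
  have e1: "eventually (\<lambda>N::nat. L\<^sup>2 / r * real N powr (2 * \<epsilon>') \<le> real N powr 1) sequentially"
    using \<epsilon>' by (intro eventually_powr_dominated) auto
  have e2: "eventually (\<lambda>N::nat. L\<^sup>2 * real N powr (2 * \<epsilon>') \<le> real N powr (1/2)) sequentially"
    using \<epsilon>' by (intro eventually_powr_dominated) auto
  have e3: "eventually (\<lambda>N::nat. 2 * L / r ^ CARD('n) * real N powr - \<epsilon> \<le> real N powr - \<epsilon>') sequentially"
    using \<epsilon>' by (intro eventually_powr_dominated) auto
  have e4: "eventually (\<lambda>N::nat. 4 * 24 ^ CARD('n) * (L / r ^ CARD('n))\<^sup>2 * real N powr - \<epsilon> \<le> real N powr - (2 * \<epsilon>')) sequentially"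
    using \<epsilon>' by (intro eventually_powr_dominated) auto
  show ?thesis using e1 e2 e3 e4 eventually_gt_at_top[of 0]
  proof eventually_elim
    case (elim N)
    show ?case
    proof (intro allI impI, elim conjE)
      fix R assume R: "R \<subseteq> {N..<2*N}" "R \<noteq> {}"
      have finR: "finite R" and Rpos: "\<And>q. q \<in> R \<Longrightarrow> q > 0" using R elim(5) finite_subset by fastforce+
      define m where "m = real (card R)"
      have m: "m \<ge> 1" "m \<le> real N"
        using R finR card_mono[OF _ R(1)] unfolding m_def by (auto simp: Suc_le_eq card_gt_0_iff)
      define W where "W = L * real N powr \<epsilon>'"
      have W: "W > 0" using L elim(5) unfolding W_def by simp
      have W2: "W\<^sup>2 = L\<^sup>2 * real N powr (2 * \<epsilon>')"
        unfolding W_def by (simp add: power_mult_distrib powr_add[symmetric] power2_eq_square)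
      have om: "2 ^ card (prime_factors (int q)) \<le> W" if "q \<in> R" for q
      proof -
        have "real q powr \<epsilon>' \<le> (2 * real N) powr \<epsilon>'" using that R \<epsilon>' by (intro powr_mono2) auto
        then have "C * real q powr \<epsilon>' \<le> C * (2 * real N) powr \<epsilon>'" using C by simp
        then show ?thesis using C(2)[OF Rpos[OF that]] unfolding W_def L_def by (simp add: powr_mult)
      qed
      have dens: "1 / W \<le> sieve_density q" if "q \<in> R" for q
      proof -
        have "1 / W \<le> 1 / 2 ^ card (prime_factors (int q))" using om[OF that] by (intro divide_left_mono) (auto simp: W)
        then show ?thesis using sieve_density_ge[of q] by linarith
      qed
      \<comment> \<open>The density is at least \<open>1 / W\<close>, so the main term
        \<open>D * q * sieve_density q\<close> reaches the error bound \<open>W\<close> once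
        \<open>D * q\<close> reaches \<open>W\<^sup>2\<close>.\<close>
      have cond: "2 ^ card (prime_factors (int q)) \<le> D * real q * sieve_density q \<and> 1 \<le> D * real q"
        if "q \<in> R" "D > 0" "W\<^sup>2 \<le> D * real N" for q D
      proof -
        have q: "real N \<le> real q" using that R by auto
        have W1: "1 \<le> W" using om[OF that(1)] by (rule order_trans[rotated]) simp
        have DN: "D * real N \<le> D * real q" using q that by simp
        have Wq: "W\<^sup>2 \<le> D * real q" using DN that by linarith
        have "W = W\<^sup>2 * (1 / W)" using W by (simp add: power2_eq_square)
        also have "\<dots> \<le> (D * real q) * sieve_density q"
          using Wq dens[OF that(1)] W that(2) by (intro mult_mono) auto
        finally have "W \<le> D * real q * sieve_density q" .
        moreover have "1 \<le> W\<^sup>2" using W1 by simp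
        ultimately show ?thesis using om[OF that(1)] DN that(3) by auto
      qed
      define G where "G = rationals_weight CARD('n) R"
      define M where "M = real (card (box_rationals k c r R))"
      have rN: "W\<^sup>2 \<le> r * real N" using elim(1) r elim(5) unfolding W2 by (simp add: field_simps)
      have finP: "finite (box_rationals k c r R)" using box_rationals_count(1) finR Rpos r by blast
      have M: "r ^ CARD('n) * G \<le> M" "M \<le> (4 * r) ^ CARD('n) * G"
        using box_rationals_count(2)[OF finR Rpos r(1), of k c] cond r rN unfolding M_def G_def by auto
      have "(\<Sum>q\<in>R. real N ^ CARD('n) * (1 / W)) \<le> G" unfolding G_def rationals_weight_def
      proof (intro sum_mono mult_mono power_mono dens)
        fix q assume "q \<in> R" then show "real N \<le> real q" using R by auto
      qed (use W in auto)
      then have Gl: "m * real N ^ CARD('n) / W \<le> G" by (simp add: m_def)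
      have Gpos: "G > 0" by (rule less_le_trans[OF _ Gl]) (use m W elim(5) in auto)
      have "G \<le> (\<Sum>q\<in>R. (2 * real N) ^ CARD('n) * 1)" unfolding G_def rationals_weight_def
      proof (intro sum_mono mult_mono power_mono sieve_density_le_1)
        fix q assume "q \<in> R" then show "real q \<le> 2 * real N" using R by auto
      qed (auto simp: sieve_density_nonneg)
      then have "G \<le> m * (2 * real N) ^ CARD('n)" by (simp add: m_def)
      also have "\<dots> \<le> real N * (2 * real N) ^ CARD('n)" using m by (intro mult_right_mono) auto
      finally have Gu: "G \<le> real N * (2 * real N) ^ CARD('n)" .
      have Mpos: "M > 0" using M(1) Gpos r by (smt (verit) mult_pos_pos zero_less_power)
      \<comment> \<open>The solution of
        \<open>m\<^sup>2 * (24 * \<delta> * N ^ 2) ^ n = M / 2\<close>, whose left side bounds the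
        number of close pairs.\<close>
      define \<delta> where "\<delta> = root CARD('n) (M / (2 * m\<^sup>2)) / (24 * real N ^ 2)"
      have \<delta>: "\<delta> > 0" unfolding \<delta>_def using Mpos m elim(5) by simp
      have "24 * \<delta> * real N ^ 2 = root CARD('n) (M / (2 * m\<^sup>2))" unfolding \<delta>_def using elim(5) by simp
      then have \<delta>n: "(24 * \<delta> * real N ^ 2) ^ CARD('n) = M / (2 * m\<^sup>2)"
        using Mpos m by simp
      define E where "E = {(P, P'). P \<in> box_rationals k c r R \<and> P' \<in> box_rationals k c r R \<and> P \<noteq> P' \<and>
        infnorm (rat_vec (fst P) (snd P) - rat_vec (fst P') (snd P')) \<le> \<delta>}"
      have "real (card E) \<le> m\<^sup>2 * (24 * \<delta> * real N ^ 2) ^ CARD('n)" and finE: "finite E"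
        using close_box_rationals_count[OF R(1) elim(5) r, of \<delta> k c] \<delta> unfolding E_def m_def by auto
      then have cE: "real (card E) \<le> M / 2" unfolding \<delta>n using m by simp
      define S where "S = box_rationals k c r R - fst ` E"
      have finS: "finite S" unfolding S_def using finP by auto
      have "card (box_rationals k c r R) - card (fst ` E) \<le> card S" unfolding S_def using finE by (intro diff_card_le_card_Diff) auto
      moreover have "card (fst ` E) \<le> card E" using finE by (rule card_image_le)
      ultimately have S: "M / 2 \<le> real (card S)" using cE unfolding M_def by linarith
      have SM: "real (card S) \<le> M" unfolding M_def S_def using finP by (simp add: card_mono)
      have sep: "\<delta> < infnorm (rat_vec (fst P) (snd P) - rat_vec (fst P') (snd P'))"
        if "P \<in> S" "P' \<in> S" "P \<noteq> P'" for P P'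
      proof (rule ccontr)
        assume "\<not> ?thesis"
        then have "(P, P') \<in> E" using that unfolding S_def E_def by auto
        then have "P \<in> fst ` E" by force
        then show False using that unfolding S_def by auto
      qed
      have M2: "r ^ CARD('n) * (m * real N ^ CARD('n) / W) \<le> M"
        using M(1) mult_left_mono[OF Gl, of "r ^ CARD('n)"] r by auto
      have Npos: "real N > 0" using elim(5) by simp
      have rn: "r ^ CARD('n) > 0" using r by simp
      have b1: "real N powr - \<epsilon> \<le> r ^ CARD('n) / (2 * W)"
      proof -
        have "2 * L / r ^ CARD('n) * real N powr - \<epsilon> * real N powr \<epsilon>' \<le> real N powr - \<epsilon>' * real N powr \<epsilon>'"
          using elim(3) by (intro mult_right_mono) auto
        also have "\<dots> = 1" using Npos by (simp add: powr_add[symmetric])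
        finally show ?thesis using rn W unfolding W_def by (simp add: field_simps)
      qed
      have b2: "real N powr - \<epsilon> \<le> (r ^ CARD('n) / W)\<^sup>2 / (4 * 24 ^ CARD('n))"
      proof -
        have "4 * 24 ^ CARD('n) * (L / r ^ CARD('n))\<^sup>2 * real N powr - \<epsilon> * real N powr (2 * \<epsilon>') \<le> real N powr - (2 * \<epsilon>') * real N powr (2 * \<epsilon>')"
          using elim(4) by (intro mult_right_mono) auto
        also have "\<dots> = 1" using Npos by (simp add: powr_add[symmetric])
        finally have "4 * 24 ^ CARD('n) * (W\<^sup>2 / (r ^ CARD('n))\<^sup>2) * real N powr - \<epsilon> \<le> 1"
          unfolding W2 by (simp add: power_divide mult_ac)
        then show ?thesis using r(1) W by (simp add: field_simps power_divide)
      qed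
      have "m * real N powr (real CARD('n) - \<epsilon>) = m * real N ^ CARD('n) * real N powr - \<epsilon>"
        using Npos by (simp add: powr_diff powr_minus powr_realpow field_simps)
      also have "\<dots> \<le> m * real N ^ CARD('n) * (r ^ CARD('n) / (2 * W))"
        using b1 m by (intro mult_left_mono) auto
      also have "\<dots> = r ^ CARD('n) * (m * real N ^ CARD('n) / W) / 2" by (simp add: mult_ac)
      also have "\<dots> \<le> M / 2" using M2 by (rule divide_right_mono) simp
      also note S
      finally have p1: "m * real N powr (real CARD('n) - \<epsilon>) \<le> real (card S)" .
      have "(r ^ CARD('n) * (m * real N ^ CARD('n) / W))\<^sup>2 \<le> M\<^sup>2"
        using M2 rn m W by (intro power_mono) auto
      then have M3: "(r ^ CARD('n) / W)\<^sup>2 * (m\<^sup>2 * (real N ^ CARD('n))\<^sup>2) \<le> M\<^sup>2"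
        by (simp add: power_mult_distrib power_divide mult_ac)
      have "\<delta> ^ CARD('n) * (24 ^ CARD('n) * (real N ^ CARD('n))\<^sup>2) = M / (2 * m\<^sup>2)"
        using \<delta>n by (simp add: power_mult_distrib mult_ac power_mult[symmetric])
      then have \<delta>e: "\<delta> ^ CARD('n) = M / (2 * m\<^sup>2) / (24 ^ CARD('n) * (real N ^ CARD('n))\<^sup>2)"
        by (rule eq_divide_imp[rotated]) (use Npos in simp)
      have "(r ^ CARD('n) / W)\<^sup>2 / (4 * 24 ^ CARD('n))
          = (r ^ CARD('n) / W)\<^sup>2 * (m\<^sup>2 * (real N ^ CARD('n))\<^sup>2) / (4 * 24 ^ CARD('n) * m\<^sup>2 * (real N ^ CARD('n))\<^sup>2)"
        using m Npos by simp
      also have "\<dots> \<le> M\<^sup>2 / (4 * 24 ^ CARD('n) * m\<^sup>2 * (real N ^ CARD('n))\<^sup>2)"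
        using M3 by (intro divide_right_mono) auto
      also have "\<dots> = \<delta> ^ CARD('n) * (M / 2)" unfolding \<delta>e by (simp add: power2_eq_square)
      also have "\<dots> \<le> \<delta> ^ CARD('n) * real (card S)" using S \<delta> by (intro mult_left_mono) auto
      finally have p2: "real N powr - \<epsilon> \<le> \<delta> ^ CARD('n) * real (card S)" using b2 by (meson order_trans)
      have "(4 * r) ^ CARD('n) \<le> 2 ^ CARD('n)" using r by (intro power_mono) auto
      then have "(4 * r) ^ CARD('n) * G \<le> 2 ^ CARD('n) * (real N * (2 * real N) ^ CARD('n))"
        using Gu Gpos by (intro mult_mono) auto
      also have "\<dots> = 4 ^ CARD('n) * real N ^ (CARD('n) + 1)"
        using power_mult_distrib[of "2::real" 2 "CARD('n)"] by (simp add: power_mult_distrib mult_ac)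
      finally have p3: "real (card S) \<le> 4 ^ CARD('n) * real N ^ (CARD('n) + 1)" using SM M(2) by (meson order_trans)
      have p4: "real (card (S \<inter> box_rationals k z D R)) \<le> 2 * 4 ^ CARD('n) * (D / r) ^ CARD('n) * real (card S)"
        if D: "real N powr - (1/2) \<le> D" for z D
      proof -
        have Dpos: "D > 0" using D Npos by (metis less_le_trans powr_gt_zero less_irrefl)
        have "real N powr (1/2) = real N powr - (1/2) * real N"
          using Npos powr_add[of "real N" "-(1/2)" 1] by simp
        also have "\<dots> \<le> D * real N" using D by (intro mult_right_mono) auto
        finally have "W\<^sup>2 \<le> D * real N" using elim(2) unfolding W2 by linarith
        then have "real (card (box_rationals k z D R)) \<le> (4 * D) ^ CARD('n) * G"
          using box_rationals_count(2)[OF finR Rpos Dpos, of k z] cond Dpos unfolding G_def by auto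
        moreover have "real (card (S \<inter> box_rationals k z D R)) \<le> real (card (box_rationals k z D R))"
          using box_rationals_count(1)[OF finR Rpos Dpos] by (intro of_nat_mono card_mono) auto
        moreover have "(4 * D) ^ CARD('n) * G \<le> 2 * 4 ^ CARD('n) * (D / r) ^ CARD('n) * real (card S)"
        proof -
          have "M \<le> 2 * real (card S)" using S by simp
          with M(1) have "r ^ CARD('n) * G \<le> 2 * real (card S)" by (rule order_trans)
          then have "(4 * D / r) ^ CARD('n) * (r ^ CARD('n) * G) \<le> (4 * D / r) ^ CARD('n) * (2 * real (card S))"
            using Dpos r by (intro mult_left_mono) auto
          then show ?thesis using r by (simp add: power_mult_distrib power_divide mult_ac)
        qed
        ultimately show ?thesis by (blast intro: order_trans)
      qed
      have Ssub: "S \<subseteq> box_rationals k c r R" by (auto simp: S_def)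
      show "\<exists>S \<delta>. good_children k c r \<epsilon> N R S \<delta>" unfolding good_children_def
        by (intro exI[of _ S] exI[of _ \<delta>] conjI ballI allI impI)
          (assumption | rule finS Ssub \<delta> sep p1[unfolded m_def] p2 p3 p4)+
    qed
  qed
qed

section \<open>Boxes around rationals and packing\<close>

text \<open>
  The box is off-centre to keep its points away from \<open>p / q\<close>: otherwise the multiples
  \<open>(j * p, j * q)\<close>, whose denominators need not lie in \<open>Q\<close>, could be approximations as well.
\<close>

definition approx_box :: "real \<Rightarrow> (int ^ 'n) \<Rightarrow> nat \<Rightarrow> (real ^ 'n::finite) set" where
  "approx_box \<tau> p q = {x. \<forall>i. \<bar>x $ i - (rat_vec p q $ i + real q powr - \<tau> / 2)\<bar> \<le> real q powr - \<tau> / 4}"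

definition box_centre :: "real \<Rightarrow> (int ^ 'n) \<Rightarrow> nat \<Rightarrow> (real ^ 'n::finite)" where
  "box_centre \<tau> p q = (\<chi> i. rat_vec p q $ i + real q powr - \<tau> / 2)"

text \<open>Rounding down to the grid of mesh \<open>\<delta>\<close> is injective on points more
  than \<open>\<delta>\<close> apart. A coordinate range of length \<open>2 * D\<close> meets at
  most \<open>2 * D / \<delta> + 2\<close> cells, hence at most \<open>4 * D / \<delta>\<close> if
  \<open>D > \<delta>\<close>.\<close>

lemma packing:
  fixes f :: "'b \<Rightarrow> real ^ 'n::finite"
  assumes T: "finite T" and \<delta>: "\<delta> > 0" and D: "D \<ge> 0"
    and sep: "\<And>P P'. \<lbrakk>P \<in> T; P' \<in> T; P \<noteq> P'\<rbrakk> \<Longrightarrow> \<delta> < infnorm (f P - f P')"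
    and close: "\<And>P P'. \<lbrakk>P \<in> T; P' \<in> T\<rbrakk> \<Longrightarrow> infnorm (f P - f P') \<le> D"
  shows "D \<le> \<delta> \<Longrightarrow> card T \<le> 1" and "real (card T) \<le> 1 + (4 * D / \<delta>) ^ CARD('n)"
proof -
  show 1: "card T \<le> 1" if "D \<le> \<delta>"
    unfolding One_nat_def card_le_Suc0_iff_eq[OF T]
    using sep close that by (metis less_le_trans not_less)
  show "real (card T) \<le> 1 + (4 * D / \<delta>) ^ CARD('n)"
  proof (cases "D \<le> \<delta> \<or> T = {}")
    case True
    then have "card T \<le> 1" using 1 by auto
    moreover have "0 \<le> (4 * D / \<delta>) ^ CARD('n)" using D \<delta> by simp
    ultimately show ?thesis by linarith
  next
    case False
    then obtain P0 where P0: "P0 \<in> T" by auto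
    define z where "z = f P0"
    define g where "g = (\<lambda>P. (\<chi> i. \<lfloor>f P $ i / \<delta>\<rfloor>) :: int ^ 'n)"
    have inj: "inj_on g T"
    proof (rule inj_onI, rule ccontr)
      fix P P' assume P: "P \<in> T" "P' \<in> T" "g P = g P'" "P \<noteq> P'"
      have "\<bar>(f P - f P') $ i\<bar> \<le> \<delta>" for i
      proof -
        have "\<lfloor>f P $ i / \<delta>\<rfloor> = \<lfloor>f P' $ i / \<delta>\<rfloor>" using P(3) unfolding g_def by (simp add: vec_eq_iff)
        then have "\<bar>f P $ i / \<delta> - f P' $ i / \<delta>\<bar> \<le> 1" by linarith
        then have "\<bar>(f P $ i - f P' $ i) / \<delta>\<bar> \<le> 1" by (simp add: diff_divide_distrib)
        then show ?thesis using \<delta> by (simp add: abs_divide)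
      qed
      then have "infnorm (f P - f P') \<le> \<delta>" unfolding infnorm_le_vec by blast
      then show False using sep[OF P(1,2,4)] by simp
    qed
    define B where "B = (\<lambda>i. {\<lfloor>(z $ i - D) / \<delta>\<rfloor>..\<lfloor>(z $ i + D) / \<delta>\<rfloor>})"
    have im: "g ` T \<subseteq> {v. \<forall>i. v $ i \<in> B i}"
    proof (rule image_subsetI)
      fix P assume "P \<in> T"
      then have "\<bar>(f P - z) $ i\<bar> \<le> D" for i using close[OF _ P0] unfolding z_def infnorm_le_vec by blast
      then have a: "z $ i - D \<le> f P $ i" "f P $ i \<le> z $ i + D" for i by (auto simp: abs_le_iff algebra_simps)
      show "g P \<in> {v. \<forall>i. v $ i \<in> B i}" unfolding B_def g_def
        using a \<delta> by (auto intro!: floor_mono divide_right_mono)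
    qed
    have fin: "finite {v. \<forall>i. v $ i \<in> B i}" unfolding B_def by (intro finite_vec_box) auto
    have "card T \<le> card {v. \<forall>i. v $ i \<in> B i}" by (rule card_inj_on_le[OF inj im fin])
    also have "\<dots> = (\<Prod>i\<in>UNIV. card (B i))" by (rule card_vec_box)
    finally have "real (card T) \<le> (\<Prod>i\<in>UNIV. real (card (B i)))" by (simp flip: of_nat_prod)
    also have "\<dots> \<le> (\<Prod>i\<in>(UNIV::'n set). 4 * D / \<delta>)"
    proof (intro prod_mono conjI)
      fix i :: 'n
      have Dd: "1 \<le> D / \<delta>" using False \<delta> by (simp add: field_simps)
      have e: "(z $ i + D) / \<delta> = (z $ i - D) / \<delta> + 2 * (D / \<delta>)" using \<delta> by (simp add: field_simps)
      have "\<lfloor>(z $ i - D) / \<delta>\<rfloor> \<le> \<lfloor>(z $ i + D) / \<delta>\<rfloor>" unfolding e using Dd by (intro floor_mono) simp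
      then have "real (card (B i)) = real_of_int (\<lfloor>(z $ i + D) / \<delta>\<rfloor> + 1 - \<lfloor>(z $ i - D) / \<delta>\<rfloor>)"
        unfolding B_def by simp
      also have "\<dots> \<le> 4 * (D / \<delta>)" unfolding e using Dd by linarith
      finally show "real (card (B i)) \<le> 4 * D / \<delta>" by simp
    qed auto
    finally show ?thesis by simp
  qed
qed

text \<open>One bound for each range of scales: below the separation, above it, and above
  \<open>N powr -(1/2)\<close>, where the count is proportional to volume. \<open>T\<close> will be
  the set of children touched by one set of the cover or by one unwanted ball.\<close>

lemma good_children_hits:
  fixes k :: "'n::finite" and c :: "real ^ 'n"
  assumes g: "good_children k c r \<epsilon> N R S \<delta>" and T: "T \<subseteq> S" and N: "N > 0" and D: "D \<ge> 0" and r: "r > 0"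
    and close: "\<And>P P'. \<lbrakk>P \<in> T; P' \<in> T\<rbrakk> \<Longrightarrow> infnorm (rat_vec (fst P) (snd P) - rat_vec (fst P') (snd P')) \<le> D"
  shows "D \<le> \<delta> \<Longrightarrow> card T \<le> 1" and "real (card T) \<le> 1 + (4 * D / \<delta>) ^ CARD('n)"
    and "real N powr - (1/2) \<le> D \<Longrightarrow> real (card T) \<le> 2 * 8 ^ CARD('n) * (D / r) ^ CARD('n) * real (card S)"
proof -
  have S: "finite S" "S \<subseteq> box_rationals k c r R" "\<delta> > 0"
    and sep: "\<And>P P'. P \<in> S \<Longrightarrow> P' \<in> S \<Longrightarrow> P \<noteq> P' \<Longrightarrow> \<delta> < infnorm (rat_vec (fst P) (snd P) - rat_vec (fst P') (snd P'))"
    and dens: "\<And>z D. real N powr - (1/2) \<le> D \<Longrightarrow>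
         real (card (S \<inter> box_rationals k z D R)) \<le> 2 * 4 ^ CARD('n) * (D / r) ^ CARD('n) * real (card S)"
    using g unfolding good_children_def by blast+
  have finT: "finite T" using S T finite_subset by blast
  show "D \<le> \<delta> \<Longrightarrow> card T \<le> 1"
    by (rule packing(1)[OF finT S(3) D, of "\<lambda>P. rat_vec (fst P) (snd P)"]) (use sep T close in blast)+
  show "real (card T) \<le> 1 + (4 * D / \<delta>) ^ CARD('n)"
    by (rule packing(2)[OF finT S(3) D, of "\<lambda>P. rat_vec (fst P) (snd P)"]) (use sep T close in blast)+
  show "real (card T) \<le> 2 * 8 ^ CARD('n) * (D / r) ^ CARD('n) * real (card S)" if ND: "real N powr - (1/2) \<le> D"
  proof (cases "T = {}")
    case True
    then show ?thesis using D r by simp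
  next
    case False
    then obtain P0 where P0: "P0 \<in> T" by auto
    have Dpos: "D > 0" using ND N by (metis less_le_trans powr_gt_zero less_irrefl of_nat_0_less_iff)
    define z where "z = rat_vec (fst P0) (snd P0)"
    \<comment> \<open>The box is centred at a member of \<open>T\<close>; the factor 2 makes room
      for the open side of the half-open box.\<close>
    have "T \<subseteq> S \<inter> box_rationals k z (2 * D) R"
    proof
      fix P assume P: "P \<in> T"
      obtain p q where pq: "P = (p, q)" by (cases P)
      have PS: "(p, q) \<in> box_rationals k c r R" using P T S pq by auto
      have "\<bar>(rat_vec p q - z) $ i\<bar> \<le> D" for i using close[OF P P0] unfolding z_def infnorm_le_vec pq by simp
      then have "z $ i - 2 * D < rat_vec p q $ i \<and> rat_vec p q $ i \<le> z $ i + 2 * D" for i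
        using Dpos unfolding vector_minus_component by (smt (verit, best))
      then show "P \<in> S \<inter> box_rationals k z (2 * D) R" using PS P T unfolding pq box_rationals_def by auto
    qed
    then have "real (card T) \<le> real (card (S \<inter> box_rationals k z (2 * D) R))" using S by (intro of_nat_mono card_mono) auto
    also have "\<dots> \<le> 2 * 4 ^ CARD('n) * (2 * D / r) ^ CARD('n) * real (card S)" using ND Dpos by (intro dens) auto
    also have "\<dots> = 2 * 8 ^ CARD('n) * (D / r) ^ CARD('n) * real (card S)"
      using power_mult_distrib[of "4::real" 2 "CARD('n)"] by (simp add: power_mult_distrib power_divide mult_ac)
    finally show ?thesis .
  qed
qed

lemma approx_box_near:
  assumes "x \<in> approx_box \<tau> p q" "q > 0"
  shows "infnorm (x - rat_vec p q) < real q powr - \<tau>"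
    and "real q powr - \<tau> / 4 \<le> infnorm (x - rat_vec p q)"
proof -
  have pos: "real q powr - \<tau> > 0" using assms by simp
  have a: "real q powr - \<tau> / 4 \<le> (x - rat_vec p q) $ i \<and> (x - rat_vec p q) $ i \<le> 3 * (real q powr - \<tau> / 4)" for i
  proof -
    have "\<bar>x $ i - (rat_vec p q $ i + real q powr - \<tau> / 2)\<bar> \<le> real q powr - \<tau> / 4"
      using assms unfolding approx_box_def by blast
    then show ?thesis unfolding vector_minus_component by linarith
  qed
  show "infnorm (x - rat_vec p q) < real q powr - \<tau>"
    unfolding infnorm_less_vec
  proof (rule allI)
    fix i show "\<bar>(x - rat_vec p q) $ i\<bar> < real q powr - \<tau>" using a[of i] pos by linarith
  qed
  have "\<bar>(x - rat_vec p q) $ undefined\<bar> \<le> infnorm (x - rat_vec p q)"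
    using infnorm_le_vec by blast
  then show "real q powr - \<tau> / 4 \<le> infnorm (x - rat_vec p q)"
    using a[of undefined] by linarith
qed

text \<open>In units of \<open>q powr - \<tau>\<close>: the child's rational is within 1/8 of the
  centre and the child box within 1/8 of that rational, which adds up to the radius 1/4 of the
  parent box.\<close>

lemma approx_box_subset:
  assumes "(p', q') \<in> box_rationals k (box_centre \<tau> p q) (real q powr - \<tau> / 8) R" "q' > 0"
    and "real q' powr - \<tau> \<le> real q powr - \<tau> / 8"
  shows "approx_box \<tau> p' q' \<subseteq> approx_box \<tau> p q"
proof
  fix x assume x: "x \<in> approx_box \<tau> p' q'"
  show "x \<in> approx_box \<tau> p q" unfolding approx_box_def
  proof (rule CollectI, rule allI)
    fix i
    have 1: "\<bar>(x - rat_vec p' q') $ i\<bar> < real q' powr - \<tau>"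
      using approx_box_near(1)[OF x assms(2)] unfolding infnorm_less_vec by blast
    have 2: "box_centre \<tau> p q $ i - real q powr - \<tau> / 8 < rat_vec p' q' $ i"
      "rat_vec p' q' $ i \<le> box_centre \<tau> p q $ i + real q powr - \<tau> / 8"
      using assms(1) unfolding box_rationals_def by auto
    show "\<bar>x $ i - (rat_vec p q $ i + real q powr - \<tau> / 2)\<bar> \<le> real q powr - \<tau> / 4"
      using 1 2 assms(3) unfolding box_centre_def vector_minus_component vec_lambda_beta by linarith
  qed
qed

subsection \<open>Cost of the covering sets\<close>

lemma infnorm_triangle_sub: "infnorm (x - z) \<le> infnorm (x - y) + infnorm (y - z)"
  using infnorm_triangle[of "x - y" "y - z"] by simp

text \<open>Either \<open>U\<close> meets at most one child, which gives the term
  \<open>1 / K\<close>, or the number of children met is bounded by volume or by packing, in both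
  cases by a multiple of \<open>d ^ n = d powr s * d powr (n - s)\<close>. As \<open>s < n\<close>,
  the last factor is at most \<open>\<beta> powr (n - s)\<close>, and at most
  \<open>N powr -((n - s) / 2)\<close> in the packing range.\<close>

lemma cover_cost_single:
  fixes k :: "'n::finite" and U :: "(real ^ 'n) set"
  assumes g: "good_children k c r \<epsilon> N R S \<delta>" and R: "R \<subseteq> {N..<2*N}" and N: "N > 0" and r: "r > 0"
    and \<tau>: "\<tau> > 0" and s: "s > 0" "s < real CARD('n)"
    and \<delta>: "4 * real N powr - \<tau> \<le> \<delta>"
    and d: "d > 0" "\<And>x y. \<lbrakk>x \<in> U; y \<in> U\<rbrakk> \<Longrightarrow> infnorm (x - y) \<le> d"
    and K: "K > 0" and \<beta>: "d \<le> \<beta>"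
  defines "T \<equiv> {P \<in> S. U \<inter> approx_box \<tau> (fst P) (snd P) \<noteq> {}}"
  shows "real (card T) * min 1 (d powr s / K) \<le> d powr s * (1 / K
      + 2 * 16 ^ CARD('n) / r ^ CARD('n) * \<beta> powr (real CARD('n) - s) * real (card S)
      + 2 * 8 ^ CARD('n) * real N powr \<epsilon> * real N powr - ((real CARD('n) - s) / 2) * real (card S))"
proof -
  let ?n = "CARD('n)" and ?M = "real (card S)"
  have TS: "T \<subseteq> S" unfolding T_def by auto
  have Spts: "S \<subseteq> box_rationals k c r R" and \<delta>pos: "\<delta> > 0" and gd: "real N powr - \<epsilon> \<le> \<delta> ^ ?n * ?M"
    using g unfolding good_children_def by blast+
  have near: "infnorm (x - rat_vec (fst P) (snd P)) \<le> real N powr - \<tau>"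
    if "P \<in> S" "x \<in> approx_box \<tau> (fst P) (snd P)" for P x
  proof -
    have "snd P \<in> R" using that Spts unfolding box_rationals_def by auto
    then have q: "snd P \<ge> N" using R by auto
    have "infnorm (x - rat_vec (fst P) (snd P)) < real (snd P) powr - \<tau>"
      using approx_box_near(1)[OF that(2)] q N by simp
    also have "\<dots> \<le> real N powr - \<tau>" using q N \<tau> by (intro powr_mono2') auto
    finally show ?thesis by simp
  qed
  have close: "infnorm (rat_vec (fst P) (snd P) - rat_vec (fst P') (snd P')) \<le> d + 2 * real N powr - \<tau>"
    if P: "P \<in> T" "P' \<in> T" for P P'
  proof -
    obtain x y where x: "x \<in> U" "x \<in> approx_box \<tau> (fst P) (snd P)" and y: "y \<in> U" "y \<in> approx_box \<tau> (fst P') (snd P')"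
      using P unfolding T_def by auto
    have "infnorm (rat_vec (fst P) (snd P) - x) \<le> real N powr - \<tau>"
      using near[OF _ x(2)] P TS by (auto simp: infnorm_sub)
    moreover have "infnorm (y - rat_vec (fst P') (snd P')) \<le> real N powr - \<tau>"
      using near[OF _ y(2)] P TS by auto
    moreover have "infnorm (x - y) \<le> d" using d(2) x y by blast
    ultimately show ?thesis
      using infnorm_triangle_sub[of "rat_vec (fst P) (snd P)" "rat_vec (fst P') (snd P')" x]
        infnorm_triangle_sub[of x "rat_vec (fst P') (snd P')" y] by linarith
  qed
  define f where "f = d powr s"
  have f: "f > 0" using d(1) by (simp add: f_def)
  define A2 where "A2 = 2 * 16 ^ ?n / r ^ ?n * \<beta> powr (real ?n - s) * ?M"
  define A3 where "A3 = 2 * 8 ^ ?n * real N powr \<epsilon> * real N powr - ((real ?n - s) / 2) * ?M"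
  have A: "A2 \<ge> 0" "A3 \<ge> 0" unfolding A2_def A3_def using r by auto
  have dn: "d ^ ?n = f * d powr (real ?n - s)"
    using d(1) unfolding f_def by (simp add: powr_add[symmetric] powr_realpow)
  have Npos: "real N powr - \<tau> > 0" using N by simp
  have "real (card T) * min 1 (f / K) \<le> f * (1 / K + A2 + A3)"
  proof (cases "d + 2 * real N powr - \<tau> \<le> \<delta>")
    case True
    have "card T \<le> 1"
      by (rule good_children_hits(1)[OF g TS N _ r close True]) (use d(1) Npos in auto)
    then have "real (card T) * min 1 (f / K) \<le> 1 * (f / K)"
      using f K by (intro mult_mono) auto
    also have "\<dots> \<le> f * (1 / K + A2 + A3)" using A f by (simp add: distrib_left)
    finally show ?thesis .
  next
    case False
    \<comment> \<open>From \<open>d > \<delta> - 2 * N powr - \<tau>\<close> and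
      \<open>\<delta> \<ge> 4 * N powr - \<tau>\<close> it follows that
      \<open>d > 2 * N powr - \<tau>\<close>: the extent of the child boxes at most doubles
      \<open>d\<close>.\<close>
    then have d2: "d + 2 * real N powr - \<tau> \<le> 2 * d" "\<delta> \<le> 2 * d" using \<delta> by linarith+
    have close2: "infnorm (rat_vec (fst P) (snd P) - rat_vec (fst P') (snd P')) \<le> 2 * d"
      if P: "P \<in> T" "P' \<in> T" for P P'
      using close[OF that] d2(1) by linarith
    have "real (card T) \<le> f * (A2 + A3)"
    proof (cases "real N powr - (1/2) \<le> 2 * d")
      case True
      have "real (card T) \<le> 2 * 8 ^ ?n * (2 * d / r) ^ ?n * ?M"
        by (rule good_children_hits(3)[OF g TS N _ r close2 True]) (use d(1) in auto)
      also have "\<dots> = 2 * 16 ^ ?n / r ^ ?n * d ^ ?n * ?M"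
        using power_mult_distrib[of "8::real" 2 ?n] by (simp add: power_mult_distrib power_divide mult_ac)
      also have "\<dots> = f * (2 * 16 ^ ?n / r ^ ?n * d powr (real ?n - s) * ?M)" unfolding dn by (simp add: mult_ac)
      also have "\<dots> \<le> f * A2" unfolding A2_def using f r d(1) \<beta> s
        by (intro mult_left_mono mult_right_mono powr_mono2) auto
      also have "\<dots> \<le> f * (A2 + A3)" using A f by (simp add: distrib_left)
      finally show ?thesis .
    next
      case F: False
      have "real (card T) \<le> 1 + (4 * (2 * d) / \<delta>) ^ ?n"
        by (rule good_children_hits(2)[OF g TS N _ r close2]) (use d(1) in auto)
      also have "\<dots> \<le> 2 * (4 * (2 * d) / \<delta>) ^ ?n"
      proof -
        have "1 \<le> 4 * (2 * d) / \<delta>" using d2(2) \<delta>pos d(1) by (simp add: field_simps)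
        then show ?thesis using one_le_power[of "4 * (2 * d) / \<delta>" ?n] by linarith
      qed
      also have "\<dots> = 2 * 8 ^ ?n * d ^ ?n * (1 / \<delta> ^ ?n)" by (simp add: power_divide power_mult_distrib)
      also have "\<dots> \<le> 2 * 8 ^ ?n * d ^ ?n * (?M * real N powr \<epsilon>)"
      proof (intro mult_left_mono)
        have "1 = real N powr - \<epsilon> * real N powr \<epsilon>" using N by (simp add: powr_add[symmetric])
        also have "\<dots> \<le> \<delta> ^ ?n * ?M * real N powr \<epsilon>" using gd by (intro mult_right_mono) auto
        finally show "1 / \<delta> ^ ?n \<le> ?M * real N powr \<epsilon>" using \<delta>pos by (simp add: field_simps)
      qed (use d(1) in auto)
      also have "\<dots> = f * (2 * 8 ^ ?n * real N powr \<epsilon> * d powr (real ?n - s) * ?M)" unfolding dn by (simp add: mult_ac)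
      also have "\<dots> \<le> f * A3"
      proof -
        have "d \<le> real N powr - (1/2)" using F d(1) by linarith
        then have "d powr (real ?n - s) \<le> (real N powr - (1/2)) powr (real ?n - s)"
          using d(1) s by (intro powr_mono2) auto
        also have "\<dots> = real N powr - ((real ?n - s) / 2)" by (simp add: powr_powr)
        finally show ?thesis unfolding A3_def using f by (intro mult_left_mono mult_right_mono) auto
      qed
      also have "\<dots> \<le> f * (A2 + A3)" using A f by (simp add: distrib_left)
      finally show ?thesis .
    qed
    moreover have "real (card T) * min 1 (f / K) \<le> real (card T) * 1" by (intro mult_left_mono) auto
    moreover have "f * (A2 + A3) \<le> f * (1 / K + A2 + A3)" using f K by (intro mult_left_mono) auto
    ultimately show ?thesis by linarith
  qed
  then show ?thesis unfolding f_def A2_def A3_def .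
qed

text \<open>Only sets meeting the parent box matter, and \<open>inv\<close> forces each of them to
  have size at most \<open>\<gamma> * q powr - \<tau>\<close>. The three terms of
  \<open>cover_cost_single\<close> then contribute an eighth of the number of children each: the
  first by \<open>N2\<close>, the second by the choice of \<open>\<gamma>\<close>, the third by
  \<open>N3\<close>.\<close>

lemma cover_cost:
  fixes k :: "'n::finite" and U :: "nat \<Rightarrow> (real ^ 'n) set" and d :: "nat \<Rightarrow> real"
  assumes g: "good_children k (box_centre \<tau> p q) (real q powr - \<tau> / 8) \<epsilon> N R S \<delta>"
    and R: "R \<subseteq> {N..<2*N}" and N: "N > 0" and q: "q > 0"
    and \<tau>: "\<tau> > 0" and s: "s > 0" "s < real CARD('n)"
    and \<delta>: "4 * real N powr - \<tau> \<le> \<delta>"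
    and N2: "8 * (2 * real N) powr (\<tau> * s) \<le> real (card S)"
    and N3: "16 * 8 ^ CARD('n) * real N powr \<epsilon> * real N powr - ((real CARD('n) - s) / 2) \<le> 1"
    and N4: "real N powr - \<tau> \<le> real q powr - \<tau> / 8"
    and d: "\<And>i. d i > 0" "\<And>i x y. \<lbrakk>x \<in> U i; y \<in> U i\<rbrakk> \<Longrightarrow> infnorm (x - y) \<le> d i"
    and summ: "summable (\<lambda>i. d i powr s)"
    and \<gamma>: "\<gamma> > 0" "\<gamma> ^ CARD('n) \<le> 1 / (16 * 128 ^ CARD('n))"
    and inv: "(\<Sum>i. if U i \<inter> approx_box \<tau> p q \<noteq> {} then d i powr s else 0) \<le> (\<gamma> * real q powr - \<tau>) powr s"
  shows "(\<Sum>P\<in>S. \<Sum>i. if U i \<inter> approx_box \<tau> (fst P) (snd P) \<noteq> {}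
      then min 1 (d i powr s / (\<gamma> * (2 * real N) powr - \<tau>) powr s) else 0) \<le> 3 / 8 * real (card S)"
proof -
  let ?n = "CARD('n)" and ?M = "real (card S)"
  define w where "w = real q powr - \<tau>"
  define K where "K = (\<gamma> * (2 * real N) powr - \<tau>) powr s"
  have w: "w > 0" "w \<le> 1"
    using q \<tau> powr_mono[of "- \<tau>" 0 "real q"] unfolding w_def by auto
  have K: "K > 0" unfolding K_def using \<gamma> N by simp
  have finS: "finite S" and Spts: "S \<subseteq> box_rationals k (box_centre \<tau> p q) (real q powr - \<tau> / 8) R"
    using g unfolding good_children_def by blast+
  let ?u = "\<lambda>P i. if U i \<inter> approx_box \<tau> (fst P) (snd P) \<noteq> {} then min 1 (d i powr s / K) else 0"
  let ?v = "\<lambda>i. if U i \<inter> approx_box \<tau> p q \<noteq> {} then d i powr s else 0"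
  have sv: "summable ?v" by (rule summable_comparison_test'[OF summ, of 0]) auto
  have su: "summable (?u P)" for P
    by (rule summable_comparison_test'[OF summable_divide[OF summ, of K], of 0]) (use K in auto)
  define A where "A = 1 / K
      + 2 * 16 ^ ?n / (w / 8) ^ ?n * (\<gamma> * w) powr (real ?n - s) * ?M
      + 2 * 8 ^ ?n * real N powr \<epsilon> * real N powr - ((real ?n - s) / 2) * ?M"
  have A: "A \<ge> 0" unfolding A_def using K w by (intro add_nonneg_nonneg) auto
  have bound: "(\<Sum>P\<in>S. ?u P i) \<le> ?v i * A" for i
  proof (cases "U i \<inter> approx_box \<tau> p q \<noteq> {}")
    case True
    have "?v i \<le> suminf ?v"
      using sum_le_suminf[OF sv, of "{i}"] by auto
    then have "d i powr s \<le> (\<gamma> * w) powr s" using True inv unfolding w_def by simp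
    then have d\<beta>: "d i \<le> \<gamma> * w"
      using powr_less_mono2[of s "\<gamma> * w" "d i"] \<gamma>(1) w(1) s(1) by (meson mult_pos_pos not_le less_imp_le)
    have "(\<Sum>P\<in>S. ?u P i) = (\<Sum>P\<in>{P \<in> S. U i \<inter> approx_box \<tau> (fst P) (snd P) \<noteq> {}}. min 1 (d i powr s / K))"
      by (rule sum.inter_filter[OF finS, symmetric])
    also have "\<dots> = real (card {P \<in> S. U i \<inter> approx_box \<tau> (fst P) (snd P) \<noteq> {}}) * min 1 (d i powr s / K)" by simp
    also have "\<dots> \<le> d i powr s * A" unfolding A_def
      by (rule cover_cost_single[OF g[folded w_def] R N _ \<tau> s \<delta> d(1) d(2) K d\<beta>]) (use w in auto)
    finally show ?thesis using True by simp
  next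
    case False
    have "U i \<inter> approx_box \<tau> (fst P) (snd P) = {}" if "P \<in> S" for P
    proof -
      have P: "(fst P, snd P) \<in> box_rationals k (box_centre \<tau> p q) (real q powr - \<tau> / 8) R" using Spts that by auto
      then have qP: "snd P \<ge> N" using R unfolding box_rationals_def by auto
      have "real (snd P) powr - \<tau> \<le> real N powr - \<tau>" using qP N \<tau> by (intro powr_mono2') auto
      then have "approx_box \<tau> (fst P) (snd P) \<subseteq> approx_box \<tau> p q"
        using approx_box_subset[OF P] qP N N4 by linarith
      then show ?thesis using False by auto
    qed
    then have "(\<Sum>P\<in>S. ?u P i) = 0" by (intro sum.neutral) auto
    then show ?thesis using False by simp
  qed
  have "(\<Sum>P\<in>S. \<Sum>i. ?u P i) = (\<Sum>i. \<Sum>P\<in>S. ?u P i)" by (rule suminf_sum[symmetric]) (rule su)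
  also have "\<dots> \<le> (\<Sum>i. ?v i * A)" 
  proof (rule suminf_le)
    show "summable (\<lambda>i. \<Sum>P\<in>S. ?u P i)" by (rule summable_sum) (rule su)
    show "summable (\<lambda>i. ?v i * A)" by (rule summable_mult2) (rule sv)
  qed (rule bound)
  also have "\<dots> = suminf ?v * A" by (rule suminf_mult2[symmetric, OF sv])
  also have "\<dots> \<le> (\<gamma> * w) powr s * A" using inv A unfolding w_def by (intro mult_right_mono)
  also have "\<dots> \<le> ?M / 8 + ?M / 8 + ?M / 8"
  proof -
    have gw: "\<gamma> * w > 0" using \<gamma> w by simp
    have g1: "\<gamma> \<le> 1"
    proof (rule ccontr)
      assume "\<not> \<gamma> \<le> 1"
      then have a: "1 \<le> \<gamma> ^ ?n" by (intro one_le_power) simp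
      have "(1::real) \<le> 128 ^ ?n" by simp
      then have "(1::real) < 16 * 128 ^ ?n" by linarith
      then have "1 / (16 * 128 ^ ?n) < (1::real)" by (subst divide_less_eq_1_pos) linarith+
      then show False using \<gamma>(2) a by linarith
    qed
    have "(\<gamma> * w) powr s * (1 / K) = (\<gamma> * w / (\<gamma> * (2 * real N) powr - \<tau>)) powr s"
      unfolding K_def using \<gamma>(1) w by (subst powr_divide) auto
    also have "\<gamma> * w / (\<gamma> * (2 * real N) powr - \<tau>) = w * (2 * real N) powr \<tau>"
      using \<gamma>(1) by (simp add: powr_minus_divide)
    finally have "(\<gamma> * w) powr s * (1 / K) = (w * (2 * real N) powr \<tau>) powr s" .
    also have "\<dots> \<le> (1 * (2 * real N) powr \<tau>) powr s" using w s by (intro powr_mono2 mult_right_mono) auto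
    also have "\<dots> = (2 * real N) powr (\<tau> * s)" by (simp add: powr_powr)
    finally have 1: "(\<gamma> * w) powr s * (1 / K) \<le> ?M / 8" using N2 by linarith
    \<comment> \<open>The powers of \<open>w\<close> cancel. The constant \<open>128 ^ n\<close> is
      \<open>16 ^ n\<close> from the volume count times \<open>8 ^ n\<close> from the radius
      \<open>w / 8\<close>; the bound on \<open>\<gamma>\<close> is made for it.\<close>
    have "(\<gamma> * w) powr s * (2 * 16 ^ ?n / (w / 8) ^ ?n * (\<gamma> * w) powr (real ?n - s) * ?M)
       = ((\<gamma> * w) powr s * (\<gamma> * w) powr (real ?n - s)) * (2 * 16 ^ ?n / (w / 8) ^ ?n * ?M)" by (simp only: mult_ac)
    also have "(\<gamma> * w) powr s * (\<gamma> * w) powr (real ?n - s) = (\<gamma> * w) ^ ?n"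
      using gw by (simp add: powr_add[symmetric] powr_realpow)
    also have "(\<gamma> * w) ^ ?n * (2 * 16 ^ ?n / (w / 8) ^ ?n * ?M) = \<gamma> ^ ?n * (2 * 128 ^ ?n * ?M)"
      using w power_mult_distrib[of "8::real" 16 ?n] by (simp add: power_divide power_mult_distrib)
    also have "\<dots> \<le> 1 / (16 * 128 ^ ?n) * (2 * 128 ^ ?n * ?M)" using \<gamma>(2) by (intro mult_right_mono) auto
    also have "\<dots> = ?M / 8" by simp
    finally have 2: "(\<gamma> * w) powr s * (2 * 16 ^ ?n / (w / 8) ^ ?n * (\<gamma> * w) powr (real ?n - s) * ?M) \<le> ?M / 8" .
    have "\<gamma> * w \<le> 1" using g1 w \<gamma> by (simp add: mult_le_one)
    then have "(\<gamma> * w) powr s \<le> 1" using gw s by (simp add: powr_le1)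
    then have "(\<gamma> * w) powr s * (2 * 8 ^ ?n * real N powr \<epsilon> * real N powr - ((real ?n - s) / 2) * ?M)
       \<le> 1 * (2 * 8 ^ ?n * real N powr \<epsilon> * real N powr - ((real ?n - s) / 2) * ?M)"
      by (intro mult_right_mono) auto
    also have "\<dots> = (16 * 8 ^ ?n * real N powr \<epsilon> * real N powr - ((real ?n - s) / 2)) * (?M / 8)" by simp
    also have "\<dots> \<le> 1 * (?M / 8)" using N3 by (intro mult_right_mono) auto
    finally have 3: "(\<gamma> * w) powr s * (2 * 8 ^ ?n * real N powr \<epsilon> * real N powr - ((real ?n - s) / 2) * ?M) \<le> ?M / 8" by simp
    show ?thesis unfolding A_def distrib_left using 1 2 3 by (intro add_mono)
  qed
  finally show ?thesis unfolding K_def by simp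
qed

subsection \<open>Cost of the unwanted rationals\<close>

lemma card_int_Icc_le:
  assumes "a \<le> b"
  shows "finite {m::int. a \<le> real_of_int m \<and> real_of_int m \<le> b}"
    and "real (card {m::int. a \<le> real_of_int m \<and> real_of_int m \<le> b}) \<le> b - a + 1"
proof -
  have e: "{m::int. a \<le> real_of_int m \<and> real_of_int m \<le> b} = {\<lceil>a\<rceil>..\<lfloor>b\<rfloor>}"
    by (auto simp: ceiling_le_iff le_floor_iff)
  show "finite {m::int. a \<le> real_of_int m \<and> real_of_int m \<le> b}" unfolding e by simp
  show "real (card {m::int. a \<le> real_of_int m \<and> real_of_int m \<le> b}) \<le> b - a + 1"
  proof (cases "\<lceil>a\<rceil> \<le> \<lfloor>b\<rfloor> + 1")
    case True
    then have "real (card {\<lceil>a\<rceil>..\<lfloor>b\<rfloor>}) = real_of_int (\<lfloor>b\<rfloor> + 1 - \<lceil>a\<rceil>)" by simp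
    then show ?thesis unfolding e by linarith
  next
    case False
    then show ?thesis unfolding e using assms by simp
  qed
qed

text \<open>A quarter from the box and a quarter from \<open>v powr - \<tau>\<close> keep such a
  rational within \<open>q powr - \<tau> / 2\<close> of the centre, so each coordinate ranges over
  multiples of \<open>1 / v\<close> in an interval of length \<open>q powr - \<tau>\<close>.\<close>

lemma card_rationals_near_box:
  fixes p :: "int ^ 'n::finite"
  assumes v: "v > 0" "real v powr - \<tau> \<le> real q powr - \<tau> / 4"
  defines "Z \<equiv> {u :: int ^ 'n. \<exists>x\<in>approx_box \<tau> p q. infnorm (x - rat_vec u v) < real v powr - \<tau>}"
  shows "finite Z" and "real (card Z) \<le> (real q powr - \<tau> * real v + 1) ^ CARD('n)"
proof -
  define w where "w = real q powr - \<tau>"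
  define c where "c = box_centre \<tau> p q"
  define B where "B = (\<lambda>i. {m::int. real v * (c $ i - w / 2) \<le> real_of_int m \<and> real_of_int m \<le> real v * (c $ i + w / 2)})"
  have w: "w \<ge> 0" by (simp add: w_def)
  have le: "real v * (c $ i - w / 2) \<le> real v * (c $ i + w / 2)" for i using w by (intro mult_left_mono) auto
  have B: "finite (B i)" "real (card (B i)) \<le> w * real v + 1" for i
  proof -
    show "finite (B i)" unfolding B_def by (rule card_int_Icc_le(1)[OF le])
    have "real (card (B i)) \<le> real v * (c $ i + w / 2) - real v * (c $ i - w / 2) + 1"
      unfolding B_def by (rule card_int_Icc_le(2)[OF le])
    then show "real (card (B i)) \<le> w * real v + 1" by (simp add: algebra_simps)
  qed
  have sub: "Z \<subseteq> {u. \<forall>i. u $ i \<in> B i}"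
  proof
    fix u assume "u \<in> Z"
    then obtain x where x: "x \<in> approx_box \<tau> p q" "infnorm (x - rat_vec u v) < real v powr - \<tau>" unfolding Z_def by auto
    show "u \<in> {u. \<forall>i. u $ i \<in> B i}"
    proof (rule CollectI, rule allI)
      fix i
      have 1: "\<bar>x $ i - rat_vec u v $ i\<bar> < real v powr - \<tau>" using x(2) unfolding infnorm_less_vec by simp
      have 2: "\<bar>x $ i - c $ i\<bar> \<le> w / 4" using x(1) unfolding approx_box_def c_def box_centre_def w_def by simp
      have "c $ i - w / 2 \<le> rat_vec u v $ i" "rat_vec u v $ i \<le> c $ i + w / 2"
        using 1 2 v(2) unfolding w_def by linarith+
      then have "real v * (c $ i - w / 2) \<le> real v * rat_vec u v $ i" "real v * rat_vec u v $ i \<le> real v * (c $ i + w / 2)"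
        by (auto intro!: mult_left_mono)
      moreover have "real v * rat_vec u v $ i = real_of_int (u $ i)" using v by (simp add: rat_vec_def)
      ultimately show "u $ i \<in> B i" unfolding B_def by simp
    qed
  qed
  have fin: "finite {u. \<forall>i. u $ i \<in> B i}" using B by (intro finite_vec_box)
  show "finite Z" using sub fin by (rule finite_subset)
  have "card Z \<le> card {u. \<forall>i. u $ i \<in> B i}" using fin sub by (rule card_mono)
  also have "\<dots> = (\<Prod>i\<in>UNIV. card (B i))" by (rule card_vec_box)
  finally have "real (card Z) \<le> (\<Prod>i\<in>UNIV. real (card (B i)))" by (simp flip: of_nat_prod)
  also have "\<dots> \<le> (\<Prod>i\<in>(UNIV::'n set). w * real v + 1)" using B by (intro prod_mono) auto
  finally show "real (card Z) \<le> (real q powr - \<tau> * real v + 1) ^ CARD('n)" unfolding w_def by simp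
qed

text \<open>As \<open>v \<le> N\<close>, the children meeting the ball have their rationals within
  twice its radius. If the ball is not too small against \<open>N powr -(1/2)\<close>, the volume
  count applies; otherwise packing does, with a loss \<open>N powr \<epsilon>\<close>, and then
  \<open>v powr \<tau>\<close> is at least \<open>N powr (1/2)\<close>. The summand 1 is there
  because the tiniest ball can still hit a child.\<close>

lemma bad_cost_single:
  fixes k :: "'n::finite" and u :: "int ^ 'n"
  assumes g: "good_children k c r \<epsilon> N R S \<delta>" and R: "R \<subseteq> {N..<2*N}" and N: "N > 0" and r: "r > 0"
    and \<tau>: "\<tau> > 0" and v: "0 < v" "v \<le> N"
  defines "T \<equiv> {P \<in> S. \<exists>x\<in>approx_box \<tau> (fst P) (snd P). infnorm (x - rat_vec u v) < real v powr - \<tau>}"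
  shows "real (card T) \<le> 1 + real (card S) * real v powr - (real CARD('n) * \<tau>) *
     (2 * 32 ^ CARD('n) / r ^ CARD('n) + (if real N powr (1/2) \<le> real v powr \<tau> then 16 ^ CARD('n) * real N powr \<epsilon> else 0))"
proof -
  let ?n = "CARD('n)" and ?M = "real (card S)"
  define \<rho> where "\<rho> = real v powr - \<tau>"
  have \<rho>: "\<rho> > 0" using v by (simp add: \<rho>_def)
  have TS: "T \<subseteq> S" unfolding T_def by auto
  have Spts: "S \<subseteq> box_rationals k c r R" and \<delta>pos: "\<delta> > 0" and gd: "real N powr - \<epsilon> \<le> \<delta> ^ ?n * ?M"
    using g unfolding good_children_def by blast+
  have near: "infnorm (rat_vec (fst P) (snd P) - rat_vec u v) \<le> 2 * \<rho>" if P: "P \<in> T" for P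
  proof -
    obtain x where x: "x \<in> approx_box \<tau> (fst P) (snd P)" "infnorm (x - rat_vec u v) < \<rho>"
      using P unfolding T_def \<rho>_def by auto
    have "snd P \<in> R" using P TS Spts unfolding box_rationals_def by auto
    then have q: "snd P \<ge> N" using R by auto
    have "infnorm (x - rat_vec (fst P) (snd P)) < real (snd P) powr - \<tau>"
      using approx_box_near(1)[OF x(1)] q N by simp
    also have "\<dots> \<le> \<rho>" unfolding \<rho>_def using q v \<tau> by (intro powr_mono2') auto
    finally have "infnorm (rat_vec (fst P) (snd P) - x) < \<rho>" by (simp only: infnorm_sub)
    then show ?thesis using x(2) infnorm_triangle_sub[of "rat_vec (fst P) (snd P)" "rat_vec u v" x] by linarith
  qed
  have close: "infnorm (rat_vec (fst P) (snd P) - rat_vec (fst P') (snd P')) \<le> 4 * \<rho>"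
    if P: "P \<in> T" "P' \<in> T" for P P'
    using near[OF P(1)] near[OF P(2)] infnorm_sub[of "rat_vec u v" "rat_vec (fst P') (snd P')"]
      infnorm_triangle_sub[of "rat_vec (fst P) (snd P)" "rat_vec (fst P') (snd P')" "rat_vec u v"] by linarith
  have \<rho>n: "\<rho> ^ ?n = real v powr - (real ?n * \<tau>)"
    unfolding \<rho>_def using v by (simp add: powr_realpow[symmetric] powr_powr mult.commute)
  show ?thesis
  proof (cases "real N powr - (1/2) \<le> 4 * \<rho>")
    case True
    have "real (card T) \<le> 2 * 8 ^ ?n * (4 * \<rho> / r) ^ ?n * ?M"
      by (rule good_children_hits(3)[OF g TS N _ r close True]) (use \<rho> in auto)
    also have "\<dots> = ?M * \<rho> ^ ?n * (2 * 32 ^ ?n / r ^ ?n)"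
      using power_mult_distrib[of "8::real" 4 ?n] by (simp add: power_mult_distrib power_divide mult_ac)
    also have "\<dots> \<le> ?M * \<rho> ^ ?n * (2 * 32 ^ ?n / r ^ ?n + (if real N powr (1/2) \<le> real v powr \<tau> then 16 ^ ?n * real N powr \<epsilon> else 0))"
      using \<rho> by (intro mult_left_mono) auto
    finally show ?thesis unfolding \<rho>n by linarith
  next
    case False
    have "real N powr (1/2) \<le> real v powr \<tau>"
    proof -
      have "real v powr - \<tau> \<le> real N powr - (1/2)" using False \<rho> unfolding \<rho>_def by linarith
      then show ?thesis using v N by (simp add: powr_minus inverse_le_iff_le)
    qed
    moreover have "real (card T) \<le> 1 + ?M * \<rho> ^ ?n * (16 ^ ?n * real N powr \<epsilon>)"
    proof -
      have "real (card T) \<le> 1 + (4 * (4 * \<rho>) / \<delta>) ^ ?n"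
        by (rule good_children_hits(2)[OF g TS N _ r close]) (use \<rho> in auto)
      also have "(4 * (4 * \<rho>) / \<delta>) ^ ?n = 16 ^ ?n * \<rho> ^ ?n * (1 / \<delta> ^ ?n)" by (simp add: power_divide power_mult_distrib)
      also have "\<dots> \<le> 16 ^ ?n * \<rho> ^ ?n * (?M * real N powr \<epsilon>)"
      proof (intro mult_left_mono)
        have "1 = real N powr - \<epsilon> * real N powr \<epsilon>" using N by (simp add: powr_add[symmetric])
        also have "\<dots> \<le> \<delta> ^ ?n * ?M * real N powr \<epsilon>" using gd by (intro mult_right_mono) auto
        finally show "1 / \<delta> ^ ?n \<le> ?M * real N powr \<epsilon>" using \<delta>pos by (simp add: field_simps)
      qed (use \<rho> in auto)
      finally show ?thesis by (simp add: mult_ac)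
    qed
    moreover have "?M * \<rho> ^ ?n * (16 ^ ?n * real N powr \<epsilon>) \<le> ?M * \<rho> ^ ?n * (2 * 32 ^ ?n / r ^ ?n + 16 ^ ?n * real N powr \<epsilon>)"
      using \<rho> r by (intro mult_left_mono) auto
    ultimately show ?thesis unfolding \<rho>n by simp
  qed
qed

text \<open>\<open>bad_cost_single\<close> is summed over the rationals near the parent box, at most
  \<open>(w * v + 1) ^ n\<close> for each \<open>v\<close>, where
  \<open>w = q powr - \<tau>\<close>. \<open>V1\<close>, \<open>V2\<close> and \<open>V3\<close>
  control the volume term, the summand 1 and the packing term, an eighth of the children
  each.\<close>

lemma bad_cost:
  fixes k :: "'n::finite" and p :: "int ^ 'n"
  assumes g: "good_children k (box_centre \<tau> p q) (real q powr - \<tau> / 8) \<epsilon> N R S \<delta>"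
    and R: "R \<subseteq> {N..<2*N}" and N: "N > 0" and q: "q > 0" and \<tau>: "\<tau> > 0"
    and N4: "real N powr - \<tau> \<le> real q powr - \<tau> / 8"
    and V: "finite V" "\<And>v. v \<in> V \<Longrightarrow> 0 < v \<and> v \<le> N \<and> real v powr - \<tau> \<le> real q powr - \<tau> / 4"
    and V1: "16 * 512 ^ CARD('n) * (\<Sum>v\<in>V. real v powr (real CARD('n) - real CARD('n) * \<tau>)
        + real q powr (real CARD('n) * \<tau>) * real v powr - (real CARD('n) * \<tau>)) \<le> 1"
    and V2: "8 * (\<Sum>v\<in>V. (2 * real v) ^ CARD('n)) \<le> real (card S)"
    and V3: "8 * 32 ^ CARD('n) * real N powr \<epsilon> *
        (\<Sum>v\<in>{v\<in>V. real N powr (1/2) \<le> real v powr \<tau>}. real v powr (real CARD('n) - real CARD('n) * \<tau>)) \<le> 1"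
  defines "bad \<equiv> \<lambda>P :: (int ^ 'n) \<times> nat. {(u :: int ^ 'n, v). v \<in> V \<and> (\<exists>x\<in>approx_box \<tau> (fst P) (snd P). infnorm (x - rat_vec u v) < real v powr - \<tau>)}"
  shows "\<And>P. P \<in> S \<Longrightarrow> finite (bad P)" and "(\<Sum>P\<in>S. real (card (bad P))) \<le> 3 / 8 * real (card S)"
proof -
  let ?n = "CARD('n)" and ?M = "real (card S)"
  define w where "w = real q powr - \<tau>"
  have w: "w > 0" "w \<le> 1" using q \<tau> powr_mono[of "- \<tau>" 0 "real q"] unfolding w_def by auto
  have "w ^ ?n = real q powr - (real ?n * \<tau>)"
    unfolding w_def using q by (simp add: powr_realpow[symmetric] powr_powr mult.commute)
  then have wn: "1 / w ^ ?n = real q powr (real ?n * \<tau>)" by (simp add: powr_minus_divide)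
  define Z where "Z = (\<lambda>v. {u :: int ^ 'n. \<exists>x\<in>approx_box \<tau> p q. infnorm (x - rat_vec u v) < real v powr - \<tau>})"
  have Z: "finite (Z v)" "real (card (Z v)) \<le> (w * real v + 1) ^ ?n" if "v \<in> V" for v
    using card_rationals_near_box[of v \<tau> q p] V(2)[OF that] unfolding Z_def w_def by auto
  have finS: "finite S" and Spts: "S \<subseteq> box_rationals k (box_centre \<tau> p q) (real q powr - \<tau> / 8) R"
    using g unfolding good_children_def by blast+
  have sub: "approx_box \<tau> (fst P) (snd P) \<subseteq> approx_box \<tau> p q" if "P \<in> S" for P
  proof -
    have P: "(fst P, snd P) \<in> box_rationals k (box_centre \<tau> p q) (real q powr - \<tau> / 8) R" using Spts that by auto
    then have qP: "snd P \<ge> N" using R unfolding box_rationals_def by auto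
    have "real (snd P) powr - \<tau> \<le> real N powr - \<tau>" using qP N \<tau> by (intro powr_mono2') auto
    then show ?thesis using approx_box_subset[OF P] qP N N4 by linarith
  qed
  define X where "X = prod.swap ` (SIGMA v:V. Z v)"
  have finX: "finite X" unfolding X_def using V Z by auto
  define hit where "hit = (\<lambda>(P :: (int ^ 'n) \<times> nat) (z :: (int ^ 'n) \<times> nat). \<exists>x\<in>approx_box \<tau> (fst P) (snd P). infnorm (x - rat_vec (fst z) (snd z)) < real (snd z) powr - \<tau>)"
  have badX: "bad P = {z \<in> X. hit P z}" if "P \<in> S" for P
    using sub[OF that] unfolding bad_def X_def hit_def Z_def by (auto simp: image_iff)
  then show "\<And>P. P \<in> S \<Longrightarrow> finite (bad P)" using finX by simp
  define L where "L = (\<lambda>v. if real N powr (1/2) \<le> real v powr \<tau> then 16 ^ ?n * real N powr \<epsilon> else 0)"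
  define B where "B = (\<lambda>v. 1 + ?M * real v powr - (real ?n * \<tau>) * (2 * 256 ^ ?n / w ^ ?n + L v))"
  have B1: "real (card {P \<in> S. hit P (u, v)}) \<le> B v" if "v \<in> V" for u v
  proof -
    have e: "2 * 32 ^ ?n / (w / 8) ^ ?n = 2 * 256 ^ ?n / w ^ ?n"
      using power_mult_distrib[of "32::real" 8 ?n] by (simp add: power_divide)
    have "real (card {P \<in> S. hit P (u, v)}) \<le> 1 + ?M * real v powr - (real ?n * \<tau>) * (2 * 32 ^ ?n / (w / 8) ^ ?n + L v)"
      unfolding w_def hit_def fst_conv snd_conv L_def
      by (rule bad_cost_single[OF g R N _ \<tau>]) (use V(2)[OF that] q in auto)
    then show ?thesis unfolding e B_def .
  qed
  have B0: "B v \<ge> 0" for v unfolding B_def L_def using w by (intro add_nonneg_nonneg mult_nonneg_nonneg) auto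
  have "(\<Sum>P\<in>S. real (card (bad P))) = (\<Sum>P\<in>S. \<Sum>z\<in>X. if hit P z then 1 else 0)"
    by (intro sum.cong refl) (simp add: badX sum.inter_filter[OF finX, symmetric])
  also have "\<dots> = (\<Sum>z\<in>X. \<Sum>P\<in>S. if hit P z then 1 else 0)" by (rule sum.swap)
  also have "\<dots> = (\<Sum>z\<in>X. real (card {P \<in> S. hit P z}))"
    by (intro sum.cong refl) (simp add: sum.inter_filter[OF finS, symmetric])
  also have "\<dots> \<le> (\<Sum>z\<in>X. B (snd z))"
    by (intro sum_mono) (auto simp: X_def intro!: B1)
  also have "\<dots> = (\<Sum>z\<in>(SIGMA v:V. Z v). B (fst z))" unfolding X_def by (subst sum.reindex) auto
  also have "\<dots> = (\<Sum>v\<in>V. \<Sum>u\<in>Z v. B v)" using V Z by (subst sum.Sigma) (auto simp: case_prod_unfold)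
  also have "\<dots> = (\<Sum>v\<in>V. real (card (Z v)) * B v)" by simp
  also have "\<dots> \<le> (\<Sum>v\<in>V. (w * real v + 1) ^ ?n * B v)" using Z B0 by (intro sum_mono mult_right_mono) auto
  also have "\<dots> \<le> (\<Sum>v\<in>V. (2 * real v) ^ ?n
      + ?M * (2 * 512 ^ ?n * (real v powr (real ?n - real ?n * \<tau>) + real q powr (real ?n * \<tau>) * real v powr - (real ?n * \<tau>)))
      + ?M * (32 ^ ?n * real N powr \<epsilon> * (if real N powr (1/2) \<le> real v powr \<tau> then real v powr (real ?n - real ?n * \<tau>) else 0)))"
  proof (rule sum_mono)
    fix v assume v: "v \<in> V"
    have v0: "real v \<ge> 1" using V(2)[OF v] by simp
    \<comment> \<open>Two bounds for the number of numerators: the crude \<open>e1\<close> serves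
      the summand 1 and the packing term, while the volume term needs \<open>e2\<close>, whose
      \<open>w ^ n\<close> cancels the \<open>1 / w ^ n\<close>.\<close>
    have "w * real v + 1 \<le> 1 * real v + real v" using w v0 by (intro add_mono mult_right_mono) auto
    then have e1: "(w * real v + 1) ^ ?n \<le> (2 * real v) ^ ?n" using w by (intro power_mono) auto
    have "(w * real v + 1) ^ ?n \<le> (2 * max (w * real v) 1) ^ ?n" using w by (intro power_mono) auto
    also have "\<dots> = 2 ^ ?n * max (w * real v) 1 ^ ?n" by (simp add: power_mult_distrib)
    also have "max (w * real v) 1 ^ ?n \<le> w ^ ?n * real v ^ ?n + 1" using w by (auto simp: max_def power_mult_distrib)
    finally have e2: "(w * real v + 1) ^ ?n \<le> 2 ^ ?n * (w ^ ?n * real v ^ ?n + 1)" by simp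
    define y where "y = real v powr - (real ?n * \<tau>)"
    have y: "y \<ge> 0" "real v ^ ?n * y = real v powr (real ?n - real ?n * \<tau>)"
      using v0 by (auto simp: y_def powr_realpow[symmetric] powr_add[symmetric])
    have "(w * real v + 1) ^ ?n * (?M * y * (2 * 256 ^ ?n / w ^ ?n))
       \<le> 2 ^ ?n * (w ^ ?n * real v ^ ?n + 1) * (?M * y * (2 * 256 ^ ?n / w ^ ?n))"
      using e2 y w by (intro mult_right_mono) auto
    also have "\<dots> = ?M * (2 * 512 ^ ?n * (real v ^ ?n * y + (1 / w ^ ?n) * y))"
    proof -
      have "(512::real) ^ ?n = 2 ^ ?n * 256 ^ ?n" using power_mult_distrib[of "2::real" 256 ?n] by simp
      moreover have "w ^ ?n \<noteq> 0" using w by simp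
      ultimately show ?thesis by (simp add: field_simps)
    qed
    finally have t1: "(w * real v + 1) ^ ?n * (?M * y * (2 * 256 ^ ?n / w ^ ?n))
       \<le> ?M * (2 * 512 ^ ?n * (real v powr (real ?n - real ?n * \<tau>) + real q powr (real ?n * \<tau>) * y))"
      unfolding y(2) wn .
    have "(w * real v + 1) ^ ?n * (?M * y * L v) \<le> (2 * real v) ^ ?n * (?M * y * L v)"
      using e1 y by (intro mult_right_mono) (auto simp: L_def)
    also have "\<dots> = ?M * (2 ^ ?n * (real v ^ ?n * y) * L v)" by (simp add: power_mult_distrib mult_ac)
    also have "\<dots> = ?M * (32 ^ ?n * real N powr \<epsilon> * (if real N powr (1/2) \<le> real v powr \<tau> then real v powr (real ?n - real ?n * \<tau>) else 0))"
      unfolding y(2) L_def using power_mult_distrib[of "2::real" 16 ?n] by simp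
    finally have t2: "(w * real v + 1) ^ ?n * (?M * y * L v) \<le> ?M * (32 ^ ?n * real N powr \<epsilon> * (if real N powr (1/2) \<le> real v powr \<tau> then real v powr (real ?n - real ?n * \<tau>) else 0))" .
    have "(w * real v + 1) ^ ?n * B v = (w * real v + 1) ^ ?n + (w * real v + 1) ^ ?n * (?M * y * (2 * 256 ^ ?n / w ^ ?n)) + (w * real v + 1) ^ ?n * (?M * y * L v)"
      unfolding B_def y_def by (simp only: distrib_left mult_1_right add.assoc)
    then show "(w * real v + 1) ^ ?n * B v \<le> (2 * real v) ^ ?n
      + ?M * (2 * 512 ^ ?n * (real v powr (real ?n - real ?n * \<tau>) + real q powr (real ?n * \<tau>) * real v powr - (real ?n * \<tau>)))
      + ?M * (32 ^ ?n * real N powr \<epsilon> * (if real N powr (1/2) \<le> real v powr \<tau> then real v powr (real ?n - real ?n * \<tau>) else 0))"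
      using add_mono[OF add_mono[OF e1 t1] t2] unfolding y_def by (simp only:)
  qed
  also have "\<dots> = (\<Sum>v\<in>V. (2 * real v) ^ ?n)
      + ?M / 8 * (16 * 512 ^ ?n * (\<Sum>v\<in>V. real v powr (real ?n - real ?n * \<tau>) + real q powr (real ?n * \<tau>) * real v powr - (real ?n * \<tau>)))
      + ?M / 8 * (8 * 32 ^ ?n * real N powr \<epsilon> * (\<Sum>v\<in>{v\<in>V. real N powr (1/2) \<le> real v powr \<tau>}. real v powr (real ?n - real ?n * \<tau>)))"
    unfolding sum.inter_filter[OF V(1)] sum_distrib_left sum.distrib[symmetric] by (intro sum.cong refl) simp
  also have "\<dots> \<le> ?M / 8 + ?M / 8 * 1 + ?M / 8 * 1"
    using V2 by (intro add_mono mult_left_mono V1 V3) auto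
  finally show "(\<Sum>P\<in>S. real (card (bad P))) \<le> 3 / 8 * ?M" by simp
qed

text \<open>A tail estimate without integrals: the part \<open>1 + \<eta>\<close> of the exponent
  pays for convergence with a fixed constant, the rest \<open>b\<close> is evaluated at the lower
  end \<open>Y\<close>.\<close>

lemma powr_tail_sum:
  fixes \<eta> b Y :: real
  assumes "\<eta> > 0" "b \<ge> 0" "Y > 0" "finite V" "\<And>v. v \<in> V \<Longrightarrow> Y \<le> real v"
  shows "(\<Sum>v\<in>V. real v powr (- (1 + \<eta>) - b)) \<le> (\<Sum>v. real v powr - (1 + \<eta>)) * Y powr - b"
proof -
  have summ: "summable (\<lambda>v. real v powr - (1 + \<eta>))" using assms by (simp add: summable_real_powr_iff)
  have "(\<Sum>v\<in>V. real v powr (- (1 + \<eta>) - b)) \<le> (\<Sum>v\<in>V. real v powr - (1 + \<eta>) * Y powr - b)"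
  proof (rule sum_mono)
    fix v assume v: "v \<in> V"
    have "real v powr - b \<le> Y powr - b" using assms v by (intro powr_mono2') auto
    then have "real v powr - (1 + \<eta>) * real v powr - b \<le> real v powr - (1 + \<eta>) * Y powr - b" by (intro mult_left_mono) auto
    then show "real v powr (- (1 + \<eta>) - b) \<le> real v powr - (1 + \<eta>) * Y powr - b" by (simp add: powr_add[symmetric])
  qed
  also have "\<dots> = (\<Sum>v\<in>V. real v powr - (1 + \<eta>)) * Y powr - b" by (simp add: sum_distrib_right)
  also have "\<dots> \<le> (\<Sum>v. real v powr - (1 + \<eta>)) * Y powr - b"
    by (intro mult_right_mono sum_le_suminf summ assms) auto
  finally show ?thesis .
qed

section \<open>Choice of a child and one refinement step\<close>

text \<open>
  Truncating the cost of a covering set at 1 lets a single estimate serve two purposes: a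
  total below 1 excludes the sets that are too large for the child box and bounds the rest.
\<close>

lemma cheap_child:
  fixes k :: "'n::finite" and p :: "int ^ 'n" and U :: "nat \<Rightarrow> (real ^ 'n) set" and d :: "nat \<Rightarrow> real"
  assumes g: "good_children k (box_centre \<tau> p q) (real q powr - \<tau> / 8) \<epsilon> N R S \<delta>"
    and R: "R \<subseteq> {N..<2*N}" and N: "N > 0" and q: "q > 0" and M: "card S > 0"
    and \<tau>: "\<tau> > 0" and s: "s > 0" "s < real CARD('n)"
    and \<delta>: "4 * real N powr - \<tau> \<le> \<delta>"
    and N2: "8 * (2 * real N) powr (\<tau> * s) \<le> real (card S)"
    and N3: "16 * 8 ^ CARD('n) * real N powr \<epsilon> * real N powr - ((real CARD('n) - s) / 2) \<le> 1"
    and N4: "real N powr - \<tau> \<le> real q powr - \<tau> / 8"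
    and d: "\<And>i. d i > 0" "\<And>i x y. \<lbrakk>x \<in> U i; y \<in> U i\<rbrakk> \<Longrightarrow> infnorm (x - y) \<le> d i"
    and summ: "summable (\<lambda>i. d i powr s)"
    and \<gamma>: "\<gamma> > 0" "\<gamma> ^ CARD('n) \<le> 1 / (16 * 128 ^ CARD('n))"
    and inv: "(\<Sum>i. if U i \<inter> approx_box \<tau> p q \<noteq> {} then d i powr s else 0) \<le> (\<gamma> * real q powr - \<tau>) powr s"
    and V: "finite V" "\<And>v. v \<in> V \<Longrightarrow> 0 < v \<and> v \<le> N \<and> real v powr - \<tau> \<le> real q powr - \<tau> / 4"
    and V1: "16 * 512 ^ CARD('n) * (\<Sum>v\<in>V. real v powr (real CARD('n) - real CARD('n) * \<tau>)
        + real q powr (real CARD('n) * \<tau>) * real v powr - (real CARD('n) * \<tau>)) \<le> 1"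
    and V2: "8 * (\<Sum>v\<in>V. (2 * real v) ^ CARD('n)) \<le> real (card S)"
    and V3: "8 * 32 ^ CARD('n) * real N powr \<epsilon> *
        (\<Sum>v\<in>{v\<in>V. real N powr (1/2) \<le> real v powr \<tau>}. real v powr (real CARD('n) - real CARD('n) * \<tau>)) \<le> 1"
  shows "\<exists>p' q'. q' \<in> R \<and> coprime (p' $ k) (int q') \<and> approx_box \<tau> p' q' \<subseteq> approx_box \<tau> p q \<and>
    (\<Sum>i. if U i \<inter> approx_box \<tau> p' q' \<noteq> {} then d i powr s else 0) \<le> (\<gamma> * real q' powr - \<tau>) powr s \<and>
    (\<forall>x\<in>approx_box \<tau> p' q'. \<forall>u. \<forall>v\<in>V. \<not> infnorm (x - rat_vec u v) < real v powr - \<tau>)"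
proof -
  define bad where "bad = (\<lambda>P :: (int ^ 'n) \<times> nat. {(u :: int ^ 'n, v). v \<in> V \<and> (\<exists>x\<in>approx_box \<tau> (fst P) (snd P). infnorm (x - rat_vec u v) < real v powr - \<tau>)})"
  have bad1: "finite (bad P)" if "P \<in> S" for P
    unfolding bad_def by (rule bad_cost(1)[OF g R N q \<tau> N4 V V1 V2 V3 that])
  have bad2: "(\<Sum>P\<in>S. real (card (bad P))) \<le> 3 / 8 * real (card S)"
    unfolding bad_def by (rule bad_cost(2)[OF g R N q \<tau> N4 V V1 V2 V3])
  define K where "K = (\<gamma> * (2 * real N) powr - \<tau>) powr s"
  have K: "K > 0" unfolding K_def using \<gamma> N by simp
  define u where "u = (\<lambda>P i. if U i \<inter> approx_box \<tau> (fst P) (snd P) \<noteq> {} then min 1 (d i powr s / K) else 0)"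
  have cov: "(\<Sum>P\<in>S. suminf (u P)) \<le> 3 / 8 * real (card S)"
    unfolding u_def K_def by (rule cover_cost[OF g R N q \<tau> s \<delta> N2 N3 N4 d summ \<gamma> inv])
  have Spts: "S \<subseteq> box_rationals k (box_centre \<tau> p q) (real q powr - \<tau> / 8) R"
    using g unfolding good_children_def by blast
  \<comment> \<open>Both averages over the children are at most 3/8, so some child has total below
    1; its number of unwanted rationals is an integer below 1, hence 0.\<close>
  have "\<exists>P\<in>S. suminf (u P) + real (card (bad P)) < 1"
  proof (rule ccontr)
    assume "\<not> ?thesis"
    then have "(\<Sum>P\<in>S. 1) \<le> (\<Sum>P\<in>S. suminf (u P) + real (card (bad P)))" by (intro sum_mono) auto
    also have "\<dots> \<le> 6 / 8 * real (card S)" unfolding sum.distrib using cov bad2 by linarith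
    finally show False using M by simp
  qed
  then obtain P where P: "P \<in> S" "suminf (u P) + real (card (bad P)) < 1" by auto
  have su: "summable (u P)" unfolding u_def
    by (rule summable_comparison_test'[OF summable_divide[OF summ, of K], of 0]) (use K in auto)
  have u0: "u P i \<ge> 0" for i unfolding u_def using K by auto
  have "suminf (u P) \<ge> 0" using su u0 by (rule suminf_nonneg)
  then have "card (bad P) = 0" using P(2) by linarith
  then have bad0: "bad P = {}" using bad1[OF P(1)] by simp
  have u1: "suminf (u P) < 1" using P(2) by linarith
  \<comment> \<open>A total below 1 means that no truncation took place, so the costs can be scaled
    back to \<open>d i powr s\<close>.\<close>
  have ui: "u P i = (if U i \<inter> approx_box \<tau> (fst P) (snd P) \<noteq> {} then d i powr s / K else 0)" for i
  proof -
    have "u P i \<le> suminf (u P)" using sum_le_suminf[OF su, of "{i}"] u0 by auto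
    then have "u P i < 1" using u1 by linarith
    then show ?thesis unfolding u_def by (auto split: if_splits)
  qed
  define f where "f = (\<lambda>i. if U i \<inter> approx_box \<tau> (fst P) (snd P) \<noteq> {} then d i powr s else 0)"
  have "f = (\<lambda>i. u P i * K)" unfolding f_def ui using K by auto
  then have "suminf f = suminf (u P) * K" using suminf_mult2[OF su, of K] by simp
  also have "\<dots> \<le> 1 * K" using u1 K by (intro mult_right_mono) auto
  finally have fK: "suminf f \<le> K" by simp
  have PP: "(fst P, snd P) \<in> box_rationals k (box_centre \<tau> p q) (real q powr - \<tau> / 8) R" using Spts P by auto
  then have qR: "snd P \<in> R" "coprime (fst P $ k) (int (snd P))" unfolding box_rationals_def by auto
  then have qP: "N \<le> snd P" "snd P \<le> 2 * N" using R by auto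
  have "real (snd P) powr - \<tau> \<le> real N powr - \<tau>" using qP N \<tau> by (intro powr_mono2') auto
  then have sub: "approx_box \<tau> (fst P) (snd P) \<subseteq> approx_box \<tau> p q"
    using approx_box_subset[OF PP] qP N N4 by linarith
  \<comment> \<open>\<open>K\<close> was formed with the upper bound \<open>2 * N\<close> for child
    denominators, so it is small enough for every child.\<close>
  have "(2 * real N) powr - \<tau> \<le> real (snd P) powr - \<tau>" using qP N \<tau> by (intro powr_mono2') auto
  then have "\<gamma> * (2 * real N) powr - \<tau> \<le> \<gamma> * real (snd P) powr - \<tau>" using \<gamma>(1) by simp
  then have "K \<le> (\<gamma> * real (snd P) powr - \<tau>) powr s"
    unfolding K_def using \<gamma>(1) s(1) by (intro powr_mono2) auto
  then have "suminf f \<le> (\<gamma> * real (snd P) powr - \<tau>) powr s" using fK by linarith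
  moreover have "\<forall>x\<in>approx_box \<tau> (fst P) (snd P). \<forall>u. \<forall>v\<in>V. \<not> infnorm (x - rat_vec u v) < real v powr - \<tau>"
    using bad0 unfolding bad_def by blast
  ultimately show ?thesis using qR sub unfolding f_def by blast
qed

text \<open>\<open>\<gamma>\<close> and \<open>q0\<close> are fixed before the cover is seen, so
  that an admissible total cost can be named in advance; \<open>N\<close> is chosen only after the
  box. The clause on \<open>v\<close> treats the denominators that \<open>rational_gap\<close>,
  applied to \<open>q\<close> and to \<open>q'\<close>, leaves open.\<close>

lemma refinement_step:
  fixes k :: "'n::finite" and \<tau> s t :: real and Q :: "nat set"
  assumes \<tau>: "\<tau> > 2 + 1 / real CARD('n)"
    and s: "s > 0" "s < real CARD('n)" and t: "t \<ge> 0" and st: "\<tau> * s < real CARD('n) + t"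
    and dense: "\<And>N0. \<exists>N\<ge>N0. real N powr t \<le> real (card (Q \<inter> {N..<2*N}))"
  shows "\<exists>\<gamma>>0. \<exists>q0>0. \<forall>q\<ge>q0. \<forall>(p :: int ^ 'n) (U :: nat \<Rightarrow> (real ^ 'n) set) d.
    (\<forall>i. d i > 0) \<longrightarrow> (\<forall>i. \<forall>x\<in>U i. \<forall>y\<in>U i. infnorm (x - y) \<le> d i) \<longrightarrow> summable (\<lambda>i. d i powr s) \<longrightarrow>
    (\<Sum>i. if U i \<inter> approx_box \<tau> p q \<noteq> {} then d i powr s else 0) \<le> (\<gamma> * real q powr - \<tau>) powr s \<longrightarrow>
    (\<exists>p' q'. q < q' \<and> q' \<in> Q \<and> coprime (p' $ k) (int q') \<and> approx_box \<tau> p' q' \<subseteq> approx_box \<tau> p q \<and>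
    (\<Sum>i. if U i \<inter> approx_box \<tau> p' q' \<noteq> {} then d i powr s else 0) \<le> (\<gamma> * real q' powr - \<tau>) powr s \<and>
    (\<forall>x\<in>approx_box \<tau> p' q'. \<forall>u v. v > 0 \<longrightarrow> real q powr (\<tau> - 1) \<le> 2 * real v \<longrightarrow> real v powr (\<tau> - 1) \<le> 2 * real q' \<longrightarrow>
       \<not> infnorm (x - rat_vec u v) < real v powr - \<tau>))"
proof -
  define n where "n = real CARD('n)"
  have n1: "n \<ge> 1" unfolding n_def by (simp add: Suc_le_eq)
  have n\<tau>: "n * \<tau> > 2 * n + 1" using \<tau> n1 unfolding n_def[symmetric] by (simp add: field_simps)
  have \<tau>2: "\<tau> > 2"
  proof -
    have "1 / n > 0" using n1 by simp
    then show ?thesis using \<tau> unfolding n_def by linarith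
  qed
  \<comment> \<open>The exponent spent on convergence of the tail sums, half of the surplus 1
    available in \<open>nb\<close>. What remains of the exponents \<open>n * \<tau> - n\<close> and
    \<open>n * \<tau>\<close> for the decay of the tails is \<open>a\<close> and
    \<open>b\<close>.\<close>
  define \<eta> where "\<eta> = 1 / (2 * (\<tau> - 1))"
  have \<eta>: "\<eta> > 0" "\<eta> < 1 / 2" "\<eta> * (\<tau> - 1) = 1 / 2" unfolding \<eta>_def using \<tau>2 by (auto simp: field_simps)
  define a where "a = n * \<tau> - n - 1 - \<eta>"
  define b where "b = n * \<tau> - 1 - \<eta>"
  have a: "a > 0" using n\<tau> n1 \<eta> unfolding a_def by linarith
  have b: "b > 0" using a n1 unfolding a_def b_def by linarith
  \<comment> \<open>The place where \<open>\<tau> > 2 + 1/n\<close> is essential: it makes the rationals with denominators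
    between \<open>q powr (\<tau> - 1)\<close> and \<open>q powr \<tau>\<close> occupy a small proportion of the box.\<close>
  have nb: "n * \<tau> - (\<tau> - 1) * b \<le> - (1 / 2)"
  proof -
    have "\<tau> * (n * \<tau> - 2 * n - 1) \<ge> 0" using \<tau>2 n\<tau> by (intro mult_nonneg_nonneg) auto
    then show ?thesis using \<eta>(3) unfolding b_def by (simp add: algebra_simps)
  qed
  \<comment> \<open>Rationals of denominator up to about \<open>N powr (1 / (\<tau> - 1))\<close> in
    a bounded region number about \<open>N powr e\<close>. The inequality \<open>e < n\<close> is
    equivalent to \<open>\<tau> > 2 + 1/n\<close> and makes them fewer than the children.\<close>
  define e where "e = (n + 1) / (\<tau> - 1)"
  have e: "e < n" using n\<tau> \<tau>2 unfolding e_def by (simp add: field_simps)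
  \<comment> \<open>One entry for each condition that must survive a loss
    \<open>N powr \<epsilon>\<close>: the separation of the children, \<open>N2\<close>,
    \<open>N3\<close>, \<open>V2\<close> and \<open>V3\<close>, in this order.\<close>
  define m where "m = Min {1, n + t - \<tau> * s, (n - s) / 2, n - e, a / (2 * \<tau>)}"
  have "m > 0" unfolding m_def using st s e a \<tau>2 by (auto simp: n_def)
  define \<epsilon> where "\<epsilon> = m / 2"
  have mm: "m \<le> 1" "m \<le> n + t - \<tau> * s" "m \<le> (n - s) / 2" "m \<le> n - e" "m \<le> a / (2 * \<tau>)"
    unfolding m_def by (rule Min_le; blast)+
  have \<epsilon>: "\<epsilon> > 0" "\<epsilon> < 1" "\<epsilon> < n + t - \<tau> * s" "\<epsilon> < (n - s) / 2" "\<epsilon> < n - e" "\<epsilon> < a / (2 * \<tau>)"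
    using mm \<open>m > 0\<close> unfolding \<epsilon>_def by linarith+
  define Z where "Z = (\<Sum>v. real v powr - (1 + \<eta>))"
  have Z: "Z \<ge> 0" unfolding Z_def using \<eta> by (intro suminf_nonneg) (simp_all add: summable_real_powr_iff)
  define \<gamma> where "\<gamma> = root CARD('n) (1 / (16 * 128 ^ CARD('n)))"
  have \<gamma>: "\<gamma> > 0" "\<gamma> ^ CARD('n) = 1 / (16 * 128 ^ CARD('n))" unfolding \<gamma>_def by simp_all
  have eq: "eventually (\<lambda>q::nat. q > 0 \<and> 8 * real q powr 0 \<le> real q powr (\<tau> - 2) \<and>
      32 * 512 ^ CARD('n) * Z * 2 powr a * real q powr - ((\<tau> - 1) * a) \<le> real q powr 0 \<and>
      32 * 512 ^ CARD('n) * Z * 2 powr b * real q powr (n * \<tau> - (\<tau> - 1) * b) \<le> real q powr 0) sequentially"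
    using \<tau>2 a nb by (intro eventually_conj eventually_powr_dominated eventually_gt_at_top) auto
  then obtain q0 where q0: "\<And>q. q \<ge> q0 \<Longrightarrow> q > 0 \<and> 8 * real q powr 0 \<le> real q powr (\<tau> - 2) \<and>
      32 * 512 ^ CARD('n) * Z * 2 powr a * real q powr - ((\<tau> - 1) * a) \<le> real q powr 0 \<and>
      32 * 512 ^ CARD('n) * Z * 2 powr b * real q powr (n * \<tau> - (\<tau> - 1) * b) \<le> real q powr 0"
    unfolding eventually_sequentially by blast
  have "q0 > 0" using q0[of q0] by simp
  show ?thesis
  proof (intro exI[of _ \<gamma>] exI[of _ q0] conjI allI impI \<gamma>(1) \<open>q0 > 0\<close>)
    fix q :: nat and p :: "int ^ 'n" and U :: "nat \<Rightarrow> (real ^ 'n) set" and d :: "nat \<Rightarrow> real"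
    assume qq0: "q0 \<le> q" and d1: "\<forall>i. 0 < d i" and d2: "\<forall>i. \<forall>x\<in>U i. \<forall>y\<in>U i. infnorm (x - y) \<le> d i"
      and summ: "summable (\<lambda>i. d i powr s)"
      and inv: "(\<Sum>i. if U i \<inter> approx_box \<tau> p q \<noteq> {} then d i powr s else 0) \<le> (\<gamma> * real q powr - \<tau>) powr s"
    have q: "q > 0" "8 \<le> real q powr (\<tau> - 2)"
      "32 * 512 ^ CARD('n) * Z * 2 powr a * real q powr - ((\<tau> - 1) * a) \<le> 1"
      "32 * 512 ^ CARD('n) * Z * 2 powr b * real q powr (n * \<tau> - (\<tau> - 1) * b) \<le> 1"
      using q0[OF qq0] by auto
    define w where "w = real q powr - \<tau>"
    have w: "w > 0" "w \<le> 1" using q(1) \<tau>2 powr_mono[of "- \<tau>" 0 "real q"] unfolding w_def by auto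
    have evN: "eventually (\<lambda>N::nat. q < N \<and> 16 ^ CARD('n) * real N powr - (n * \<tau>) \<le> real N powr (- \<epsilon> - (n + 1)) \<and>
       8 * 2 powr (\<tau> * s) * real N powr (\<tau> * s) \<le> real N powr (n + t - \<epsilon>) \<and>
       16 * 8 ^ CARD('n) * real N powr (\<epsilon> - (n - s) / 2) \<le> real N powr 0 \<and>
       8 / w * real N powr - \<tau> \<le> real N powr 0 \<and>
       5 * real N powr 1 \<le> real N powr (\<tau> - 1) \<and>
       8 * 2 ^ CARD('n) * 4 powr e * real N powr e \<le> real N powr (n - \<epsilon>) \<and>
       8 * 32 ^ CARD('n) * Z * real N powr (\<epsilon> - a / (2 * \<tau>)) \<le> real N powr 0) sequentially"
      using \<tau>2 n\<tau> \<epsilon> n1 by (intro eventually_conj eventually_powr_dominated eventually_gt_at_top) auto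
    have w8: "0 < real q powr - \<tau> / 8" "real q powr - \<tau> / 8 \<le> 1 / 2" using w unfolding w_def by auto
    obtain N0 where N0: "\<And>N. N \<ge> N0 \<Longrightarrow> (\<forall>R. R \<subseteq> {N..<2*N} \<and> R \<noteq> {} \<longrightarrow>
        (\<exists>S \<delta>. good_children k (box_centre \<tau> p q) (real q powr - \<tau> / 8) \<epsilon> N R S \<delta>)) \<and>
       (q < N \<and> 16 ^ CARD('n) * real N powr - (n * \<tau>) \<le> real N powr (- \<epsilon> - (n + 1)) \<and>
       8 * 2 powr (\<tau> * s) * real N powr (\<tau> * s) \<le> real N powr (n + t - \<epsilon>) \<and>
       16 * 8 ^ CARD('n) * real N powr (\<epsilon> - (n - s) / 2) \<le> real N powr 0 \<and>
       8 / w * real N powr - \<tau> \<le> real N powr 0 \<and>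
       5 * real N powr 1 \<le> real N powr (\<tau> - 1) \<and>
       8 * 2 ^ CARD('n) * 4 powr e * real N powr e \<le> real N powr (n - \<epsilon>) \<and>
       8 * 32 ^ CARD('n) * Z * real N powr (\<epsilon> - a / (2 * \<tau>)) \<le> real N powr 0)"
      using eventually_conj[OF eventually_good_children[OF w8 \<epsilon>(1)] evN]
      unfolding eventually_sequentially by blast
    obtain N where N: "N \<ge> N0" "real N powr t \<le> real (card (Q \<inter> {N..<2*N}))" using dense by blast
    define R where "R = Q \<inter> {N..<2*N}"
    have qN: "q < N" using N0[OF N(1)] by blast
    have Npos: "N > 0" using qN by simp
    have E: "16 ^ CARD('n) * real N powr - (n * \<tau>) \<le> real N powr (- \<epsilon> - (n + 1))"
       "8 * 2 powr (\<tau> * s) * real N powr (\<tau> * s) \<le> real N powr (n + t - \<epsilon>)"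
       "16 * 8 ^ CARD('n) * real N powr (\<epsilon> - (n - s) / 2) \<le> 1"
       "8 / w * real N powr - \<tau> \<le> 1"
       "5 * real N \<le> real N powr (\<tau> - 1)"
       "8 * 2 ^ CARD('n) * 4 powr e * real N powr e \<le> real N powr (n - \<epsilon>)"
       "8 * 32 ^ CARD('n) * Z * real N powr (\<epsilon> - a / (2 * \<tau>)) \<le> 1"
      using N0[OF N(1)] Npos by auto
    have R: "R \<subseteq> {N..<2*N}" by (auto simp: R_def)
    have "real N powr t \<ge> 1" using Npos t by (intro ge_one_powr_ge_zero) auto
    then have cR: "real (card R) \<ge> 1" "real N powr t \<le> real (card R)" using N(2) unfolding R_def by linarith+
    then have "R \<noteq> {}" by auto
    then obtain S \<delta> where g: "good_children k (box_centre \<tau> p q) (real q powr - \<tau> / 8) \<epsilon> N R S \<delta>"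
      using N0[OF N(1)] R by blast
    have gS: "real (card R) * real N powr (n - \<epsilon>) \<le> real (card S)" "real N powr - \<epsilon> \<le> \<delta> ^ CARD('n) * real (card S)"
      "real (card S) \<le> 4 ^ CARD('n) * real N ^ (CARD('n) + 1)" "\<delta> > 0"
      using g unfolding good_children_def n_def by blast+
    have Mt: "real N powr (n + t - \<epsilon>) \<le> real (card S)"
    proof -
      have "real N powr (n + t - \<epsilon>) = real N powr t * real N powr (n - \<epsilon>)" by (simp add: powr_add[symmetric] algebra_simps)
      also have "\<dots> \<le> real (card R) * real N powr (n - \<epsilon>)" using cR by (intro mult_right_mono) auto
      finally show ?thesis using gS(1) by linarith
    qed
    have M0: "real N powr (n - \<epsilon>) \<le> real (card S)"
      using mult_right_mono[OF cR(1), of "real N powr (n - \<epsilon>)"] gS(1) by simp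
    have "real N powr (n - \<epsilon>) > 0" using Npos by simp
    then have Mpos: "card S > 0" using M0 by linarith
    \<comment> \<open>The product \<open>\<delta> ^ n * card S\<close> is at least
      \<open>N powr - \<epsilon>\<close> and there are at most about \<open>N powr (n + 1)\<close>
      children, so \<open>n * \<tau> > n + 1 + \<epsilon>\<close> is enough.\<close>
    have \<delta>: "4 * real N powr - \<tau> \<le> \<delta>"
    proof -
      have "4 ^ CARD('n) * real N powr - (n * \<tau>) * real (card S) \<le> 4 ^ CARD('n) * real N powr - (n * \<tau>) * (4 ^ CARD('n) * real N ^ (CARD('n) + 1))"
        using gS(3) by (intro mult_left_mono) auto
      also have "\<dots> = 16 ^ CARD('n) * real N powr - (n * \<tau>) * real N powr (n + 1)"
      proof -
        have "real N ^ (CARD('n) + 1) = real N powr (n + 1)"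
          using Npos powr_realpow[of "real N" "CARD('n) + 1"] unfolding n_def by (simp add: add.commute)
        then show ?thesis using power_mult_distrib[of "4::real" 4 "CARD('n)"] by simp
      qed
      also have "\<dots> \<le> real N powr (- \<epsilon> - (n + 1)) * real N powr (n + 1)" using E(1) by (intro mult_right_mono) auto
      also have "\<dots> = real N powr - \<epsilon>" by (simp add: powr_add[symmetric])
      also have "\<dots> \<le> \<delta> ^ CARD('n) * real (card S)" by (rule gS(2))
      finally have "4 ^ CARD('n) * real N powr - (n * \<tau>) \<le> \<delta> ^ CARD('n)" using Mpos by simp
      moreover have "real N powr - (n * \<tau>) = (real N powr - \<tau>) ^ CARD('n)"
        using Npos unfolding n_def by (simp add: powr_realpow[symmetric] powr_powr mult.commute)
      ultimately have "(4 * real N powr - \<tau>) ^ CARD('n) \<le> \<delta> ^ CARD('n)" by (simp add: power_mult_distrib)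
      then show ?thesis using gS(4) by (subst (asm) power_mono_iff) auto
    qed
    have N2: "8 * (2 * real N) powr (\<tau> * s) \<le> real (card S)"
      using E(2) Mt Npos by (simp add: powr_mult)
    have N3: "16 * 8 ^ CARD('n) * real N powr \<epsilon> * real N powr - ((real CARD('n) - s) / 2) \<le> 1"
      using E(3) Npos unfolding n_def by (simp add: powr_add[symmetric] mult.assoc)
    have N4: "real N powr - \<tau> \<le> real q powr - \<tau> / 8"
      using E(4) w unfolding w_def[symmetric] by (simp add: field_simps)
    \<comment> \<open>The denominator \<open>q'\<close> is not yet known, so \<open>2 * q'\<close>
      is replaced by its upper bound \<open>4 * N\<close>.\<close>
    define V where "V = {v::nat. 0 < v \<and> real q powr (\<tau> - 1) \<le> 2 * real v \<and> real v powr (\<tau> - 1) \<le> 4 * real N}"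
    have VN: "v \<le> N" if "v \<in> V" for v
    proof (rule ccontr)
      assume "\<not> v \<le> N"
      then have "real N powr (\<tau> - 1) \<le> real v powr (\<tau> - 1)" using \<tau>2 by (intro powr_mono2) auto
      then show False using that E(5) Npos unfolding V_def by simp
    qed
    have finV: "finite V" by (rule finite_subset[of _ "{..N}"]) (use VN in auto)
    \<comment> \<open>The lower end of \<open>V\<close>. That it is at least \<open>4 * q\<close>
      makes the unwanted balls small against the parent box.\<close>
    define Y where "Y = real q powr (\<tau> - 1) / 2"
    have Y: "Y > 0" "4 * real q \<le> Y"
    proof -
      show "Y > 0" unfolding Y_def using q by simp
      have "8 * real q \<le> real q powr (\<tau> - 2) * real q" using q(2) by (intro mult_right_mono) auto
      also have "\<dots> = real q powr (\<tau> - 1)" using q(1) powr_add[of "real q" "\<tau> - 2" 1] by simp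
      finally show "4 * real q \<le> Y" unfolding Y_def by simp
    qed
    have VY: "Y \<le> real v" if "v \<in> V" for v using that unfolding V_def Y_def by auto
    have Vw: "real v powr - \<tau> \<le> real q powr - \<tau> / 4" if "v \<in> V" for v
    proof -
      have "real v powr - \<tau> \<le> (4 * real q) powr - \<tau>" using VY[OF that] Y q(1) \<tau>2 by (intro powr_mono2') auto
      also have "\<dots> = 4 powr - \<tau> * real q powr - \<tau>" by (simp add: powr_mult)
      also have "\<dots> \<le> 4 powr - 1 * real q powr - \<tau>" using \<tau>2 by (intro mult_right_mono powr_mono) auto
      finally show ?thesis by (simp add: powr_minus_divide)
    qed
    have V': "0 < v \<and> v \<le> N \<and> real v powr - \<tau> \<le> real q powr - \<tau> / 4" if "v \<in> V" for v
      using VN[OF that] Vw[OF that] that unfolding V_def by auto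
    have ex: "n - n * \<tau> = - (1 + \<eta>) - a" "- (n * \<tau>) = - (1 + \<eta>) - b"
      unfolding a_def b_def by auto
    have V1: "16 * 512 ^ CARD('n) * (\<Sum>v\<in>V. real v powr (real CARD('n) - real CARD('n) * \<tau>)
        + real q powr (real CARD('n) * \<tau>) * real v powr - (real CARD('n) * \<tau>)) \<le> 1"
    proof -
      have Ya: "Y powr - x = 2 powr x * real q powr - ((\<tau> - 1) * x)" for x
        unfolding Y_def by (simp add: powr_divide powr_powr powr_minus_divide)
      have "(\<Sum>v\<in>V. real v powr (- (1 + \<eta>) - a)) \<le> Z * Y powr - a"
        unfolding Z_def by (rule powr_tail_sum) (use \<eta> a Y finV VY in auto)
      then have 1: "16 * 512 ^ CARD('n) * (\<Sum>v\<in>V. real v powr (- (1 + \<eta>) - a)) \<le> 1 / 2"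
      proof -
        assume A: "(\<Sum>v\<in>V. real v powr (- (1 + \<eta>) - a)) \<le> Z * Y powr - a"
        have "16 * 512 ^ CARD('n) * (\<Sum>v\<in>V. real v powr (- (1 + \<eta>) - a)) \<le> 16 * 512 ^ CARD('n) * (Z * Y powr - a)"
          using A by (intro mult_left_mono) auto
        also have "\<dots> = (32 * 512 ^ CARD('n) * Z * 2 powr a * real q powr - ((\<tau> - 1) * a)) / 2" unfolding Ya by simp
        finally show ?thesis using q(3) by linarith
      qed
      have "(\<Sum>v\<in>V. real v powr (- (1 + \<eta>) - b)) \<le> Z * Y powr - b"
        unfolding Z_def by (rule powr_tail_sum) (use \<eta> b Y finV VY in auto)
      then have "16 * 512 ^ CARD('n) * (real q powr (n * \<tau>) * (\<Sum>v\<in>V. real v powr (- (1 + \<eta>) - b)))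
         \<le> 16 * 512 ^ CARD('n) * (real q powr (n * \<tau>) * (Z * Y powr - b))"
        by (intro mult_left_mono) auto
      also have "\<dots> = (32 * 512 ^ CARD('n) * Z * 2 powr b * real q powr (n * \<tau> - (\<tau> - 1) * b)) / 2"
        unfolding Ya by (simp add: powr_diff powr_minus_divide)
      finally have 2: "16 * 512 ^ CARD('n) * (real q powr (n * \<tau>) * (\<Sum>v\<in>V. real v powr (- (1 + \<eta>) - b))) \<le> 1 / 2"
        using q(4) by linarith
      show ?thesis unfolding n_def[symmetric] unfolding ex sum.distrib sum_distrib_left[symmetric] distrib_left
        using 1 2 by linarith
    qed
    have V2: "8 * (\<Sum>v\<in>V. (2 * real v) ^ CARD('n)) \<le> real (card S)"
    proof -
      define X where "X = (4 * real N) powr (1 / (\<tau> - 1))"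
      have VX: "real v \<le> X" if "v \<in> V" for v
      proof -
        have "(real v powr (\<tau> - 1)) powr (1 / (\<tau> - 1)) \<le> X" unfolding X_def
          using that \<tau>2 unfolding V_def by (intro powr_mono2) auto
        then show ?thesis using \<tau>2 by (simp add: powr_powr)
      qed
      have X0: "X \<ge> 0" by (simp add: X_def)
      have "V \<subseteq> {1..nat \<lfloor>X\<rfloor>}" using VX V' by (auto simp: le_nat_floor Suc_le_eq)
      then have "card V \<le> card {1..nat \<lfloor>X\<rfloor>}" by (intro card_mono) auto
      then have cV: "real (card V) \<le> X" using X0 by simp linarith
      have "(\<Sum>v\<in>V. (2 * real v) ^ CARD('n)) \<le> (\<Sum>v\<in>V. (2 * X) ^ CARD('n))"
        using VX by (intro sum_mono power_mono) auto
      also have "\<dots> = real (card V) * (2 * X) ^ CARD('n)" by simp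
      also have "\<dots> \<le> X * (2 * X) ^ CARD('n)" using cV X0 by (intro mult_right_mono) auto
      also have "\<dots> = 2 ^ CARD('n) * X ^ (CARD('n) + 1)" by (simp add: power_mult_distrib)
      also have "X ^ (CARD('n) + 1) = (4 * real N) powr e"
      proof -
        have "X > 0" unfolding X_def using Npos by simp
        then have "X ^ (CARD('n) + 1) = X powr (n + 1)" using powr_realpow[of X "CARD('n) + 1"] unfolding n_def by (simp add: add.commute)
        then show ?thesis unfolding X_def e_def by (simp add: powr_powr)
      qed
      also have "\<dots> = 4 powr e * real N powr e" by (simp add: powr_mult)
      finally have "8 * (\<Sum>v\<in>V. (2 * real v) ^ CARD('n)) \<le> 8 * 2 ^ CARD('n) * 4 powr e * real N powr e" by simp
      then show ?thesis using E(6) M0 by linarith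
    qed
    have V3: "8 * 32 ^ CARD('n) * real N powr \<epsilon> *
        (\<Sum>v\<in>{v\<in>V. real N powr (1/2) \<le> real v powr \<tau>}. real v powr (real CARD('n) - real CARD('n) * \<tau>)) \<le> 1"
    proof -
      have "(\<Sum>v\<in>{v\<in>V. real N powr (1/2) \<le> real v powr \<tau>}. real v powr (- (1 + \<eta>) - a)) \<le> Z * (real N powr (1 / (2 * \<tau>))) powr - a"
        unfolding Z_def
      proof (rule powr_tail_sum)
        fix v assume "v \<in> {v\<in>V. real N powr (1/2) \<le> real v powr \<tau>}"
        then have "(real N powr (1/2)) powr (1 / \<tau>) \<le> (real v powr \<tau>) powr (1 / \<tau>)" using \<tau>2 by (intro powr_mono2) auto
        then show "real N powr (1 / (2 * \<tau>)) \<le> real v" using \<tau>2 by (simp add: powr_powr)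
      qed (use \<eta> a finV Npos in auto)
      also have "\<dots> = Z * real N powr - (a / (2 * \<tau>))" by (simp add: powr_powr)
      finally have "8 * 32 ^ CARD('n) * real N powr \<epsilon> * (\<Sum>v\<in>{v\<in>V. real N powr (1/2) \<le> real v powr \<tau>}. real v powr (- (1 + \<eta>) - a))
        \<le> 8 * 32 ^ CARD('n) * real N powr \<epsilon> * (Z * real N powr - (a / (2 * \<tau>)))" by (intro mult_left_mono) auto
      also have "\<dots> = 8 * 32 ^ CARD('n) * Z * real N powr (\<epsilon> - a / (2 * \<tau>))" by (simp add: powr_diff powr_minus_divide)
      finally show ?thesis unfolding n_def[symmetric] unfolding ex using E(7) by linarith
    qed
    obtain p' q' where pq: "q' \<in> R" "coprime (p' $ k) (int q')" "approx_box \<tau> p' q' \<subseteq> approx_box \<tau> p q"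
      "(\<Sum>i. if U i \<inter> approx_box \<tau> p' q' \<noteq> {} then d i powr s else 0) \<le> (\<gamma> * real q' powr - \<tau>) powr s"
      "\<forall>x\<in>approx_box \<tau> p' q'. \<forall>u. \<forall>v\<in>V. \<not> infnorm (x - rat_vec u v) < real v powr - \<tau>"
      using cheap_child[OF g R Npos q(1) Mpos _ s \<delta> N2 N3 N4 _ _ summ \<gamma>(1) _ inv finV V' V1 V2 V3] d1 d2 \<tau>2 \<gamma>(2) by auto
    have q': "q' \<in> Q" "q < q'" "q' \<le> 2 * N" using pq(1) qN unfolding R_def by auto
    have "v \<in> V" if "v > 0" "real q powr (\<tau> - 1) \<le> 2 * real v" "real v powr (\<tau> - 1) \<le> 2 * real q'" for v
      using that q'(3) unfolding V_def by auto
    then show "\<exists>p' q'. q < q' \<and> q' \<in> Q \<and> coprime (p' $ k) (int q') \<and> approx_box \<tau> p' q' \<subseteq> approx_box \<tau> p q \<and>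
      (\<Sum>i. if U i \<inter> approx_box \<tau> p' q' \<noteq> {} then d i powr s else 0) \<le> (\<gamma> * real q' powr - \<tau>) powr s \<and>
      (\<forall>x\<in>approx_box \<tau> p' q'. \<forall>u v. v > 0 \<longrightarrow> real q powr (\<tau> - 1) \<le> 2 * real v \<longrightarrow> real v powr (\<tau> - 1) \<le> 2 * real q' \<longrightarrow>
       \<not> infnorm (x - rat_vec u v) < real v powr - \<tau>)"
      using pq q' by (intro exI[of _ p'] exI[of _ q']) auto
  qed
qed

subsection \<open>The limit point\<close>

text \<open>Distinct rationals differ by at least \<open>1 / (v * q)\<close> in some coordinate,
  while both lie near \<open>x\<close>, so
  \<open>1 < v * q * (q powr - \<tau> + v powr - \<tau>)\<close>. The smaller denominator gives the
  dominant term and decides the alternative.\<close>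

lemma rational_gap:
  fixes u p :: "int ^ 'n"
  assumes "q > 0" "v > 0" "\<tau> > 0" and ne: "rat_vec u v \<noteq> rat_vec p q"
    and 1: "infnorm (x - rat_vec p q) < real q powr - \<tau>" and 2: "infnorm (x - rat_vec u v) < real v powr - \<tau>"
  shows "real v powr (\<tau> - 1) < 2 * real q \<or> real q powr (\<tau> - 1) < 2 * real v"
proof -
  obtain i where i: "rat_vec u v $ i \<noteq> rat_vec p q $ i" using ne by (auto simp: vec_eq_iff)
  have e: "real v * real q * (rat_vec u v - rat_vec p q) $ i = real_of_int (u $ i * int q - p $ i * int v)"
    by (rule rat_vec_diff_nth) (use assms in auto)
  have "real v * real q * (rat_vec u v - rat_vec p q) $ i \<noteq> 0" using i assms(1,2) by simp
  then have "u $ i * int q - p $ i * int v \<noteq> 0" unfolding e by (metis of_int_0)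
  then have "1 \<le> \<bar>u $ i * int q - p $ i * int v\<bar>" by linarith
  then have "1 \<le> \<bar>real_of_int (u $ i * int q - p $ i * int v)\<bar>" by linarith
  then have a: "1 \<le> real v * real q * \<bar>(rat_vec u v - rat_vec p q) $ i\<bar>"
    unfolding e[symmetric] by (simp add: abs_mult del: vector_minus_component)
  have "\<bar>x $ i - rat_vec p q $ i\<bar> < real q powr - \<tau>" "\<bar>x $ i - rat_vec u v $ i\<bar> < real v powr - \<tau>"
    using 1 2 unfolding infnorm_less_vec by auto
  then have b: "\<bar>(rat_vec u v - rat_vec p q) $ i\<bar> < real q powr - \<tau> + real v powr - \<tau>"
    unfolding vector_minus_component by linarith
  have pos: "real v * real q > 0" using assms by simp
  have c: "1 < real v * real q * (real q powr - \<tau> + real v powr - \<tau>)"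
    using a mult_strict_left_mono[OF b pos] by linarith
  have pw: "real y * real y powr - \<tau> = 1 / real y powr (\<tau> - 1)" if "y > 0" for y :: nat
    using that by (simp add: powr_diff powr_minus_divide)
  show ?thesis
  proof (cases "v \<le> q")
    case True
    have "real q powr - \<tau> \<le> real v powr - \<tau>" using True assms by (intro powr_mono2') auto
    then have "real v * real q * (real q powr - \<tau> + real v powr - \<tau>) \<le> real v * real q * (2 * real v powr - \<tau>)"
      using pos by (intro mult_left_mono) auto
    also have "\<dots> = 2 * real q * (real v * real v powr - \<tau>)" by simp
    finally have "1 < 2 * real q / real v powr (\<tau> - 1)" using c pw[OF assms(2)] by simp
    then show ?thesis using assms(2) by (simp add: field_simps)
  next
    case False
    have "real v powr - \<tau> \<le> real q powr - \<tau>" using False assms by (intro powr_mono2') auto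
    then have "real v * real q * (real q powr - \<tau> + real v powr - \<tau>) \<le> real v * real q * (2 * real q powr - \<tau>)"
      using pos by (intro mult_left_mono) auto
    also have "\<dots> = 2 * real v * (real q * real q powr - \<tau>)" by simp
    finally have "1 < 2 * real v / real q powr (\<tau> - 1)" using c pw[OF assms(1)] by simp
    then show ?thesis using assms(1) by (simp add: field_simps)
  qed
qed

lemma approx_box_cbox:
  "approx_box \<tau> p q = cbox (\<chi> i. rat_vec p q $ i + real q powr - \<tau> / 4) (\<chi> i. rat_vec p q $ i + 3 * real q powr - \<tau> / 4)"
proof -
  have "\<bar>x - (a + w / 2)\<bar> \<le> w / 4 \<longleftrightarrow> a + w / 4 \<le> x \<and> x \<le> a + 3 * w / 4" for x a w :: real by linarith
  then show ?thesis unfolding approx_box_def by (auto simp: mem_box_cart set_eq_iff)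
qed

lemma finite_approximations:
  fixes x :: "real ^ 'n"
  assumes "v > 0"
  shows "finite {u :: int ^ 'n. infnorm (x - rat_vec u v) < \<rho>}"
proof (rule finite_subset)
  let ?B = "\<lambda>i. {\<lfloor>real v * (x $ i - \<rho>)\<rfloor>..\<lceil>real v * (x $ i + \<rho>)\<rceil>}"
  show "finite {u. \<forall>i. u $ i \<in> ?B i}" by (rule finite_vec_box) auto
  show "{u :: int ^ 'n. infnorm (x - rat_vec u v) < \<rho>} \<subseteq> {u. \<forall>i. u $ i \<in> ?B i}"
  proof (intro subsetI CollectI allI)
    fix u :: "int ^ 'n" and i assume "u \<in> {u. infnorm (x - rat_vec u v) < \<rho>}"
    then have "\<bar>x $ i - real_of_int (u $ i) / real v\<bar> < \<rho>" unfolding infnorm_less_vec rat_vec_def by auto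
    then have "x $ i - \<rho> < real_of_int (u $ i) / real v" "real_of_int (u $ i) / real v < x $ i + \<rho>" by linarith+
    then have "real v * (x $ i - \<rho>) < real_of_int (u $ i)" "real_of_int (u $ i) < real v * (x $ i + \<rho>)"
      using assms by (simp_all add: field_simps)
    then show "u $ i \<in> ?B i" by simp linarith
  qed
qed

text \<open>Hence infinitely many approximations to one point have unbounded denominators.\<close>

lemma finite_bounded_approximations:
  fixes x :: "real ^ 'n"
  shows "finite {(u :: int ^ 'n, v). 0 < v \<and> v \<le> B \<and> infnorm (x - rat_vec u v) < real v powr - \<tau>}"
proof (rule finite_subset)
  show "finite (\<Union>v\<in>{1..B}. {u :: int ^ 'n. infnorm (x - rat_vec u v) < real v powr - \<tau>} \<times> {v})"
    by (auto intro!: finite_approximations)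
qed auto

text \<open>Let \<open>v > 2 * q 0\<close> lie outside \<open>Q\<close>. For the last
  \<open>j\<close> with \<open>2 * q j \<le> v powr (\<tau> - 1)\<close>, \<open>avoid\<close> and
  \<open>rational_gap\<close> leave only \<open>u / v = p j / q j\<close>. Then \<open>v\<close> is
  a proper multiple of \<open>q j\<close>, and the distance kept from \<open>p j / q j\<close> rules
  it out.\<close>

lemma nested_boxes_limit:
  fixes p :: "nat \<Rightarrow> int ^ 'n::finite" and q :: "nat \<Rightarrow> nat"
  assumes \<tau>: "\<tau> > 2" and q: "\<And>j. q j > 0" "strict_mono q" "\<And>j. q (Suc j) \<in> Q" and cop: "\<And>j. coprime (p j $ k) (int (q j))"
    and x: "\<And>j. x \<in> approx_box \<tau> (p j) (q j)"
    and avoid: "\<And>j u v. \<lbrakk>v > 0; real (q j) powr (\<tau> - 1) \<le> 2 * real v; real v powr (\<tau> - 1) \<le> 2 * real (q (Suc j))\<rbrakk>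
       \<Longrightarrow> \<not> infnorm (x - rat_vec u v) < real v powr - \<tau>"
  shows "x \<in> W_star \<tau> Q"
proof -
  have near: "infnorm (x - rat_vec (p j) (q j)) < real (q j) powr - \<tau>" "real (q j) powr - \<tau> / 4 \<le> infnorm (x - rat_vec (p j) (q j))" for j
    using approx_box_near[OF x q(1)] by auto
  have "inj (\<lambda>j. (p j, q j))" using strict_mono_imp_inj_on[OF q(2)] by (auto simp: inj_on_def)
  then have "infinite (range (\<lambda>j. (p j, q j)))" using finite_imageD infinite_UNIV_nat by blast
  moreover have "range (\<lambda>j. (p j, q j)) \<subseteq> {(p, q). q \<in> {1..} \<and> infnorm (x - rat_vec p q) < real q powr - \<tau>}"
    using near q(1) by (auto simp: Suc_le_eq)
  ultimately have 1: "x \<in> W \<tau> {1..}" unfolding W_def using finite_subset by blast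
  have small: "v \<le> 2 * q 0" if v: "v > 0" "v \<notin> Q" "infnorm (x - rat_vec u v) < real v powr - \<tau>" for u v
  proof (rule ccontr)
    assume "\<not> v \<le> 2 * q 0"
    then have v0: "2 * q 0 < v" by simp
    have "real v powr 1 \<le> real v powr (\<tau> - 1)" using v(1) \<tau> by (intro powr_mono) auto
    then have v1: "real v \<le> real v powr (\<tau> - 1)" using v(1) by simp
    define J where "J = {j. 2 * real (q j) \<le> real v powr (\<tau> - 1)}"
    have J0: "0 \<in> J" unfolding J_def using v0 v1 by simp
    have "J \<subseteq> {..nat \<lceil>real v powr (\<tau> - 1)\<rceil>}"
    proof
      fix j assume "j \<in> J"
      moreover have "j \<le> q j" using q(2) by (rule strict_mono_imp_increasing)
      ultimately show "j \<in> {..nat \<lceil>real v powr (\<tau> - 1)\<rceil>}" unfolding J_def by simp linarith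
    qed
    then have finJ: "finite J" using finite_subset by blast
    define j where "j = Max J"
    have "j \<in> J" unfolding j_def using finJ J0 by (intro Max_in) auto
    then have j1: "2 * real (q j) \<le> real v powr (\<tau> - 1)" unfolding J_def by simp
    have "Suc j \<notin> J" using Max_ge[OF finJ, of "Suc j"] unfolding j_def by auto
    then have j2: "real v powr (\<tau> - 1) \<le> 2 * real (q (Suc j))" unfolding J_def by simp
    have j3: "2 * real v < real (q j) powr (\<tau> - 1)" using avoid[OF v(1) _ j2, of u] v(3) by (meson not_less)
    have eq: "rat_vec u v = rat_vec (p j) (q j)"
      using rational_gap[OF q(1)[of j] v(1) _ _ near(1)[of j] v(3)] \<tau> j1 j3 by fastforce
    have "rat_vec u v $ k = rat_vec (p j) (q j) $ k" by (simp add: eq)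
    then have "real_of_int (u $ k * int (q j)) = real_of_int (p j $ k * int v)"
      using v(1) q(1)[of j] unfolding rat_vec_def by (simp add: field_simps)
    then have "u $ k * int (q j) = p j $ k * int v" by linarith
    then have "int (q j) dvd p j $ k * int v" by (metis dvd_triv_right)
    then have "int (q j) dvd int v" using cop[of j] by (metis coprime_commute coprime_dvd_mult_right_iff)
    then obtain c where c: "v = q j * c" by auto
    \<comment> \<open>For \<open>j > 0\<close> because \<open>q j\<close> lies in \<open>Q\<close>;
      for \<open>j = 0\<close>, where this is not assumed, because \<open>v\<close> exceeds
      \<open>2 * q 0\<close>.\<close>
    have "v \<noteq> q j"
    proof
      assume "v = q j"
      show False
      proof (cases j)
        case 0
        then show False using \<open>v = q j\<close> v0 by simp
      next
        case (Suc i)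
        then show False using \<open>v = q j\<close> q(3)[of i] v(2) by simp
      qed
    qed
    then have "c \<noteq> 1" "c \<noteq> 0" using c v(1) by auto
    then have "2 \<le> c" by linarith
    then have "2 * q j \<le> v" unfolding c by simp
    then have "2 * real (q j) \<le> real v" by linarith
    \<comment> \<open>Since \<open>\<tau> > 2\<close>, the factor \<open>2 powr - \<tau>\<close> is
      at most 1/4, the inner radius of the annulus.\<close>
    then have "real v powr - \<tau> \<le> (2 * real (q j)) powr - \<tau>" using q(1)[of j] \<tau> by (intro powr_mono2') auto
    also have "\<dots> = 2 powr - \<tau> * real (q j) powr - \<tau>" by (simp add: powr_mult)
    also have "\<dots> \<le> 2 powr - 2 * real (q j) powr - \<tau>" using \<tau> by (intro mult_right_mono powr_mono) auto
    also have "2 powr - 2 = (1 / 4 :: real)" by (simp add: powr_minus_divide)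
    finally show False using v(3) near(2)[of j] unfolding eq by simp
  qed
  have "finite {(u :: int ^ 'n, v). v \<in> {1..} - Q \<and> infnorm (x - rat_vec u v) < real v powr - \<tau>}"
    by (rule finite_subset[OF _ finite_bounded_approximations[of "2 * q 0" x \<tau>]]) (use small in auto)
  then have 2: "x \<notin> W \<tau> ({1..} - Q)" unfolding W_def by simp
  show ?thesis using 1 2 unfolding W_star_def by blast
qed

text \<open>The conclusion concerns countable covers of any shape: only sizes enter, and neither
  compactness nor openness of the sets is used. Positive sizes are what the last contradiction
  needs.\<close>

lemma W_star_escapes:
  fixes \<tau> s t :: real and Q :: "nat set"
  assumes \<tau>: "\<tau> > 2 + 1 / real CARD('n)"
    and s: "s > 0" "s < real CARD('n)" and t: "t \<ge> 0" and st: "\<tau> * s < real CARD('n) + t"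
    and dense: "\<And>N0. \<exists>N\<ge>N0. real N powr t \<le> real (card (Q \<inter> {N..<2*N}))"
  shows "\<exists>\<epsilon>>0. \<forall>(U :: nat \<Rightarrow> (real ^ 'n::finite) set) d.
    (\<forall>i. d i > 0) \<longrightarrow> (\<forall>i. \<forall>x\<in>U i. \<forall>y\<in>U i. infnorm (x - y) \<le> d i) \<longrightarrow> summable (\<lambda>i. d i powr s) \<longrightarrow>
    (\<Sum>i. d i powr s) \<le> \<epsilon> \<longrightarrow> (\<exists>x\<in>W_star \<tau> Q. \<forall>i. x \<notin> U i)"
proof -
  fix k :: 'n
  have "(0::real) < 1 / real CARD('n)" by simp
  then have \<tau>2: "\<tau> > 2" using \<tau> by linarith
  obtain \<gamma> q0 where \<gamma>: "\<gamma> > 0" and q0: "q0 > 0" and step: "\<forall>q\<ge>q0. \<forall>(p :: int ^ 'n) (U :: nat \<Rightarrow> (real ^ 'n) set) d.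
    (\<forall>i. d i > 0) \<longrightarrow> (\<forall>i. \<forall>x\<in>U i. \<forall>y\<in>U i. infnorm (x - y) \<le> d i) \<longrightarrow> summable (\<lambda>i. d i powr s) \<longrightarrow>
    (\<Sum>i. if U i \<inter> approx_box \<tau> p q \<noteq> {} then d i powr s else 0) \<le> (\<gamma> * real q powr - \<tau>) powr s \<longrightarrow>
    (\<exists>p' q'. q < q' \<and> q' \<in> Q \<and> coprime (p' $ k) (int q') \<and> approx_box \<tau> p' q' \<subseteq> approx_box \<tau> p q \<and>
    (\<Sum>i. if U i \<inter> approx_box \<tau> p' q' \<noteq> {} then d i powr s else 0) \<le> (\<gamma> * real q' powr - \<tau>) powr s \<and>
    (\<forall>x\<in>approx_box \<tau> p' q'. \<forall>u v. v > 0 \<longrightarrow> real q powr (\<tau> - 1) \<le> 2 * real v \<longrightarrow> real v powr (\<tau> - 1) \<le> 2 * real q' \<longrightarrow>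
       \<not> infnorm (x - rat_vec u v) < real v powr - \<tau>))"
    using refinement_step[OF \<tau> s t st dense, of k] by (elim exE conjE) rule
  define \<epsilon> where "\<epsilon> = (\<gamma> * real q0 powr - \<tau>) powr s"
  have \<epsilon>: "\<epsilon> > 0" unfolding \<epsilon>_def using \<gamma> q0 by simp
  show ?thesis
  proof (intro exI[of _ \<epsilon>] conjI allI impI \<epsilon>)
    fix U :: "nat \<Rightarrow> (real ^ 'n) set" and d :: "nat \<Rightarrow> real"
    assume d: "\<forall>i. 0 < d i" "\<forall>i. \<forall>x\<in>U i. \<forall>y\<in>U i. infnorm (x - y) \<le> d i" and summ: "summable (\<lambda>i. d i powr s)"
      and le: "(\<Sum>i. d i powr s) \<le> \<epsilon>"
    define F where "F = (\<lambda>(P :: (int ^ 'n) \<times> nat) i. if U i \<inter> approx_box \<tau> (fst P) (snd P) \<noteq> {} then d i powr s else 0)"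
    have sF: "summable (F P)" for P unfolding F_def by (rule summable_comparison_test'[OF summ, of 0]) auto
    define I where "I = (\<lambda>P :: (int ^ 'n) \<times> nat. q0 \<le> snd P \<and> coprime (fst P $ k) (int (snd P)) \<and>
       suminf (F P) \<le> (\<gamma> * real (snd P) powr - \<tau>) powr s)"
    define Rel where "Rel = (\<lambda>P P' :: (int ^ 'n) \<times> nat. snd P < snd P' \<and> snd P' \<in> Q \<and>
       approx_box \<tau> (fst P') (snd P') \<subseteq> approx_box \<tau> (fst P) (snd P) \<and>
       (\<forall>x\<in>approx_box \<tau> (fst P') (snd P'). \<forall>u v. v > 0 \<longrightarrow> real (snd P) powr (\<tau> - 1) \<le> 2 * real v \<longrightarrow> real v powr (\<tau> - 1) \<le> 2 * real (snd P') \<longrightarrow>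
       \<not> infnorm (x - rat_vec u v) < real v powr - \<tau>))"
    \<comment> \<open>The numerator 1 is coprime to every \<open>q0\<close>, which need not lie in
      \<open>Q\<close>; \<open>\<epsilon>\<close> is exactly the cost allowed for this first
      box.\<close>
    have "I ((\<chi> i. 1), q0)"
    proof -
      have "suminf (F ((\<chi> i. 1), q0)) \<le> (\<Sum>i. d i powr s)"
        by (intro suminf_le sF summ) (auto simp: F_def)
      then show ?thesis unfolding I_def using le unfolding \<epsilon>_def by simp
    qed
    moreover have "\<exists>P'. I P' \<and> Rel P P'" if "I P" for P
    proof -
      have PI: "q0 \<le> snd P"
        "(\<Sum>i. if U i \<inter> approx_box \<tau> (fst P) (snd P) \<noteq> {} then d i powr s else 0) \<le> (\<gamma> * real (snd P) powr - \<tau>) powr s"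
        using that unfolding I_def F_def by iprover+
      define \<Psi> where "\<Psi> = (\<lambda>(p' :: int ^ 'n) q'. snd P < q' \<and> q' \<in> Q \<and> coprime (p' $ k) (int q') \<and>
        approx_box \<tau> p' q' \<subseteq> approx_box \<tau> (fst P) (snd P) \<and>
        (\<Sum>i. if U i \<inter> approx_box \<tau> p' q' \<noteq> {} then d i powr s else 0) \<le> (\<gamma> * real q' powr - \<tau>) powr s \<and>
        (\<forall>x\<in>approx_box \<tau> p' q'. \<forall>u v. v > 0 \<longrightarrow> real (snd P) powr (\<tau> - 1) \<le> 2 * real v \<longrightarrow> real v powr (\<tau> - 1) \<le> 2 * real q' \<longrightarrow>
        \<not> infnorm (x - rat_vec u v) < real v powr - \<tau>))"
      have "\<exists>p' q'. \<Psi> p' q'" unfolding \<Psi>_def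
        by (rule step[THEN spec[where x = "snd P"], THEN mp, THEN spec[where x = "fst P"], THEN spec[where x = U],
          THEN spec[where x = d], THEN mp, OF _ d(1), THEN mp, OF _ d(2), THEN mp, OF _ summ, THEN mp, OF PI])
      then obtain p' q' where "\<Psi> p' q'" by blast
      then have pq: "snd P < q'" "q' \<in> Q" "coprime (p' $ k) (int q')" "approx_box \<tau> p' q' \<subseteq> approx_box \<tau> (fst P) (snd P)"
        "suminf (F (p', q')) \<le> (\<gamma> * real q' powr - \<tau>) powr s"
        "\<forall>x\<in>approx_box \<tau> p' q'. \<forall>u v. v > 0 \<longrightarrow> real (snd P) powr (\<tau> - 1) \<le> 2 * real v \<longrightarrow> real v powr (\<tau> - 1) \<le> 2 * real q' \<longrightarrow>
        \<not> infnorm (x - rat_vec u v) < real v powr - \<tau>"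
        unfolding \<Psi>_def F_def fst_conv snd_conv by iprover+
      have "q0 \<le> q'" using that pq(1) unfolding I_def by linarith
      then have "I (p', q')" using pq(3,5) unfolding I_def by simp
      moreover have "Rel P (p', q')" using pq(1,2,4,6) unfolding Rel_def by simp
      ultimately show ?thesis by blast
    qed
    ultimately have "\<exists>f. \<forall>j. I (f j) \<and> Rel (f j) (f (Suc j))"
      using dependent_nat_choice[of "\<lambda>_. I" "\<lambda>_. Rel"] by blast
    then obtain f where f: "\<And>j. I (f j)" "\<And>j. Rel (f j) (f (Suc j))" by blast
    define q where "q = (\<lambda>j. snd (f j))"
    define p where "p = (\<lambda>j. fst (f j))"
    have q: "\<And>j. q j > 0" "strict_mono q" "\<And>j. q (Suc j) \<in> Q" "\<And>j. coprime (p j $ k) (int (q j))"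
      using f q0 unfolding q_def p_def I_def Rel_def by (auto simp: strict_mono_Suc_iff intro: less_le_trans)
    have "\<exists>x. \<forall>j. x \<in> approx_box \<tau> (p j) (q j)"
    proof (rule bounded_closed_nest)
      fix j
      show "closed (approx_box \<tau> (p j) (q j))" unfolding approx_box_cbox by (rule closed_cbox)
      show "approx_box \<tau> (p j) (q j) \<noteq> {}" unfolding approx_box_cbox using q(1)[of j] by (simp add: interval_ne_empty_cart)
    next
      fix m j :: nat assume "m \<le> j"
      then show "approx_box \<tau> (p j) (q j) \<subseteq> approx_box \<tau> (p m) (q m)"
        by (rule lift_Suc_antimono_le[rotated]) (use f(2) in \<open>simp add: Rel_def p_def q_def\<close>)
    next
      show "bounded (approx_box \<tau> (p 0) (q 0))" unfolding approx_box_cbox by (rule bounded_cbox)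
    qed blast
    then obtain x where x: "\<And>j. x \<in> approx_box \<tau> (p j) (q j)" by blast
    have "x \<in> W_star \<tau> Q"
    proof (rule nested_boxes_limit[OF \<tau>2 q x])
      fix j u v assume "0 < v" "real (q j) powr (\<tau> - 1) \<le> 2 * real v" "real v powr (\<tau> - 1) \<le> 2 * real (q (Suc j))"
      then show "\<not> infnorm (x - rat_vec u v) < real v powr - \<tau>"
        using f(2)[of j] x[of "Suc j"] unfolding Rel_def p_def q_def by blast
    qed
    moreover have "x \<notin> U i" for i
    proof
      assume xU: "x \<in> U i"
      \<comment> \<open>A set containing \<open>x\<close> meets every box, so its own cost is below
        the bound of the invariant at every stage.\<close>
      have di: "d i \<le> \<gamma> * real (q j) powr - \<tau>" for j
      proof -
        have "d i powr s = F (f j) i" unfolding F_def using xU x[of j] unfolding p_def q_def by auto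
        also have "\<dots> \<le> suminf (F (f j))" using sum_le_suminf[OF sF, of "{i}" "f j"] by (auto simp: F_def)
        also have "\<dots> \<le> (\<gamma> * real (q j) powr - \<tau>) powr s" using f(1) unfolding I_def q_def by blast
        finally have a: "d i powr s \<le> (\<gamma> * real (q j) powr - \<tau>) powr s" .
        have "0 \<le> \<gamma> * real (q j) powr - \<tau>" using \<gamma> by simp
        then show ?thesis using powr_less_mono2[OF s(1), of "\<gamma> * real (q j) powr - \<tau>" "d i"] a by linarith
      qed
      have "eventually (\<lambda>N::nat. 2 * \<gamma> / d i * real N powr - \<tau> \<le> real N powr 0) sequentially"
        using \<tau>2 by (intro eventually_powr_dominated) auto
      then obtain N0 where N0: "\<And>N. N \<ge> N0 \<Longrightarrow> 2 * \<gamma> / d i * real N powr - \<tau> \<le> real N powr 0"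
        unfolding eventually_sequentially by blast
      have "N0 \<le> q N0" using q(2) by (rule strict_mono_imp_increasing)
      then have "2 * \<gamma> / d i * real (q N0) powr - \<tau> \<le> 1" using N0[of "q N0"] q(1)[of N0] by simp
      then have "2 * (\<gamma> * real (q N0) powr - \<tau>) \<le> d i" using d(1) by (simp add: field_simps)
      then show False using di[of N0] d(1)[rule_format, of i] by linarith
    qed
    ultimately show "\<exists>x\<in>W_star \<tau> Q. \<forall>i. x \<notin> U i" by blast
  qed
qed

subsection \<open>Lower bound\<close>

lemma conv_exponent_nonneg: "0 \<le> conv_exponent Q" and conv_exponent_le:
  "\<lbrakk>0 < \<nu>; (\<lambda>q. real q powr - \<nu>) summable_on Q\<rbrakk> \<Longrightarrow> conv_exponent Q \<le> \<nu>"
  and conv_exponent_less: "conv_exponent Q < y \<Longrightarrow> \<exists>\<nu>>0. \<nu> < y \<and> (\<lambda>q. real q powr - \<nu>) summable_on Q"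
  and conv_exponent_le_1: "conv_exponent Q \<le> 1"
proof -
  let ?E = "{\<nu>. 0 < \<nu> \<and> (\<lambda>q. real q powr - \<nu>) summable_on Q}"
  have in_E: "\<nu> \<in> ?E" if "\<nu> > 1" for \<nu>
  proof -
    have "summable (\<lambda>q. real q powr - \<nu>)" using that by (simp add: summable_real_powr_iff)
    then have "(\<lambda>q. real q powr - \<nu>) summable_on UNIV" by (subst summable_on_UNIV_nonneg_real_iff) auto
    then have "(\<lambda>q. real q powr - \<nu>) summable_on Q" by (rule summable_on_subset_banach) simp
    then show ?thesis using that by simp
  qed
  then have ne: "?E \<noteq> {}" by (metis empty_iff gt_ex)
  have bdd: "bdd_below ?E" by (rule bdd_belowI[of _ 0]) auto
  show "0 \<le> conv_exponent Q" unfolding conv_exponent_def by (rule cInf_greatest[OF ne]) auto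
  show le: "conv_exponent Q \<le> \<nu>" if "0 < \<nu>" "(\<lambda>q. real q powr - \<nu>) summable_on Q" for \<nu>
    unfolding conv_exponent_def using that by (intro cInf_lower bdd) auto
  show "\<exists>\<nu>>0. \<nu> < y \<and> (\<lambda>q. real q powr - \<nu>) summable_on Q" if "conv_exponent Q < y"
    using cInf_lessD[OF ne, of y] that unfolding conv_exponent_def by auto
  show "conv_exponent Q \<le> 1"
  proof (rule field_le_epsilon)
    fix e :: real assume "e > 0"
    then have "1 + e \<in> ?E" by (intro in_E) auto
    then show "conv_exponent Q \<le> 1 + e" using le by auto
  qed
qed

text \<open>If all late blocks were sparse, those starting at powers of 2 would contribute at most a
  geometric series to the sum of \<open>q powr - \<nu>\<close>, for any \<open>\<nu>\<close>
  strictly between \<open>t\<close> and \<open>conv_exponent Q\<close>.\<close>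

lemma dyadic_blocks_dense:
  assumes t: "0 \<le> t" "t < conv_exponent Q"
  shows "\<exists>N\<ge>N0. real N powr t \<le> real (card (Q \<inter> {N..<2*N}))"
proof (rule ccontr)
  assume "\<not> ?thesis"
  then have c: "real (card (Q \<inter> {N..<2*N})) < real N powr t" if "N \<ge> N0" for N using that by force
  define \<nu> where "\<nu> = (t + conv_exponent Q) / 2"
  have \<nu>: "t < \<nu>" "\<nu> < conv_exponent Q" "\<nu> > 0" using t unfolding \<nu>_def by auto
  define x where "x = (2::real) powr (t - \<nu>)"
  have x: "0 < x" "x < 1" unfolding x_def using \<nu> powr_less_mono[of "t - \<nu>" 0 2] by auto
  define g where "g = (\<lambda>J::nat. \<Sum>q\<in>Q \<inter> {..<2^J}. real q powr - \<nu>)"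
  have block: "g (Suc J) \<le> g J + x ^ J" if J: "J \<ge> N0" for J
  proof -
    have "N0 \<le> 2 ^ J" using J less_exp[of J] by linarith
    then have cJ: "real (card (Q \<inter> {2^J..<2*2^J})) \<le> real (2^J) powr t" using c[of "2^J"] by simp
    have "Q \<inter> {..<2^Suc J} = (Q \<inter> {..<2^J}) \<union> (Q \<inter> {2^J..<2*2^J})" by auto
    then have "g (Suc J) = g J + (\<Sum>q\<in>Q \<inter> {2^J..<2*2^J}. real q powr - \<nu>)"
      unfolding g_def using sum.union_disjoint[of "Q \<inter> {..<2^J}" "Q \<inter> {2^J..<2*2^J}" "\<lambda>q. real q powr - \<nu>"] by fastforce
    also have "(\<Sum>q\<in>Q \<inter> {2^J..<2*2^J}. real q powr - \<nu>) \<le> (\<Sum>q\<in>Q \<inter> {2^J..<2*2^J}. real (2^J) powr - \<nu>)"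
    proof (rule sum_mono)
      fix q assume "q \<in> Q \<inter> {2^J..<2*2^J}"
      then have "real (2^J) \<le> real q" by (simp only: of_nat_le_iff) auto
      then show "real q powr - \<nu> \<le> real (2^J) powr - \<nu>" using \<nu> by (intro powr_mono2') auto
    qed
    also have "\<dots> = real (card (Q \<inter> {2^J..<2*2^J})) * real (2^J) powr - \<nu>" by simp
    also have "\<dots> \<le> real (2^J) powr t * real (2^J) powr - \<nu>" using cJ by (intro mult_right_mono) auto
    also have "real (2^J) = 2 powr real J" by (simp add: powr_realpow)
    also have "(2 powr real J) powr t * (2 powr real J) powr - \<nu> = (2 powr real J) powr (t - \<nu>)"
      using powr_add[of "2 powr real J" t "- \<nu>"] by simp
    also have "\<dots> = x powr real J" unfolding x_def powr_powr by (simp only: mult.commute)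
    also have "\<dots> = x ^ J" by (rule powr_realpow[OF x(1)])
    finally show ?thesis by simp
  qed
  have gb: "g (N0 + j) \<le> g N0 + (\<Sum>i<N0 + j. x ^ i)" for j
  proof (induction j)
    case 0
    show ?case using x by (simp add: sum_nonneg)
  next
    case (Suc j)
    then show ?case using block[of "N0 + j"] by simp
  qed
  have geo: "(\<Sum>i<m. x ^ i) \<le> 1 / (1 - x)" for m :: nat
    using x by (simp add: sum_gp_strict divide_right_mono)
  have "(\<lambda>q. real q powr - \<nu>) summable_on Q"
  proof (rule nonneg_bdd_above_summable_on)
    show "bdd_above (sum (\<lambda>q. real q powr - \<nu>) ` {F. F \<subseteq> Q \<and> finite F})"
    proof (rule bdd_aboveI2)
      fix F assume F: "F \<in> {F. F \<subseteq> Q \<and> finite F}"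
      then obtain B where B: "\<forall>q\<in>F. q < B" unfolding finite_nat_set_iff_bounded mem_Collect_eq by blast
      have "F \<subseteq> Q \<inter> {..<2^(N0 + B)}"
      proof
        fix q assume "q \<in> F"
        moreover have "B < 2 ^ (N0 + B)"
          using less_exp[of B] power_increasing[of B "N0 + B" "2::nat"] by linarith
        ultimately show "q \<in> Q \<inter> {..<2^(N0 + B)}" using B F by force
      qed
      then have "(\<Sum>q\<in>F. real q powr - \<nu>) \<le> g (N0 + B)" unfolding g_def by (intro sum_mono2) auto
      also have "\<dots> \<le> g N0 + 1 / (1 - x)" using gb[of B] geo[of "N0 + B"] by linarith
      finally show "(\<Sum>q\<in>F. real q powr - \<nu>) \<le> g N0 + 1 / (1 - x)" .
    qed
  qed auto
  then have "conv_exponent Q \<le> \<nu>" using \<nu>(3) by (rule conv_exponent_le[rotated])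
  then show False using \<nu>(2) by simp
qed

text \<open>The case \<open>y < n\<close> takes \<open>t = 0\<close>, where one element of
  \<open>Q\<close> is enough for a block; this includes \<open>conv_exponent Q = 0\<close>, for
  which no \<open>t\<close> as in \<open>dyadic_blocks_dense\<close> exists.\<close>

lemma dense_scale_exists:
  assumes Q: "Q \<subseteq> {1..}" "infinite Q" and y: "y < n + conv_exponent Q"
  shows "\<exists>t\<ge>0. y < n + t \<and> (\<forall>N0. \<exists>N\<ge>N0. real N powr t \<le> real (card (Q \<inter> {N..<2*N})))"
proof (cases "y < n")
  case True
  have "\<exists>N\<ge>N0. real N powr 0 \<le> real (card (Q \<inter> {N..<2*N}))" for N0
  proof -
    obtain N where N: "N \<in> Q" "N \<ge> N0" using Q(2) by (meson infinite_nat_iff_unbounded_le)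
    have "N \<ge> 1" using N Q(1) by auto
    then have "N \<in> Q \<inter> {N..<2*N}" using N by auto
    then have "0 < card (Q \<inter> {N..<2*N})" by (auto simp: card_gt_0_iff)
    then have "1 \<le> real (card (Q \<inter> {N..<2*N}))" by linarith
    moreover have "real N powr 0 = 1" using \<open>N \<ge> 1\<close> by simp
    ultimately show ?thesis using N(2) by (intro exI[of _ N]) linarith
  qed
  then show ?thesis using True by (intro exI[of _ 0]) auto
next
  case False
  define t where "t = (y - n + conv_exponent Q) / 2"
  have "0 \<le> t" "t < conv_exponent Q" "y < n + t" unfolding t_def using False y conv_exponent_nonneg[of Q] by (auto simp: field_simps)
  then show ?thesis using dyadic_blocks_dense by blast
qed

text \<open>Passing to a larger exponent only lowers the cost of sets of diameter at most 1. This
  removes the convention for \<open>s = 0\<close> from the lower bound.\<close>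

lemma hausdorff_gauge_ge:
  assumes "diameter U \<le> 1" "bounded U" "0 \<le> s" "s \<le> s'" "s' > 0"
  shows "ennreal (diameter U powr s') \<le> hausdorff_gauge s U"
proof (cases "U = {}")
  case False
  have d: "diameter U \<ge> 0" using assms(2) by (rule diameter_ge_0)
  show ?thesis
  proof (cases "s = 0")
    case True
    have "diameter U powr s' \<le> 1" using d assms by (simp add: powr_le1)
    then show ?thesis using False True by (simp add: hausdorff_gauge_def ennreal_le_1)
  next
    case s: False
    have "diameter U powr s' \<le> diameter U powr s" using d assms by (intro powr_mono') auto
    then show ?thesis using False s by (simp add: hausdorff_gauge_def ennreal_leI)
  qed
qed (simp add: hausdorff_gauge_def)

lemma hausdorff_measure_W_star_pos:
  fixes Q :: "nat set" and \<tau> s :: real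
  assumes Q: "Q \<subseteq> {1..}" "infinite Q" and \<tau>: "\<tau> > 2 + 1 / real CARD('n::finite)"
    and s: "0 \<le> s" "s < (real CARD('n) + conv_exponent Q) / \<tau>"
  shows "hausdorff_measure s (W_star \<tau> Q :: (real ^ 'n) set) \<noteq> 0"
proof
  assume H: "hausdorff_measure s (W_star \<tau> Q :: (real ^ 'n) set) = 0"
  let ?n = "real CARD('n)"
  have n1: "?n \<ge> 1" by (simp add: Suc_le_eq)
  have inv: "0 < 1 / ?n" using n1 by simp
  then have \<tau>2: "\<tau> > 2" using \<tau> by linarith
  define T where "T = (?n + conv_exponent Q) / \<tau>"
  have "?n + conv_exponent Q > 0" using n1 conv_exponent_nonneg[of Q] by linarith
  then have T: "0 < T" unfolding T_def using \<tau>2 by simp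
  \<comment> \<open>The counts by volume and by packing gain only for exponents below
    \<open>n\<close>. Here \<open>conv_exponent Q \<le> 1\<close> meets
    \<open>n * \<tau> > 2 * n + 1\<close>.\<close>
  have Tn: "T < ?n"
  proof -
    have "?n * \<tau> > 2 * ?n + 1" using \<tau> n1 by (simp add: field_simps)
    then have "?n + conv_exponent Q < ?n * \<tau>" using conv_exponent_le_1[of Q] n1 by linarith
    then show ?thesis unfolding T_def using \<tau>2 by (simp add: field_simps)
  qed
  \<comment> \<open>Strictly between \<open>s\<close> and \<open>T\<close>, hence positive even when
    \<open>s = 0\<close>.\<close>
  define s' where "s' = (s + T) / 2"
  have s': "0 < s'" "s \<le> s'" "s' < T" "s' < ?n" using s(1) s(2)[folded T_def] T Tn unfolding s'_def by auto
  have "\<tau> * s' < ?n + conv_exponent Q" using s'(3) \<tau>2 unfolding T_def by (simp add: field_simps)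
  then obtain t where t: "t \<ge> 0" "\<tau> * s' < ?n + t" "\<And>N0. \<exists>N\<ge>N0. real N powr t \<le> real (card (Q \<inter> {N..<2*N}))"
    using dense_scale_exists[OF Q, of "\<tau> * s'" ?n] by blast
  obtain \<epsilon> where \<epsilon>: "\<epsilon> > 0" and esc: "\<And>(U :: nat \<Rightarrow> (real ^ 'n) set) d. \<lbrakk>\<forall>i. d i > 0;
      \<forall>i. \<forall>x\<in>U i. \<forall>y\<in>U i. infnorm (x - y) \<le> d i; summable (\<lambda>i. d i powr s'); (\<Sum>i. d i powr s') \<le> \<epsilon>\<rbrakk>
      \<Longrightarrow> \<exists>x\<in>W_star \<tau> Q. \<forall>i. x \<notin> U i"
    using W_star_escapes[OF \<tau> s'(1,4) t] by blast
  have "hausdorff_premeasure s 1 (W_star \<tau> Q :: (real ^ 'n) set) \<le> hausdorff_measure s (W_star \<tau> Q :: (real ^ 'n) set)"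
    unfolding hausdorff_measure_def by (rule SUP_upper) simp
  then have "hausdorff_premeasure s 1 (W_star \<tau> Q :: (real ^ 'n) set) < ennreal (\<epsilon> / 2)" using H \<epsilon> by simp
  then obtain U :: "nat \<Rightarrow> (real ^ 'n) set" where U: "(\<Sum>i. hausdorff_gauge s (U i)) < ennreal (\<epsilon> / 2)"
    "W_star \<tau> Q \<subseteq> (\<Union>i. U i)" "\<And>i. bounded (U i)" "\<And>i. diameter (U i) \<le> 1"
    unfolding hausdorff_premeasure_def Inf_less_iff by auto
  define f where "f = (\<lambda>i. diameter (U i) powr s')"
  have f0: "f i \<ge> 0" for i by (simp add: f_def)
  have "(\<Sum>i. ennreal (f i)) \<le> (\<Sum>i. hausdorff_gauge s (U i))"
    unfolding f_def by (intro suminf_le hausdorff_gauge_ge U s s') auto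
  then have fs: "(\<Sum>i. ennreal (f i)) < ennreal (\<epsilon> / 2)" using U(1) by (rule le_less_trans)
  then have sf: "summable f" using f0 by (intro summable_suminf_not_top) (auto simp: less_top[symmetric])
  have "ennreal (suminf f) < ennreal (\<epsilon> / 2)" using fs suminf_ennreal2[OF f0 sf] by simp
  then have sfe: "suminf f < \<epsilon> / 2" using \<epsilon> by (simp add: ennreal_less_iff suminf_nonneg[OF sf f0])
  \<comment> \<open>A cover may contain sets of diameter 0, but \<open>W_star_escapes\<close>
    requires positive sizes; the costs are padded by a series of sum
    \<open>\<epsilon> / 2\<close>.\<close>
  define g where "g = (\<lambda>i::nat. \<epsilon> / 2 * (1 / 2) ^ Suc i)"
  have g: "g sums (\<epsilon> / 2)" unfolding g_def using sums_mult[OF power_half_series, of "\<epsilon> / 2"] by simp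
  have g0: "g i > 0" for i unfolding g_def using \<epsilon> by simp
  define d where "d = (\<lambda>i. (f i + g i) powr (1 / s'))"
  have ds: "d i powr s' = f i + g i" for i
  proof -
    have "f i + g i > 0" using f0[of i] g0[of i] by simp
    then show ?thesis unfolding d_def using s' by (simp add: powr_powr)
  qed
  have d0: "d i > 0" for i
  proof -
    have "f i + g i > 0" using f0[of i] g0[of i] by simp
    then show ?thesis unfolding d_def by simp
  qed
  have dd: "diameter (U i) \<le> d i" for i
  proof (rule ccontr)
    assume "\<not> diameter (U i) \<le> d i"
    then have "d i powr s' < f i" unfolding f_def using d0[of i] s' by (intro powr_less_mono2) auto
    then show False unfolding ds using g0[of i] by simp
  qed
  have summ: "summable (\<lambda>i. d i powr s')" unfolding ds by (intro summable_add sf sums_summable[OF g])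
  have "(\<Sum>i. d i powr s') = suminf f + \<epsilon> / 2"
    unfolding ds using suminf_add[OF sf sums_summable[OF g]] sums_unique[OF g] by simp
  then have le: "(\<Sum>i. d i powr s') \<le> \<epsilon>" using sfe by simp
  have "infnorm (x - y) \<le> d i" if "x \<in> U i" "y \<in> U i" for x y i
  proof -
    have "infnorm (x - y) \<le> norm (x - y)" by (rule infnorm_le_norm)
    also have "\<dots> \<le> diameter (U i)" using diameter_bounded_bound[OF U(3) that] by (simp add: dist_norm)
    finally show ?thesis using dd[of i] by linarith
  qed
  then obtain x where "x \<in> W_star \<tau> Q" "\<forall>i. x \<notin> U i" using esc[of d U] d0 summ le by blast
  then show False using U(2) by blast
qed

subsection \<open>Upper bound\<close>

lemma summable_on_imp_summable_if:
  fixes f :: "nat \<Rightarrow> real"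
  assumes "f summable_on Q" "\<And>q. f q \<ge> 0"
  shows "summable (\<lambda>q. if q \<in> Q then f q else 0)"
proof -
  have "(\<lambda>q. if q \<in> Q then f q else 0) summable_on UNIV"
    using assms(1) by (subst summable_on_cong_neutral[where T = Q and g = f]) auto
  then show ?thesis by (subst (asm) summable_on_UNIV_nonneg_real_iff) (auto simp: assms)
qed

lemma approx_infinite_imp_large:
  fixes x :: "real ^ 'n"
  assumes x: "x \<in> W \<tau> Q" and Q: "Q \<subseteq> {1..}"
  shows "\<exists>p q. q \<in> Q \<and> B < q \<and> infnorm (x - rat_vec p q) < real q powr - \<tau>"
proof (rule ccontr)
  assume n: "\<not> ?thesis"
  have "{(p :: int ^ 'n, q). q \<in> Q \<and> infnorm (x - rat_vec p q) < real q powr - \<tau>}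
     \<subseteq> {(p, q). 0 < q \<and> q \<le> B \<and> infnorm (x - rat_vec p q) < real q powr - \<tau>}"
  proof (rule subsetI)
    fix z :: "(int ^ 'n) \<times> nat" assume z: "z \<in> {(p, q). q \<in> Q \<and> infnorm (x - rat_vec p q) < real q powr - \<tau>}"
    obtain p q where zpq: "z = (p, q)" by (cases z)
    have pq: "q \<in> Q" "infnorm (x - rat_vec p q) < real q powr - \<tau>" using z unfolding zpq by auto
    then have "q \<le> B" using n by (meson not_less)
    moreover have "0 < q" using pq(1) Q by auto
    ultimately show "z \<in> {(p, q). 0 < q \<and> q \<le> B \<and> infnorm (x - rat_vec p q) < real q powr - \<tau>}"
      using pq(2) unfolding zpq by simp
  qed
  then have "finite {(p :: int ^ 'n, q). q \<in> Q \<and> infnorm (x - rat_vec p q) < real q powr - \<tau>}"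
    by (rule finite_subset) (rule finite_bounded_approximations)
  then show False using x unfolding W_def by simp
qed

definition sup_ball :: "real ^ 'n \<Rightarrow> real \<Rightarrow> (real ^ 'n) set" where
  "sup_ball a \<rho> = {x. infnorm (x - a) < \<rho>}"

lemma sup_ball_bounds:
  fixes a :: "real ^ 'n::finite"
  assumes "\<rho> \<ge> 0"
  shows "bounded (sup_ball a \<rho>)" "diameter (sup_ball a \<rho>) \<le> 2 * real CARD('n) * \<rho>"
proof -
  have n1: "real CARD('n) \<ge> 1" by (simp add: Suc_le_eq)
  have d: "norm (x - y) \<le> 2 * real CARD('n) * \<rho>" if "x \<in> sup_ball a \<rho>" "y \<in> sup_ball a \<rho>" for x y
  proof -
    have "infnorm (x - y) \<le> infnorm (x - a) + infnorm (a - y)" by (rule infnorm_triangle_sub)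
    also have "\<dots> \<le> 2 * \<rho>" using that infnorm_sub[of a y] unfolding sup_ball_def by auto
    finally have i: "infnorm (x - y) \<le> 2 * \<rho>" .
    have "real CARD('n) \<le> real CARD('n) * real CARD('n)" using mult_left_mono[OF n1, of "real CARD('n)"] by simp
    then have "sqrt (real CARD('n)) \<le> real CARD('n)" by (intro real_le_lsqrt) (simp_all add: power2_eq_square)
    then have "sqrt (real CARD('n)) * infnorm (x - y) \<le> real CARD('n) * (2 * \<rho>)"
      using i infnorm_pos_le by (intro mult_mono) auto
    then show ?thesis using norm_le_infnorm[of "x - y"] by simp
  qed
  show "diameter (sup_ball a \<rho>) \<le> 2 * real CARD('n) * \<rho>"
    using assms d by (intro diameter_le) auto
  show "bounded (sup_ball a \<rho>)"
  proof (cases "sup_ball a \<rho> = {}")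
    case False
    then obtain z where "z \<in> sup_ball a \<rho>" by auto
    then show ?thesis unfolding bounded_def using d by (intro exI[of _ z]) (auto simp: dist_norm)
  qed simp
qed

lemma card_int_vec_Icc:
  assumes "0 \<le> b"
  shows "finite {p :: int ^ 'n::finite. \<forall>i. \<bar>real_of_int (p $ i)\<bar> \<le> b}"
    and "real (card {p :: int ^ 'n. \<forall>i. \<bar>real_of_int (p $ i)\<bar> \<le> b}) \<le> (2 * b + 1) ^ CARD('n)"
proof -
  define B where "B = {m::int. - b \<le> real_of_int m \<and> real_of_int m \<le> b}"
  have e: "{p :: int ^ 'n. \<forall>i. \<bar>real_of_int (p $ i)\<bar> \<le> b} = {p. \<forall>i. p $ i \<in> B}"
    unfolding B_def abs_le_iff by (intro Collect_cong all_cong1) auto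
  have B: "finite B" "real (card B) \<le> 2 * b + 1"
    unfolding B_def using card_int_Icc_le[of "- b" b] assms by auto
  show "finite {p :: int ^ 'n::finite. \<forall>i. \<bar>real_of_int (p $ i)\<bar> \<le> b}" unfolding e using B by (intro finite_vec_box)
  have "card {p :: int ^ 'n. \<forall>i. p $ i \<in> B} = (\<Prod>i\<in>(UNIV :: 'n set). card B)" by (rule card_vec_box)
  then have "real (card {p :: int ^ 'n. \<forall>i. p $ i \<in> B}) = real (card B) ^ CARD('n)" by simp
  also have "\<dots> \<le> (2 * b + 1) ^ CARD('n)" using B by (intro power_mono) auto
  finally show "real (card {p :: int ^ 'n. \<forall>i. \<bar>real_of_int (p $ i)\<bar> \<le> b}) \<le> (2 * b + 1) ^ CARD('n)" unfolding e .
qed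

text \<open>Allows covers indexed by denominator and numerator, flattened by the pairing of
  naturals.\<close>

lemma premeasure_le_double_sum:
  fixes V :: "nat \<Rightarrow> nat \<Rightarrow> 'a::metric_space set"
  assumes "A \<subseteq> (\<Union>q. \<Union>j. V q j)" "\<And>q j. bounded (V q j)" "\<And>q j. diameter (V q j) \<le> \<delta>"
  shows "hausdorff_premeasure s \<delta> A \<le> (\<Sum>q. \<Sum>j. hausdorff_gauge s (V q j))"
proof -
  define U where "U = (\<lambda>i. V (fst (prod_decode i)) (snd (prod_decode i)))"
  have "(\<Sum>i. (\<lambda>(q, j). hausdorff_gauge s (V q j)) (prod_decode i)) = (\<Sum>q. \<Sum>j. hausdorff_gauge s (V q j))"
    by (rule suminf_ennreal_2dimen) simp
  then have e: "(\<Sum>i. hausdorff_gauge s (U i)) = (\<Sum>q. \<Sum>j. hausdorff_gauge s (V q j))"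
    unfolding U_def by (simp add: case_prod_unfold)
  have "A \<subseteq> (\<Union>i. U i)"
  proof
    fix x assume "x \<in> A"
    then obtain q j where "x \<in> V q j" using assms(1) by blast
    then have "x \<in> U (prod_encode (q, j))" unfolding U_def by simp
    then show "x \<in> (\<Union>i. U i)" by blast
  qed
  then have "hausdorff_premeasure s \<delta> A \<le> (\<Sum>i. hausdorff_gauge s (U i))"
    unfolding hausdorff_premeasure_def using assms(2,3) by (intro Inf_lower CollectI exI[of _ U]) (auto simp: U_def)
  then show ?thesis unfolding e .
qed

text \<open>A Borel-Cantelli argument: the balls with large denominators still cover the set, and
  their total cost is a tail of a convergent series.\<close>

lemma hausdorff_measure_W_zero:
  fixes Q :: "nat set" and \<tau> s \<nu> :: real
  assumes Q: "Q \<subseteq> {1..}" and \<tau>: "\<tau> > 0" and s: "s > 0"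
    and \<nu>: "real CARD('n::finite) + \<nu> < \<tau> * s" "(\<lambda>q. real q powr - \<nu>) summable_on Q"
  shows "hausdorff_measure s (W \<tau> Q :: (real ^ 'n) set) = 0"
proof -
  define n where "n = real CARD('n)"
  have n1: "n \<ge> 1" unfolding n_def by (simp add: Suc_le_eq)
  \<comment> \<open>Spends the whole margin in \<open>n + \<nu> < \<tau> * s\<close>: about
    \<open>q powr ((1 + \<alpha>) * n)\<close> balls of cost \<open>q powr - (\<tau> * s)\<close>
    give \<open>q powr - \<nu>\<close>.\<close>
  define \<alpha> where "\<alpha> = (\<tau> * s - n - \<nu>) / n"
  have \<alpha>: "\<alpha> > 0" "(1 + \<alpha>) * n - \<tau> * s = - \<nu>" using \<nu> n1 unfolding \<alpha>_def n_def by (auto simp: field_simps)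
  \<comment> \<open>The numerator range grows slightly faster than \<open>q\<close>, so that one cover serves the whole
    unbounded set at the cost of an arbitrarily small power.\<close>
  define P where "P = (\<lambda>q::nat. {p :: int ^ 'n. \<forall>i. \<bar>real_of_int (p $ i)\<bar> \<le> real q powr (1 + \<alpha>)})"
  have finP: "finite (P q)" for q unfolding P_def by (rule card_int_vec_Icc(1)) simp
  define C where "C = 3 ^ CARD('n) * (2 * n) powr s"
  have cP: "real (card (P q)) * (2 * n * real q powr - \<tau>) powr s \<le> C * real q powr - \<nu>" if q: "q > 0" for q
  proof -
    have "real (card (P q)) \<le> (2 * real q powr (1 + \<alpha>) + 1) ^ CARD('n)" unfolding P_def by (rule card_int_vec_Icc(2)) simp
    also have "\<dots> \<le> (3 * real q powr (1 + \<alpha>)) ^ CARD('n)"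
    proof (rule power_mono)
      have "1 \<le> real q powr (1 + \<alpha>)" using q \<alpha> by (intro ge_one_powr_ge_zero) auto
      then show "2 * real q powr (1 + \<alpha>) + 1 \<le> 3 * real q powr (1 + \<alpha>)" by simp
    qed simp
    also have "\<dots> = 3 ^ CARD('n) * real q powr ((1 + \<alpha>) * n)"
      using q unfolding n_def by (simp add: power_mult_distrib powr_realpow[symmetric] powr_powr)
    finally have c: "real (card (P q)) \<le> 3 ^ CARD('n) * real q powr ((1 + \<alpha>) * n)" .
    have e: "(2 * n * real q powr - \<tau>) powr s = (2 * n) powr s * real q powr - (\<tau> * s)"
      using n1 by (simp add: powr_mult powr_powr)
    have "real (card (P q)) * (2 * n * real q powr - \<tau>) powr s
       \<le> 3 ^ CARD('n) * real q powr ((1 + \<alpha>) * n) * ((2 * n) powr s * real q powr - (\<tau> * s))"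
      unfolding e using c by (rule mult_right_mono) simp
    also have "\<dots> = C * (real q powr ((1 + \<alpha>) * n) * real q powr - (\<tau> * s))" unfolding C_def by simp
    also have "real q powr ((1 + \<alpha>) * n) * real q powr - (\<tau> * s) = real q powr - \<nu>"
      using powr_add[of "real q" "(1 + \<alpha>) * n" "- (\<tau> * s)"] \<alpha>(2) by simp
    finally show ?thesis .
  qed
  define f where "f = (\<lambda>q. C * (if q \<in> Q then real q powr - \<nu> else 0))"
  have C0: "C \<ge> 0" unfolding C_def by simp
  have f0: "f q \<ge> 0" for q unfolding f_def using C0 by simp
  have sf: "summable f" unfolding f_def
    by (intro summable_mult summable_on_imp_summable_if \<nu>) simp
  have pre0: "hausdorff_premeasure s \<delta> (W \<tau> Q :: (real ^ 'n) set) = 0" if \<delta>: "\<delta> > 0" for \<delta>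
  proof -
    have le: "hausdorff_premeasure s \<delta> (W \<tau> Q :: (real ^ 'n) set) \<le> ennreal e" if e: "e > 0" for e
    proof -
      obtain q1 where q1: "\<And>m. m \<ge> q1 \<Longrightarrow> norm (\<Sum>i. f (i + m)) < e" using suminf_exist_split[OF e sf] by blast
      have "eventually (\<lambda>q::nat. 2 * n / \<delta> * real q powr - \<tau> \<le> real q powr 0) sequentially"
        using \<tau> by (intro eventually_powr_dominated) auto
      then obtain q2 where q2: "\<And>q. q \<ge> q2 \<Longrightarrow> 2 * n / \<delta> * real q powr - \<tau> \<le> real q powr 0"
        unfolding eventually_sequentially by blast
      \<comment> \<open>\<open>q1\<close> makes the tail of \<open>f\<close> small,
        \<open>q2\<close> makes the balls smaller than \<open>\<delta>\<close>, and 1 excludes the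
        denominator 0.\<close>
      define m where "m = max (max q1 q2) 1"
      obtain h where h: "\<And>q. bij_betw (h q) {0..<card (P q)} (P q)" using ex_bij_betw_nat_finite[OF finP] by metis
      define V where "V = (\<lambda>q j. if q \<in> Q \<and> m \<le> q \<and> j < card (P q) then sup_ball (rat_vec (h q j) q) (real q powr - \<tau>) else {})"
      have dq: "2 * n * real q powr - \<tau> \<le> \<delta>" if "m \<le> q" for q
        using q2[of q] that \<delta> unfolding m_def by (simp add: field_simps)
      have diamV: "diameter (V q j) \<le> 2 * n * real q powr - \<tau>" for q j
        unfolding V_def n_def using sup_ball_bounds(2)[of "real q powr - \<tau>"] by auto
      have bV: "bounded (V q j)" for q j unfolding V_def using sup_ball_bounds(1)[of "real q powr - \<tau>"] by auto
      have dV: "diameter (V q j) \<le> \<delta>" for q j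
      proof (cases "m \<le> q")
        case True
        then show ?thesis using diamV[of q j] dq[of q] by linarith
      next
        case False
        then show ?thesis unfolding V_def using \<delta> by simp
      qed
      have cov: "W \<tau> Q \<subseteq> (\<Union>q. \<Union>j. V q j)"
      proof
        fix x :: "real ^ 'n" assume x: "x \<in> W \<tau> Q"
        \<comment> \<open>How large \<open>q\<close> must be depends on \<open>x\<close>, which is
          harmless: \<open>x\<close> has approximations with arbitrarily large
          \<open>q\<close>.\<close>
        have "eventually (\<lambda>q::nat. (infnorm x + 1) * real q powr 0 \<le> real q powr \<alpha>) sequentially"
          using \<alpha> by (intro eventually_powr_dominated) auto
        then obtain q3 where q3: "\<And>q. q \<ge> q3 \<Longrightarrow> (infnorm x + 1) * real q powr 0 \<le> real q powr \<alpha>"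
          unfolding eventually_sequentially by blast
        obtain p q where pq: "q \<in> Q" "max m q3 < q" "infnorm (x - rat_vec p q) < real q powr - \<tau>"
          using approx_infinite_imp_large[OF x Q] by blast
        have q0: "q > 0" using pq(2) by simp
        have q\<alpha>: "infnorm x + 1 \<le> real q powr \<alpha>" using q3[of q] pq(2) by simp
        have q\<tau>: "real q powr - \<tau> \<le> 1" using powr_mono[of "- \<tau>" 0 "real q"] q0 \<tau> by simp
        have "p \<in> P q" unfolding P_def
        proof (rule CollectI, rule allI)
          fix i
          have "\<bar>x $ i\<bar> \<le> infnorm x" using infnorm_le_vec by blast
          moreover have "\<bar>x $ i - rat_vec p q $ i\<bar> < real q powr - \<tau>" using pq(3) unfolding infnorm_less_vec by simp
          ultimately have "\<bar>rat_vec p q $ i\<bar> \<le> real q powr \<alpha>" using q\<alpha> q\<tau> by linarith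
          then have "real q * \<bar>rat_vec p q $ i\<bar> \<le> real q * real q powr \<alpha>" by (rule mult_left_mono) simp
          moreover have "real q * \<bar>rat_vec p q $ i\<bar> = \<bar>real_of_int (p $ i)\<bar>" using q0 by (simp add: rat_vec_def)
          moreover have "real q * real q powr \<alpha> = real q powr (1 + \<alpha>)" using q0 by (simp add: powr_add)
          ultimately show "\<bar>real_of_int (p $ i)\<bar> \<le> real q powr (1 + \<alpha>)" by simp
        qed
        then obtain j where j: "j < card (P q)" "h q j = p" using h[of q] unfolding bij_betw_def by force
        have "x \<in> V q j" using pq j unfolding V_def sup_ball_def by simp
        then show "x \<in> (\<Union>q. \<Union>j. V q j)" by blast
      qed
      have ind: "(\<Sum>j. hausdorff_gauge s (V q j)) \<le> ennreal (if m \<le> q then f q else 0)" for q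
      proof (cases "q \<in> Q \<and> m \<le> q")
        case True
        have "(\<Sum>j. hausdorff_gauge s (V q j)) = (\<Sum>j<card (P q). hausdorff_gauge s (V q j))"
          by (rule suminf_finite) (auto simp: V_def hausdorff_gauge_def)
        also have "\<dots> \<le> (\<Sum>j<card (P q). ennreal ((2 * n * real q powr - \<tau>) powr s))"
        proof (rule sum_mono)
          fix j
          have "diameter (V q j) powr s \<le> (2 * n * real q powr - \<tau>) powr s"
            using diameter_ge_0[OF bV] diamV s by (intro powr_mono2) auto
          then show "hausdorff_gauge s (V q j) \<le> ennreal ((2 * n * real q powr - \<tau>) powr s)"
            using s unfolding hausdorff_gauge_def by (auto intro: ennreal_leI)
        qed
        also have "\<dots> = ennreal (real (card (P q)) * (2 * n * real q powr - \<tau>) powr s)"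
          by (simp add: ennreal_mult ennreal_of_nat_eq_real_of_nat)
        also have "\<dots> \<le> ennreal (if m \<le> q then f q else 0)"
          using cP[of q] True unfolding f_def m_def by (auto intro!: ennreal_leI)
        finally show ?thesis .
      next
        case False
        then have "V q j = {}" for j unfolding V_def by auto
        then show ?thesis by (simp add: hausdorff_gauge_def)
      qed
      define F where "F = (\<lambda>q. if m \<le> q then f q else 0)"
      have F0: "F q \<ge> 0" for q unfolding F_def using f0 by simp
      have sF: "summable F" unfolding F_def by (rule summable_comparison_test'[OF sf, of 0]) (auto simp: f0)
      have "suminf F = (\<Sum>i. F (i + m)) + (\<Sum>i<m. F i)" by (rule suminf_split_initial_segment[OF sF])
      also have "(\<Sum>i<m. F i) = 0" unfolding F_def by (intro sum.neutral) auto
      also have "(\<lambda>i. F (i + m)) = (\<lambda>i. f (i + m))" unfolding F_def by auto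
      finally have "suminf F = (\<Sum>i. f (i + m))" by simp
      moreover have "norm (\<Sum>i. f (i + m)) < e" by (rule q1) (simp add: m_def)
      ultimately have Fe: "suminf F \<le> e" by (simp add: abs_less_iff)
      have "hausdorff_premeasure s \<delta> (W \<tau> Q :: (real ^ 'n) set) \<le> (\<Sum>q. \<Sum>j. hausdorff_gauge s (V q j))"
        by (rule premeasure_le_double_sum[OF cov bV dV])
      also have "\<dots> \<le> (\<Sum>q. ennreal (F q))" unfolding F_def by (intro suminf_le ind) auto
      also have "\<dots> = ennreal (suminf F)" by (rule suminf_ennreal2[OF F0 sF])
      also have "\<dots> \<le> ennreal e" using Fe by (rule ennreal_leI)
      finally show ?thesis .
    qed
    have "hausdorff_premeasure s \<delta> (W \<tau> Q :: (real ^ 'n) set) \<le> 0"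
      by (rule ennreal_le_epsilon) (simp add: le)
    then show ?thesis by simp
  qed
  show ?thesis unfolding hausdorff_measure_def
    by (intro antisym SUP_least) (simp_all add: pre0)
qed

lemma hausdorff_measure_mono: "A \<subseteq> B \<Longrightarrow> hausdorff_measure s A \<le> hausdorff_measure s B"
  unfolding hausdorff_measure_def hausdorff_premeasure_def
  by (intro SUP_mono' Inf_superset_mono Collect_mono impI) (blast intro: order_trans)

lemma W_star_subset: "W_star \<tau> Q \<subseteq> W \<tau> Q"
proof
  fix x :: "real ^ 'n" assume x: "x \<in> W_star \<tau> Q"
  define A where "A = (\<lambda>S. {(p :: int ^ 'n, q). q \<in> S \<and> infnorm (x - rat_vec p q) < real q powr - \<tau>})"
  have "infinite (A {1..})" "finite (A ({1..} - Q))" using x unfolding W_star_def W_def A_def by auto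
  moreover have "A {1..} \<subseteq> A ({1..} - Q) \<union> A Q" unfolding A_def by auto
  ultimately have "infinite (A Q)" using finite_subset[of "A {1..}"] finite_UnI by blast
  then show "x \<in> W \<tau> Q" unfolding W_def A_def by simp
qed

theorem theorem1:
  fixes Q :: "nat set" and \<tau> :: real
  assumes "Q \<subseteq> {1..}" and "infinite Q"
    and "\<tau> > 2 + 1 / real CARD('n::finite)"
  shows "hausdorff_dim (W_star \<tau> Q :: (real ^ 'n) set)
           = ereal ((real CARD('n) + conv_exponent Q) / \<tau>)"
proof (rule antisym)
  let ?T = "(real CARD('n) + conv_exponent Q) / \<tau>"
  have "0 < 1 / real CARD('n)" by simp
  then have \<tau>: "\<tau> > 0" using assms(3) by linarith
  show "hausdorff_dim (W_star \<tau> Q :: (real ^ 'n) set) \<le> ereal ?T"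
  proof (rule ereal_le_epsilon2)
    fix e :: real assume e: "e > 0"
    define s where "s = ?T + e"
    have T: "?T \<ge> 0" using \<tau> conv_exponent_nonneg[of Q] by simp
    then have s: "s > 0" using e unfolding s_def by linarith
    have "\<tau> * s = real CARD('n) + conv_exponent Q + \<tau> * e" using \<tau> unfolding s_def by (simp add: field_simps)
    moreover have "\<tau> * e > 0" using \<tau> e by simp
    ultimately have "conv_exponent Q < \<tau> * s - real CARD('n)" by linarith
    from conv_exponent_less[OF this] obtain \<nu> where \<nu>: "\<nu> < \<tau> * s - real CARD('n)" "(\<lambda>q. real q powr - \<nu>) summable_on Q"
      by blast
    have "real CARD('n) + \<nu> < \<tau> * s" using \<nu>(1) by linarith
    then have "hausdorff_measure s (W \<tau> Q :: (real ^ 'n) set) = 0"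
      using hausdorff_measure_W_zero[OF assms(1) \<tau> s _ \<nu>(2)] by blast
    then have "hausdorff_measure s (W_star \<tau> Q :: (real ^ 'n) set) = 0"
      using hausdorff_measure_mono[OF W_star_subset, of s \<tau> Q] by (metis le_zero_eq)
    then have "hausdorff_dim (W_star \<tau> Q :: (real ^ 'n) set) \<le> ereal s"
      unfolding hausdorff_dim_def using s by (intro Inf_lower) auto
    then show "hausdorff_dim (W_star \<tau> Q :: (real ^ 'n) set) \<le> ereal ?T + ereal e" unfolding s_def by simp
  qed
  show "ereal ?T \<le> hausdorff_dim (W_star \<tau> Q :: (real ^ 'n) set)"
    unfolding hausdorff_dim_def
  proof (rule Inf_greatest)
    fix y assume "y \<in> {ereal s | s. 0 \<le> s \<and> hausdorff_measure s (W_star \<tau> Q :: (real ^ 'n) set) = 0}"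
    then obtain s where s: "y = ereal s" "0 \<le> s" "hausdorff_measure s (W_star \<tau> Q :: (real ^ 'n) set) = 0" by blast
    then have "\<not> s < ?T" using hausdorff_measure_W_star_pos[OF assms] by blast
    then show "ereal ?T \<le> y" unfolding s(1) by simp
  qed
qed

end
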